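(* Let $\Gamma$ be a discrete group. If $E\subset\Gamma$ is convergently embedded in $K$ for some locally compact group $K$, then $E$ is a Riesz set.
   Context: $A(\Gamma)$ and $B(\Gamma)$ are the Fourier and Fourier–Stieltjes algebras of $\Gamma$. $E\subseteq\Gamma$ is a Riesz set if every function in $B(\Gamma)$ vanishing off $E$ belongs to $A(\Gamma)$. A countable set $E\subset\Gamma$ is convergently embedded in a locally compact (Hausdorff) group $K$ if there is an injective group homomorphism $\alpha:\langle E\rangle\to K$ with dense range, where $\langle E\rangle$ is the subgroup of $\Gamma$ generated by $E$, such that $\alpha(E)$ is relatively compact and has exactly one limit point $p\in K$, and $p\notin\alpha(E)$. *)

theory Defs
  imports "HOL-Analysis.Analysis" "HOL-Algebra.Generated_Groups"
begin

text \<open>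
  A discrete group is a group of HOL-Algebra. A complex function on it is a map
  \<open>'a \<Rightarrow> complex\<close> of which only the values on the carrier matter; all notions below
  are insensitive to the values outside the carrier.
\<close>

definition positive_definite :: "('a, 'm) monoid_scheme \<Rightarrow> ('a \<Rightarrow> complex) \<Rightarrow> bool" where
  "positive_definite G \<phi> \<longleftrightarrow>
     (\<forall>F c. finite F \<and> F \<subseteq> carrier G \<longrightarrow>
        (\<Sum>x\<in>F. \<Sum>y\<in>F. cnj (c x) * c y * \<phi> (inv\<^bsub>G\<^esub> x \<otimes>\<^bsub>G\<^esub> y)) \<in> \<real>\<^sub>\<ge>\<^sub>0)"

text \<open>
  \<open>B(G)\<close> is the complex linear span of the positive definite functions (which are
  automatically continuous, the group being discrete).
\<close>

definition fourier_stieltjes_algebra :: "('a, 'm) monoid_scheme \<Rightarrow> ('a \<Rightarrow> complex) set" where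
  "fourier_stieltjes_algebra G =
     {u. \<exists>(n::nat) c \<phi>. (\<forall>i<n. positive_definite G (\<phi> i)) \<and>
                        (\<forall>x\<in>carrier G. u x = (\<Sum>i<n. c i * \<phi> i x))}"

definition l2 :: "'a set \<Rightarrow> ('a \<Rightarrow> complex) set" where
  "l2 A = {\<xi>. (\<lambda>h. (cmod (\<xi> h))\<^sup>2) summable_on A}"

definition l2_inner :: "'a set \<Rightarrow> ('a \<Rightarrow> complex) \<Rightarrow> ('a \<Rightarrow> complex) \<Rightarrow> complex" where
  "l2_inner A \<xi> \<eta> = (\<Sum>\<^sub>\<infinity>h\<in>A. \<xi> h * cnj (\<eta> h))"

definition left_regular :: "('a, 'm) monoid_scheme \<Rightarrow> 'a \<Rightarrow> ('a \<Rightarrow> complex) \<Rightarrow> ('a \<Rightarrow> complex)" where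
  "left_regular G x \<xi> = (\<lambda>h. \<xi> (inv\<^bsub>G\<^esub> x \<otimes>\<^bsub>G\<^esub> h))"

text \<open>
  \<open>A(G)\<close> is the set of coefficient functions of the left regular representation on
  \<open>\<ell>\<^sup>2(G)\<close>.
\<close>

definition fourier_algebra :: "('a, 'm) monoid_scheme \<Rightarrow> ('a \<Rightarrow> complex) set" where
  "fourier_algebra G =
     {u. \<exists>\<xi>\<in>l2 (carrier G). \<exists>\<eta>\<in>l2 (carrier G).
           \<forall>x\<in>carrier G. u x = l2_inner (carrier G) (left_regular G x \<xi>) \<eta>}"

definition Riesz_set :: "('a, 'm) monoid_scheme \<Rightarrow> 'a set \<Rightarrow> bool" where
  "Riesz_set G E \<longleftrightarrow>
     (\<forall>u\<in>fourier_stieltjes_algebra G.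
        (\<forall>x\<in>carrier G - E. u x = 0) \<longrightarrow> u \<in> fourier_algebra G)"

definition locally_compact_group :: "('k, 'n) monoid_scheme \<Rightarrow> 'k topology \<Rightarrow> bool" where
  "locally_compact_group K T \<longleftrightarrow>
     group K \<and> topspace T = carrier K \<and>
     continuous_map (prod_topology T T) T (\<lambda>(x, y). x \<otimes>\<^bsub>K\<^esub> y) \<and>
     continuous_map T T (\<lambda>x. inv\<^bsub>K\<^esub> x) \<and>
     locally_compact_space T \<and> Hausdorff_space T"

definition convergently_embedded ::
  "('a, 'm) monoid_scheme \<Rightarrow> 'a set \<Rightarrow> ('k, 'n) monoid_scheme \<Rightarrow> 'k topology \<Rightarrow> bool" where
  "convergently_embedded G E K T \<longleftrightarrow>
     countable E \<and>
     (\<exists>\<alpha> p. \<alpha> \<in> hom (subgroup_generated G E) K \<and>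
            inj_on \<alpha> (carrier (subgroup_generated G E)) \<and>
            T closure_of (\<alpha> ` carrier (subgroup_generated G E)) = topspace T \<and>
            compactin T (T closure_of (\<alpha> ` E)) \<and>
            T derived_set_of (\<alpha> ` E) = {p} \<and>
            p \<notin> \<alpha> ` E)"

end

theory Submission
  imports Defs
begin

text \<open>
  Let \<open>H\<close> be the group generated by \<open>E\<close>, embedded in \<open>K\<close> by \<open>\<alpha>\<close>. A function \<open>u\<close> in \<open>B(H)\<close> is a
  coefficient \<open>\<langle>\<pi> x \<xi>, \<eta>\<rangle>\<close> of a representation. For \<open>a, b\<close> in \<open>C\<^sub>c(K)\<close> the product of \<open>u\<close> with
  \<open>x \<mapsto> \<langle>translate (\<alpha> x) a, b\<rangle>\<close> is a coefficient of \<open>\<rho> = \<pi> \<otimes> (\<lambda>\<^sub>K \<circ> \<alpha>)\<close>. If \<open>a\<close> is supported near \<open>1\<close> and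
  \<open>b = 1\<close> near \<open>p\<close>, this product equals \<open>(\<integral>a) u\<close> up to finitely many points, because \<open>u\<close> lives on a
  sequence converging to \<open>p\<close>. So it suffices that the part of the coefficient carried by the singular
  summand of \<open>\<rho>\<close>, the complement of the largest subrepresentation quasi-contained in the regular
  representation, vanishes. By disjointness this part is insensitive to changes at finitely many
  points, hence, up to the factor \<open>\<integral>a\<close>, it does not depend on \<open>a\<close> and \<open>b\<close>. On the other hand Fell
  absorption shows that the singular summand is invariant under multiplication by functions
  \<open>conv a b\<close> on \<open>K\<close>; for \<open>\<alpha> x \<noteq> p\<close> such a function separates the supports of \<open>translate (\<alpha> x) a\<close> and
  \<open>b\<close> once these are small, and the singular part vanishes at \<open>x\<close>. Finally the coefficients of an
  absolutely continuous vector are coefficients of the regular representation itself, by the polar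
  decomposition of an injective intertwiner. Hilbert spaces are real throughout: real and imaginary
  part of \<open>u\<close> are coefficients of the same vector.
\<close>

section \<open>Square-summable families\<close>

text \<open>Disjointness enters in one form only: a bounded intertwiner carries absolutely
  continuous vectors to absolutely continuous vectors. A change at finitely many points is a
  square-summable function, that is a coefficient of the regular representation, and so it is
  invisible to the singular part.

  Multiplication by a function on \<open>K\<close> does not commute with the representation, so this
  principle does not apply to it directly. For the function \<open>conv a b\<close> the product with
  a vector w is the image of the tensor of w and a under a bounded intertwiner, and that tensor
  inherits boundedness from w because the values of the translates of a can be absorbed into the
  weights. This is why the separating multipliers are convolutions.

  The separation argument says nothing where \<open>\<alpha> x = p\<close>. Injectivity leaves at
  most one such x, and a coefficient with finite support is again regular, so disjointness removes
  it as well. The finitely many points at which the cut-off product differs from u are returned at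
  the end as a square-summable correction.\<close>

typedef 'a ell2 = "{f::'a \<Rightarrow> real. (\<lambda>x. (f x)\<^sup>2) summable_on UNIV}"
  morphisms coord Abs_ell2
  by (rule exI[of _ "\<lambda>_. 0"]) simp

setup_lifting type_definition_ell2

lemma ell2_eqI: "(\<And>i. coord f i = coord g i) \<Longrightarrow> f = g"
  by (metis coord_inject ext)

lemma coord_square_summable: "(\<lambda>i. (coord f i)\<^sup>2) summable_on UNIV"
  using coord[of f] by simp

lemma square_summable_times:
  fixes f g :: "'a \<Rightarrow> real"
  assumes "(\<lambda>i. (f i)\<^sup>2) summable_on A" "(\<lambda>i. (g i)\<^sup>2) summable_on A"
  shows "(\<lambda>i. f i * g i) summable_on A"
proof (rule abs_summable_summable, rule summable_on_comparison_test[where f = "\<lambda>i. (f i)\<^sup>2 + (g i)\<^sup>2"])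
  show "(\<lambda>i. (f i)\<^sup>2 + (g i)\<^sup>2) summable_on A"
    using assms by (rule summable_on_add)
  show "norm (f i * g i) \<le> (f i)\<^sup>2 + (g i)\<^sup>2" for i
  proof -
    have "2 * \<bar>f i * g i\<bar> \<le> (f i)\<^sup>2 + (g i)\<^sup>2"
      using sum_squares_bound[of "\<bar>f i\<bar>" "\<bar>g i\<bar>"] by (simp add: abs_mult)
    moreover have "0 \<le> \<bar>f i * g i\<bar>" by simp
    ultimately show ?thesis unfolding real_norm_def by linarith
  qed
qed simp

lemma square_summable_add:
  fixes f g :: "'a \<Rightarrow> real"
  assumes "(\<lambda>i. (f i)\<^sup>2) summable_on A" "(\<lambda>i. (g i)\<^sup>2) summable_on A"
  shows "(\<lambda>i. (f i + g i)\<^sup>2) summable_on A"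
  unfolding power2_sum
  using summable_on_add[OF summable_on_add[OF assms] summable_on_cmult_right[OF square_summable_times[OF assms], of 2]]
  by (simp add: mult.assoc)

instantiation ell2 :: (type) real_vector
begin

lift_definition zero_ell2 :: "'a ell2" is "\<lambda>_. 0" by simp

lift_definition plus_ell2 :: "'a ell2 \<Rightarrow> 'a ell2 \<Rightarrow> 'a ell2" is "\<lambda>f g i. f i + g i"
  by (rule square_summable_add)

lift_definition scaleR_ell2 :: "real \<Rightarrow> 'a ell2 \<Rightarrow> 'a ell2" is "\<lambda>r f i. r * f i"
  by (simp add: power_mult_distrib summable_on_cmult_right)

lift_definition uminus_ell2 :: "'a ell2 \<Rightarrow> 'a ell2" is "\<lambda>f i. - f i" by simp

definition minus_ell2 :: "'a ell2 \<Rightarrow> 'a ell2 \<Rightarrow> 'a ell2" where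
  "minus_ell2 f g = f + - g"

instance
proof
  fix f g h :: "'a ell2" and r s :: real
  show "f + g + h = f + (g + h)" by transfer (simp add: add.assoc)
  show "f + g = g + f" by transfer (simp add: add.commute)
  show "0 + f = f" by transfer simp
  show "- f + f = 0" by transfer simp
  show "f - g = f + - g" by (rule minus_ell2_def)
  show "r *\<^sub>R (f + g) = r *\<^sub>R f + r *\<^sub>R g" by transfer (simp add: distrib_left)
  show "(r + s) *\<^sub>R f = r *\<^sub>R f + s *\<^sub>R f" by transfer (simp add: distrib_right)
  show "r *\<^sub>R s *\<^sub>R f = (r * s) *\<^sub>R f" by transfer (simp add: mult.assoc)
  show "1 *\<^sub>R f = f" by transfer simp
qed

end

instantiation ell2 :: (type) real_inner
begin

definition inner_ell2 :: "'a ell2 \<Rightarrow> 'a ell2 \<Rightarrow> real" where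
  "inner_ell2 f g = (\<Sum>\<^sub>\<infinity>i. coord f i * coord g i)"

definition norm_ell2 :: "'a ell2 \<Rightarrow> real" where "norm_ell2 f = sqrt (f \<bullet> f)"

definition sgn_ell2 :: "'a ell2 \<Rightarrow> 'a ell2" where "sgn_ell2 f = f /\<^sub>R norm f"

definition dist_ell2 :: "'a ell2 \<Rightarrow> 'a ell2 \<Rightarrow> real" where "dist_ell2 f g = norm (f - g)"

definition uniformity_ell2 :: "('a ell2 \<times> 'a ell2) filter" where
  "uniformity_ell2 = (INF e\<in>{0<..}. principal {(x, y). dist x y < e})"

definition open_ell2 :: "'a ell2 set \<Rightarrow> bool" where
  "open_ell2 U \<longleftrightarrow> (\<forall>x\<in>U. eventually (\<lambda>(x', y). x' = x \<longrightarrow> y \<in> U) uniformity)"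

instance
proof
  fix f g h :: "'a ell2" and r s :: real
  have summ: "(\<lambda>i. coord f i * coord g i) summable_on UNIV" for f g :: "'a ell2"
    by (intro square_summable_times coord_square_summable)
  show "sgn f = f /\<^sub>R norm f" by (rule sgn_ell2_def)
  show "dist f g = norm (f - g)" by (rule dist_ell2_def)
  show "uniformity = (INF e\<in>{0<..}. principal {(x::'a ell2, y). dist x y < e})"
    by (rule uniformity_ell2_def)
  show "open U \<longleftrightarrow> (\<forall>x\<in>U. eventually (\<lambda>(x', y). x' = x \<longrightarrow> y \<in> U) uniformity)" for U :: "'a ell2 set"
    by (rule open_ell2_def)
  show "f \<bullet> g = g \<bullet> f" by (simp add: inner_ell2_def mult.commute)
  show "(f + g) \<bullet> h = f \<bullet> h + g \<bullet> h"
    by (simp add: inner_ell2_def plus_ell2.rep_eq distrib_right infsum_add summ)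
  show "(r *\<^sub>R f) \<bullet> g = r * (f \<bullet> g)"
    by (simp add: inner_ell2_def scaleR_ell2.rep_eq mult.assoc infsum_cmult_right')
  show "0 \<le> f \<bullet> f" by (simp add: inner_ell2_def infsum_nonneg)
  show "f \<bullet> f = 0 \<longleftrightarrow> f = 0"
  proof
    assume "f \<bullet> f = 0"
    then have "coord f i * coord f i = 0" for i
      unfolding inner_ell2_def by (intro nonneg_infsum_le_0D[where A = UNIV] summ) auto
    then show "f = 0" by (intro ell2_eqI) (simp add: zero_ell2.rep_eq)
  qed (simp add: inner_ell2_def zero_ell2.rep_eq)
  show "norm f = sqrt (f \<bullet> f)" by (rule norm_ell2_def)
qed

end

lemma coord_minus [simp]: "coord (f - g) i = coord f i - coord g i"
  unfolding minus_ell2_def plus_ell2.rep_eq uminus_ell2.rep_eq by simp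

lemmas coord_simps [simp] = zero_ell2.rep_eq plus_ell2.rep_eq scaleR_ell2.rep_eq uminus_ell2.rep_eq

lift_definition unit :: "'a \<Rightarrow> 'a ell2" is "\<lambda>a i. of_bool (i = a)"
proof -
  show "(\<lambda>i. (of_bool (i = a) :: real)\<^sup>2) summable_on UNIV" for a :: 'a
    by (rule summable_on_cong_neutral[where S = "{a}", THEN iffD1]) auto
qed

lemma coord_unit [simp]: "coord (unit a) i = of_bool (i = a)"
  by (rule unit.rep_eq[THEN fun_cong])

lemma inner_unit_right: "f \<bullet> unit a = coord f a"
proof -
  have "f \<bullet> unit a = (\<Sum>\<^sub>\<infinity>i\<in>{a}. coord f i)"
    unfolding inner_ell2_def by (rule infsum_cong_neutral) auto
  then show ?thesis by simp
qed

lemma inner_unit_left: "unit a \<bullet> f = coord f a"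
  by (simp add: inner_commute inner_unit_right)

lemma norm_unit [simp]: "norm (unit a) = 1"
  by (simp add: norm_eq_sqrt_inner inner_unit_right)

lemma finite_sum_coord_le: "finite F \<Longrightarrow> (\<Sum>i\<in>F. (coord f i)\<^sup>2) \<le> (norm f)\<^sup>2"
  unfolding power2_norm_eq_inner inner_ell2_def power2_eq_square[symmetric]
  by (intro finite_sum_le_infsum coord_square_summable) auto

lemma norm_ell2_leI:
  assumes "\<And>F. finite F \<Longrightarrow> (\<Sum>i\<in>F. (coord f i)\<^sup>2) \<le> e\<^sup>2" "0 \<le> e"
  shows "norm f \<le> e"
proof -
  have "(norm f)\<^sup>2 \<le> e\<^sup>2"
    unfolding power2_norm_eq_inner inner_ell2_def power2_eq_square[symmetric]
    using assms(1) by (intro infsum_le_finite_sums coord_square_summable) (auto simp: power2_eq_square)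
  then show ?thesis using assms(2) by (rule power2_le_imp_le)
qed

text \<open>The limit is taken coordinatewise. The Cauchy estimate is kept as a bound on all finite
  partial sums, since these, unlike the norm, pass to a coordinatewise limit.\<close>

instance ell2 :: (type) complete_space
proof
  fix X :: "nat \<Rightarrow> 'a ell2"
  assume X: "Cauchy X"
  have coord_le: "\<bar>coord f i\<bar> \<le> norm f" for f :: "'a ell2" and i
    using Cauchy_Schwarz_ineq2[of f "unit i"] by (simp add: inner_unit_right)
  have "Cauchy (\<lambda>n. coord (X n) i)" for i
  proof (rule metric_CauchyI)
    fix e :: real assume "e > 0"
    then obtain M where M: "\<And>m n. m \<ge> M \<Longrightarrow> n \<ge> M \<Longrightarrow> dist (X m) (X n) < e"
      using metric_CauchyD[OF X] by meson
    then have "dist (coord (X m) i) (coord (X n) i) < e" if "m \<ge> M" "n \<ge> M" for m n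
      using le_less_trans[OF coord_le[of "X m - X n" i]] M[OF that] by (simp add: dist_norm)
    then show "\<exists>M. \<forall>m\<ge>M. \<forall>n\<ge>M. dist (coord (X m) i) (coord (X n) i) < e" by blast
  qed
  then have f: "(\<lambda>n. coord (X n) i) \<longlonglongrightarrow> lim (\<lambda>n. coord (X n) i)" for i
    by (simp add: Cauchy_convergent convergent_LIMSEQ_iff[symmetric])
  define f where "f i = lim (\<lambda>n. coord (X n) i)" for i
  note f = f[folded f_def]
  have part: "\<exists>M. \<forall>n\<ge>M. \<forall>F. finite F \<longrightarrow> (\<Sum>i\<in>F. (coord (X n) i - f i)\<^sup>2) \<le> e\<^sup>2" if e: "e > 0" for e
  proof -
    obtain M where M: "\<And>m n. m \<ge> M \<Longrightarrow> n \<ge> M \<Longrightarrow> dist (X m) (X n) < e"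
      using metric_CauchyD[OF X e] by meson
    have "(\<Sum>i\<in>F. (coord (X n) i - f i)\<^sup>2) \<le> e\<^sup>2" if "n \<ge> M" "finite F" for n F
    proof (rule LIMSEQ_le_const2)
      show "(\<lambda>m. \<Sum>i\<in>F. (coord (X n) i - coord (X m) i)\<^sup>2) \<longlonglongrightarrow> (\<Sum>i\<in>F. (coord (X n) i - f i)\<^sup>2)"
        by (intro tendsto_intros f)
      have "(\<Sum>i\<in>F. (coord (X n) i - coord (X m) i)\<^sup>2) \<le> e\<^sup>2" if "m \<ge> M" for m
      proof -
        have "(\<Sum>i\<in>F. (coord (X n - X m) i)\<^sup>2) \<le> (norm (X n - X m))\<^sup>2"
          using \<open>finite F\<close> by (rule finite_sum_coord_le)
        also have "\<dots> \<le> e\<^sup>2"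
          using M[OF \<open>n \<ge> M\<close> that] by (intro power_mono) (auto simp: dist_norm)
        finally show ?thesis by simp
      qed
      then show "\<exists>N. \<forall>m\<ge>N. (\<Sum>i\<in>F. (coord (X n) i - coord (X m) i)\<^sup>2) \<le> e\<^sup>2" by blast
    qed
    then show ?thesis by blast
  qed
  obtain M where M: "\<And>F. finite F \<Longrightarrow> (\<Sum>i\<in>F. (coord (X M) i - f i)\<^sup>2) \<le> 1"
    using part[of 1] by auto
  have "(\<lambda>i. (coord (X M) i - f i)\<^sup>2) summable_on UNIV"
    by (rule nonneg_bdd_above_summable_on) (auto intro!: bdd_aboveI[where M = 1] M)
  then have "(\<lambda>i. (f i - coord (X M) i)\<^sup>2) summable_on UNIV" by (simp add: power2_commute)
  from square_summable_add[OF this coord_square_summable[of "X M"]]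
  have "(\<lambda>i. (f i)\<^sup>2) summable_on UNIV" by simp
  then have f': "coord (Abs_ell2 f) = f" by (simp add: Abs_ell2_inverse)
  have "X \<longlonglongrightarrow> Abs_ell2 f"
  proof (rule metric_LIMSEQ_I)
    fix e :: real assume "e > 0"
    then obtain M where M: "\<And>n F. n \<ge> M \<Longrightarrow> finite F \<Longrightarrow> (\<Sum>i\<in>F. (coord (X n) i - f i)\<^sup>2) \<le> (e/2)\<^sup>2"
      using part[of "e/2"] by auto
    have "norm (X n - Abs_ell2 f) \<le> e/2" if "n \<ge> M" for n
      using M[OF that] \<open>e > 0\<close> by (intro norm_ell2_leI) (auto simp: f')
    then have "dist (X n) (Abs_ell2 f) < e" if "n \<ge> M" for n
      using that \<open>e > 0\<close> by (fastforce simp: dist_norm)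
    then show "\<exists>M. \<forall>n\<ge>M. dist (X n) (Abs_ell2 f) < e" by blast
  qed
  then show "convergent X" by (rule convergentI)
qed

instance ell2 :: (type) banach ..

section \<open>Hilbert space tools\<close>

lemma quadratic_nonneg_imp:
  fixes a b c :: real
  assumes "\<And>t. 0 \<le> a * t\<^sup>2 + 2 * b * t + c"
  shows "b\<^sup>2 \<le> a * c"
proof (cases "a = 0")
  case True
  have "b = 0"
  proof (rule ccontr)
    assume "b \<noteq> 0"
    then show False using assms[of "(- c - 1) / (2 * b)"] True by (simp add: field_simps)
  qed
  with True show ?thesis by simp
next
  case False
  have "0 \<le> a"
  proof (rule ccontr)
    assume a: "\<not> 0 \<le> a"
    have "0 \<le> a * 1\<^sup>2 + 2 * b * 1 + c" "0 \<le> a * (- 1)\<^sup>2 + 2 * b * (- 1) + c"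
      using assms by blast+
    then have c: "c > 0" using a by simp
    \<comment> \<open>\<open>t\<close> is at least 1 and so large that \<open>a * t\<close>
      outweighs \<open>\<bar>2 * b\<bar> + c\<close>; one more factor \<open>t\<close> then makes
      the whole quadratic negative.\<close>
    define t where "t = (\<bar>2 * b\<bar> + c) / (- a) + 1"
    have "t \<ge> 1" using a c by (simp add: t_def field_simps)
    have "a * t = - (\<bar>2 * b\<bar> + c) + a" using a by (simp add: t_def field_simps)
    then have "a * t\<^sup>2 = (- (\<bar>2 * b\<bar> + c) + a) * t" by (metis mult.assoc power2_eq_square)
    then have "a * t\<^sup>2 + 2 * b * t + c = (2 * b - \<bar>2 * b\<bar>) * t + (c - c * t) + a * t"
      by (simp add: algebra_simps)
    moreover have "(2 * b - \<bar>2 * b\<bar>) * t \<le> 0" "c - c * t \<le> 0" "a * t < 0"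
      using \<open>t \<ge> 1\<close> c a by (auto intro: mult_nonpos_nonneg mult_neg_pos)
    ultimately show False using assms[of t] by linarith
  qed
  with False have "a > 0" by simp
  then show ?thesis using assms[of "- b / a"] by (simp add: field_simps power2_eq_square)
qed

text \<open>
  A subspace of \<open>H \<times> \<real>\<close> that is bounded in this sense is the graph of a bounded functional;
  the representing vector minimizes \<open>\<parallel>w\<parallel>\<^sup>2 - 2 r\<close> over the graph.
\<close>

lemma riesz_graph:
  fixes G :: "('h::{real_inner,banach} \<times> real) set"
  assumes G: "subspace G" and bound: "\<And>w r. (w, r) \<in> G \<Longrightarrow> \<bar>r\<bar> \<le> M * norm w"
  obtains z where "z \<in> closure (fst ` G)" "\<And>w r. (w, r) \<in> G \<Longrightarrow> z \<bullet> w = r" "norm z \<le> M \<or> z = 0"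
proof -
  define J :: "'h \<times> real \<Rightarrow> real" where "J g = fst g \<bullet> fst g - 2 * snd g" for g
  have J_lower: "- (M\<^sup>2) \<le> J g" if "g \<in> G" for g
  proof -
    obtain w r where g: "g = (w, r)" by fastforce
    have "0 \<le> (norm w - M)\<^sup>2" by simp
    with bound[of w r] that g show ?thesis
      by (simp add: J_def power2_norm_eq_inner[symmetric] power2_diff algebra_simps)
  qed
  define m where "m = Inf (J ` G)"
  have bdd: "bdd_below (J ` G)" using J_lower by (auto intro!: bdd_belowI)
  have m_le: "m \<le> J g" if "g \<in> G" for g
    unfolding m_def using bdd that by (auto intro: cInf_lower)
  have "\<exists>g\<in>G. J g < m + inverse (real (Suc n))" for n
  proof -
    have "J ` G \<noteq> {}" using subspace_0[OF G] by blast
    then show ?thesis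
      using cInf_lessD[of "J ` G" "m + inverse (real (Suc n))"] by (auto simp: m_def)
  qed
  then obtain g where g: "\<And>n. g n \<in> G" "\<And>n. J (g n) < m + inverse (real (Suc n))" by metis
  \<comment> \<open>The midpoint lies in \<open>G\<close>, so the parallelogram law bounds the
    distance between the first components of near-minimizers; the second components enter
    \<open>J\<close> linearly and cancel.\<close>
  have par: "(norm (fst a - fst b))\<^sup>2 \<le> 2 * (J a - m) + 2 * (J b - m)" if "a \<in> G" "b \<in> G" for a b
  proof -
    have "(1/2) *\<^sub>R (a + b) \<in> G" using that G by (intro subspace_scale subspace_add)
    from m_le[OF this] have "4 * m \<le> 4 * J ((1/2) *\<^sub>R (a + b))" by simp
    also have "\<dots> = 2 * J a + 2 * J b - (norm (fst a - fst b))\<^sup>2"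
      by (simp add: J_def power2_norm_eq_inner inner_simps inner_commute algebra_simps)
    finally show ?thesis by simp
  qed
  have "Cauchy (\<lambda>n. fst (g n))"
  proof (rule metric_CauchyI)
    fix e :: real assume "e > 0"
    then obtain N where N: "inverse (real (Suc N)) < e\<^sup>2 / 4"
      using reals_Archimedean[of "e\<^sup>2 / 4"] by auto
    have "dist (fst (g k)) (fst (g l)) < e" if "k \<ge> N" "l \<ge> N" for k l
    proof -
      have "J (g j) - m < e\<^sup>2 / 4" if "j \<ge> N" for j
      proof -
        have "inverse (real (Suc j)) \<le> inverse (real (Suc N))"
          using that by (simp add: field_simps)
        with g(2)[of j] N show ?thesis by argo
      qed
      from this[OF that(1)] this[OF that(2)] have "(norm (fst (g k) - fst (g l)))\<^sup>2 < e\<^sup>2"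
        using par[OF g(1) g(1), of k l] by argo
      then show ?thesis using \<open>e > 0\<close> by (simp add: dist_norm power2_less_imp_less)
    qed
    then show "\<exists>N. \<forall>k\<ge>N. \<forall>l\<ge>N. dist (fst (g k)) (fst (g l)) < e" by blast
  qed
  then obtain z where z: "(\<lambda>n. fst (g n)) \<longlonglongrightarrow> z"
    by (auto dest!: Cauchy_convergent simp: convergent_def)
  have zcl: "z \<in> closure (fst ` G)"
    unfolding closure_sequential using z g(1) by (intro exI[of _ "\<lambda>n. fst (g n)"]) auto
  have repr: "z \<bullet> w = r" if wr: "(w, r) \<in> G" for w r
  proof -
    \<comment> \<open>First variation in the direction \<open>(w, r)\<close>: the quadratic in
      \<open>t\<close> is nonnegative up to an error that vanishes with \<open>n\<close>. In the
      limit its constant term is 0, so the linear coefficient must be 0.\<close>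
    have "0 \<le> (w \<bullet> w) * t\<^sup>2 + 2 * (z \<bullet> w - r) * t + 0" for t
    proof (rule LIMSEQ_le_const)
      show "(\<lambda>n. (w \<bullet> w) * t\<^sup>2 + 2 * (fst (g n) \<bullet> w - r) * t + inverse (real (Suc n)))
          \<longlonglongrightarrow> (w \<bullet> w) * t\<^sup>2 + 2 * (z \<bullet> w - r) * t + 0"
        by (intro tendsto_intros z LIMSEQ_inverse_real_of_nat)
      have "0 \<le> (w \<bullet> w) * t\<^sup>2 + 2 * (fst (g n) \<bullet> w - r) * t + inverse (real (Suc n))" for n
      proof -
        have "m \<le> J (g n + t *\<^sub>R (w, r))"
          using wr g(1) G by (intro m_le subspace_add subspace_scale)
        also have "\<dots> = J (g n) + ((w \<bullet> w) * t\<^sup>2 + 2 * (fst (g n) \<bullet> w - r) * t)"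
          by (simp add: J_def inner_simps inner_commute power2_eq_square algebra_simps)
        finally show ?thesis using g(2)[of n] by linarith
      qed
      then show "\<exists>N. \<forall>n\<ge>N. 0 \<le> (w \<bullet> w) * t\<^sup>2 + 2 * (fst (g n) \<bullet> w - r) * t + inverse (real (Suc n))"
        by blast
    qed
    then have "(z \<bullet> w - r)\<^sup>2 \<le> (w \<bullet> w) * 0" by (rule quadratic_nonneg_imp)
    then show ?thesis by simp
  qed
  have "z \<bullet> z \<le> M * norm z"
  proof (rule LIMSEQ_le)
    show "(\<lambda>n. z \<bullet> fst (g n)) \<longlonglongrightarrow> z \<bullet> z" by (intro tendsto_intros z)
    show "(\<lambda>n. M * norm (fst (g n))) \<longlonglongrightarrow> M * norm z" by (intro tendsto_intros z)
    have "z \<bullet> fst (g n) \<le> M * norm (fst (g n))" for n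
      using repr[of "fst (g n)" "snd (g n)"] bound[of "fst (g n)" "snd (g n)"] g(1)[of n] by simp
    then show "\<exists>N. \<forall>n\<ge>N. z \<bullet> fst (g n) \<le> M * norm (fst (g n))" by blast
  qed
  \<comment> \<open>Dividing by \<open>norm z\<close> needs \<open>z\<close> nonzero;
    \<open>M\<close> carries no sign, so \<open>z = 0\<close> stays a separate alternative.\<close>
  then have "norm z \<le> M \<or> z = 0"
    by (cases "z = 0") (simp_all flip: power2_norm_eq_inner add: power2_eq_square)
  with zcl repr that show thesis by blast
qed

text \<open>Coefficients sit on the indices rather than on the values of \<open>f\<close>, which
  need not be injective: the hypothesis of \<open>riesz_family\<close> is stated over the index
  set.\<close>

lemma span_image_sum:
  fixes f :: "'y \<Rightarrow> 'v::real_vector"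
  assumes "x \<in> span (f ` Y)"
  obtains F c where "finite F" "F \<subseteq> Y" "x = (\<Sum>y\<in>F. c y *\<^sub>R f y)"
proof -
  have "\<exists>F c. finite F \<and> F \<subseteq> Y \<and> x = (\<Sum>y\<in>F. c y *\<^sub>R f y)"
    using assms
  proof (induction rule: span_induct_alt)
    case base
    show ?case by (rule exI[of _ "{}"]) simp
  next
    case (step k v x)
    then obtain F c y0 where F: "finite F" "F \<subseteq> Y" "x = (\<Sum>y\<in>F. c y *\<^sub>R f y)" and y0: "y0 \<in> Y" "v = f y0"
      by blast
    \<comment> \<open>\<open>y0\<close> may already belong to \<open>F\<close>, so its old
      coefficient is kept and \<open>k\<close> is added.\<close>
    define c' where "c' y = of_bool (y \<in> F) * c y + of_bool (y = y0) * k" for y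
    have "(\<Sum>y\<in>insert y0 F. c' y *\<^sub>R f y)
        = (\<Sum>y\<in>insert y0 F. (of_bool (y \<in> F) * c y) *\<^sub>R f y) + (\<Sum>y\<in>insert y0 F. (of_bool (y = y0) * k) *\<^sub>R f y)"
      by (simp only: c'_def scaleR_add_left sum.distrib)
    also have "(\<Sum>y\<in>insert y0 F. (of_bool (y \<in> F) * c y) *\<^sub>R f y) = x"
      unfolding F(3) using F(1) by (intro sum.mono_neutral_cong_right) auto
    also have "(\<Sum>y\<in>insert y0 F. (of_bool (y = y0) * k) *\<^sub>R f y) = (\<Sum>y\<in>{y0}. k *\<^sub>R f y)"
      using F(1) by (intro sum.mono_neutral_cong_right) auto
    finally have "k *\<^sub>R v + x = (\<Sum>y\<in>insert y0 F. c' y *\<^sub>R f y)" using y0 by (simp add: add.commute)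
    moreover have "finite (insert y0 F)" "insert y0 F \<subseteq> Y" using F y0 by auto
    ultimately show ?case by blast
  qed
  with that show thesis by blast
qed

text \<open>The bound makes the prescribed values consistent, since a linear relation among the
  \<open>w y\<close> forces the same relation among the \<open>t y\<close>, and it makes them
  continuous. Projections, the partial isometry \<open>V\<close> of the polar decomposition and the
  operators \<open>kop\<close> are all obtained from this lemma.\<close>

lemma riesz_family:
  fixes w :: "'y \<Rightarrow> 'h::{real_inner,banach}" and t :: "'y \<Rightarrow> real"
  assumes bound: "\<And>F c. finite F \<Longrightarrow> F \<subseteq> Y \<Longrightarrow> \<bar>\<Sum>y\<in>F. c y * t y\<bar> \<le> M * norm (\<Sum>y\<in>F. c y *\<^sub>R w y)"
  obtains z where "z \<in> closure (span (w ` Y))" "\<And>y. y \<in> Y \<Longrightarrow> z \<bullet> w y = t y" "norm z \<le> M \<or> z = 0"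
proof -
  define f where "f y = (w y, t y)" for y
  define G where "G = span (f ` Y)"
  have bd: "\<bar>r\<bar> \<le> M * norm v" if vr: "(v, r) \<in> G" for v r
  proof -
    obtain F c where F: "finite F" "F \<subseteq> Y" and vr: "(v, r) = (\<Sum>y\<in>F. c y *\<^sub>R f y)"
      using span_image_sum[OF vr[unfolded G_def]] by blast
    have "v = (\<Sum>y\<in>F. c y *\<^sub>R w y)" "r = (\<Sum>y\<in>F. c y * t y)"
      using arg_cong[OF vr, of fst] arg_cong[OF vr, of snd] by (simp_all add: f_def fst_sum snd_sum)
    with bound[OF F] show ?thesis by simp
  qed
  have "subspace G" unfolding G_def by simp
  from riesz_graph[OF this bd] obtain z where
    z: "z \<in> closure (fst ` G)" "\<And>w r. (w, r) \<in> G \<Longrightarrow> z \<bullet> w = r" "norm z \<le> M \<or> z = 0" by blast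
  have "fst ` G = span (w ` Y)"
    unfolding G_def by (subst span_linear_image[symmetric]) (simp_all add: linear_fst image_image f_def)
  moreover have "f y \<in> G" if "y \<in> Y" for y unfolding G_def using that by (intro span_base) auto
  ultimately show thesis using z that unfolding f_def by force
qed

section \<open>Closed subspaces and orthogonal projections\<close>

lemma subspace_closure:
  fixes S :: "'a::real_normed_vector set"
  assumes S: "subspace S"
  shows "subspace (closure S)"
proof (rule subspaceI)
  show "0 \<in> closure S" using subspace_0[OF S] closure_subset by blast
  show "x + y \<in> closure S" if xy: "x \<in> closure S" "y \<in> closure S" for x y
  proof -
    obtain f g where "\<And>n. f n \<in> S" "f \<longlonglongrightarrow> x" "\<And>n. g n \<in> S" "g \<longlonglongrightarrow> y"
      using xy unfolding closure_sequential by blast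
    then show ?thesis unfolding closure_sequential
      by (intro exI[of _ "\<lambda>n. f n + g n"]) (auto intro: tendsto_intros subspace_add[OF S])
  qed
  show "c *\<^sub>R x \<in> closure S" if x: "x \<in> closure S" for c x
  proof -
    obtain f where "\<And>n. f n \<in> S" "f \<longlonglongrightarrow> x" using x unfolding closure_sequential by blast
    then show ?thesis unfolding closure_sequential
      by (intro exI[of _ "\<lambda>n. c *\<^sub>R f n"]) (auto intro: tendsto_intros subspace_scale[OF S])
  qed
qed

lemma orthogonal_closure_span:
  fixes x :: "'h::real_inner"
  assumes "\<And>w. w \<in> S \<Longrightarrow> x \<bullet> w = 0" "y \<in> closure (span S)"
  shows "x \<bullet> y = 0"
proof -
  have "span S \<subseteq> {y. x \<bullet> y = 0}"
    using assms(1) by (intro span_minimal) (auto simp: subspace_def inner_simps)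
  then have "closure (span S) \<subseteq> {y. x \<bullet> y = 0}"
    by (rule closure_minimal) (intro closed_Collect_eq continuous_intros)
  with assms(2) show ?thesis by blast
qed

definition proj :: "'h::real_inner set \<Rightarrow> 'h \<Rightarrow> 'h" where
  "proj N x = (SOME z. z \<in> N \<and> (\<forall>w\<in>N. (x - z) \<bullet> w = 0))"

context
  fixes N :: "'h::{real_inner,banach} set"
  assumes N: "subspace N" "closed N"
begin

lemma proj: "proj N x \<in> N \<and> (\<forall>w\<in>N. (x - proj N x) \<bullet> w = 0)"
proof -
  have "\<bar>\<Sum>y\<in>F. c y * (x \<bullet> y)\<bar> \<le> norm x * norm (\<Sum>y\<in>F. c y *\<^sub>R y)" for F and c :: "'h \<Rightarrow> real"
    using Cauchy_Schwarz_ineq2[of x "\<Sum>y\<in>F. c y *\<^sub>R y"] by (simp add: inner_sum_right)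
  from riesz_family[of N "\<lambda>y. x \<bullet> y" "norm x" "\<lambda>y. y", OF this] obtain z where
    z: "z \<in> closure (span N)" "\<And>y. y \<in> N \<Longrightarrow> z \<bullet> y = x \<bullet> y" by auto
  have "span N = N" using N(1) by (rule span_eq_iff[THEN iffD2])
  with z(1) have "z \<in> N" using closure_closed[OF N(2)] by simp
  then have "z \<in> N \<and> (\<forall>w\<in>N. (x - z) \<bullet> w = 0)"
    using z(2) by (simp add: inner_diff_left)
  then show ?thesis unfolding proj_def by (rule someI)
qed

lemma proj_in: "proj N x \<in> N" using proj by blast

lemma proj_orth: "w \<in> N \<Longrightarrow> (x - proj N x) \<bullet> w = 0" using proj by blast

lemma inner_proj: "w \<in> N \<Longrightarrow> proj N x \<bullet> w = x \<bullet> w"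
  using proj_orth[of w x] by (simp add: inner_diff_left)

lemma proj_eqI:
  assumes "z \<in> N" "\<And>w. w \<in> N \<Longrightarrow> z \<bullet> w = x \<bullet> w"
  shows "proj N x = z"
proof -
  have d: "proj N x - z \<in> N" using N assms(1) proj_in by (simp add: subspace_diff)
  have "(proj N x - z) \<bullet> (proj N x - z) = 0"
    using inner_proj[OF d] assms(2)[OF d] by (simp add: inner_diff_left)
  then show ?thesis by simp
qed

lemma proj_id: "x \<in> N \<Longrightarrow> proj N x = x" by (rule proj_eqI) auto

lemma proj_selfadjoint: "proj N x \<bullet> y = x \<bullet> proj N y"
  using inner_proj[OF proj_in, of x y] inner_proj[OF proj_in, of y x] by (simp add: inner_commute)

lemma norm_proj_le: "norm (proj N x) \<le> norm x"
proof -
  have "norm (proj N x) * norm (proj N x) \<le> norm x * norm (proj N x)"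
    using inner_proj[OF proj_in, of x x] norm_cauchy_schwarz[of x "proj N x"]
    by (simp add: power2_norm_eq_inner flip: power2_eq_square)
  then show ?thesis by (cases "proj N x = 0") simp_all
qed

lemma bounded_linear_proj: "bounded_linear (proj N)"
proof (rule bounded_linear_intro[where K = 1])
  show "proj N (x + y) = proj N x + proj N y" for x y
    using N by (intro proj_eqI) (auto simp: subspace_add proj_in inner_proj inner_add_left)
  show "proj N (r *\<^sub>R x) = r *\<^sub>R proj N x" for r x
    using N by (intro proj_eqI) (auto simp: subspace_scale proj_in inner_proj)
qed (simp add: norm_proj_le)

end

section \<open>Square root of a self-adjoint operator close to the identity\<close>

lemma selfadjoint_sqrt:
  fixes A :: "'h::{real_inner,banach} \<Rightarrow> 'h"
  assumes A: "bounded_linear A" and sa: "\<And>x y. A x \<bullet> y = x \<bullet> A y"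
    and contr: "\<And>x. norm (x - A x) \<le> norm x"
  obtains B where "bounded_linear B" "\<And>x y. B x \<bullet> y = x \<bullet> B y" "\<And>x. B (B x) = A x"
    "\<forall>C. bounded_linear C \<longrightarrow> (\<forall>x. C (A x) = A (C x)) \<longrightarrow> (\<forall>x. C (B x) = B (C x))"
proof -
  text \<open>\<open>B = 1 - Y\<close>, where \<open>Y\<close> is the limit of the iteration \<open>Y \<mapsto> (D + Y\<^sup>2) / 2\<close> with \<open>D = 1 - A\<close>;
    the same iteration over the reals with \<open>D = 1\<close> majorizes the increments.\<close>
  define D where "D = Blinfun (\<lambda>x. x - A x)"
  have D: "blinfun_apply D x = x - A x" for x
    unfolding D_def by (subst bounded_linear_Blinfun_apply) (intro bounded_linear_sub bounded_linear_ident A, simp)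
  define Y where "Y = rec_nat (0 :: 'h \<Rightarrow>\<^sub>L 'h) (\<lambda>_ Z. (1/2) *\<^sub>R (D + (Z o\<^sub>L Z)))"
  define y where "y = rec_nat (0 :: real) (\<lambda>_ z. (1 + z * z) / 2)"
  have Y0: "Y 0 = 0" and YS: "Y (Suc n) = (1/2) *\<^sub>R (D + (Y n o\<^sub>L Y n))" for n by (simp_all add: Y_def)
  have y0: "y 0 = 0" and yS: "y (Suc n) = (1 + y n * y n) / 2" for n by (simp_all add: y_def)
  have y01: "0 \<le> y n \<and> y n \<le> 1" for n
  proof (induction n)
    case (Suc n)
    then have "y n * y n \<le> 1" by (intro mult_le_one) auto
    then show ?case by (simp add: yS)
  qed (simp add: y0)
  have normD: "norm D \<le> 1" by (rule norm_blinfun_bound) (auto simp: D contr)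
  \<comment> \<open>Every \<open>Y n\<close> is a polynomial in \<open>D\<close>, so it commutes
    with whatever commutes with \<open>D\<close>; in particular the iterates commute with each
    other.\<close>
  have comm: "blinfun_apply C (Y n x) = Y n (blinfun_apply C x)" if "\<And>x. blinfun_apply C (D x) = D (blinfun_apply C x)" for C n x
    by (induction n arbitrary: x)
       (simp_all add: Y0 YS that blinfun.add_left blinfun.scaleR_left blinfun.add_right blinfun.scaleR_right)
  have YSx: "Y (Suc n) x = (1/2) *\<^sub>R (D x + Y n (Y n x))" for n x
    by (simp add: YS blinfun.add_left blinfun.scaleR_left)
  have YD: "Y n (D x) = D (Y n x)" for n x using comm[of D] by simp
  have YY: "Y m (Y n x) = Y n (Y m x)" for m n x by (rule comm) (rule YD)
  have normY: "norm (Y n) \<le> y n" for n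
  proof (induction n)
    case (Suc n)
    have "norm (Y (Suc n)) \<le> (norm D + norm (Y n o\<^sub>L Y n)) / 2"
      using norm_triangle_ineq[of D "Y n o\<^sub>L Y n"] by (simp add: YS)
    also have "\<dots> \<le> (1 + norm (Y n) * norm (Y n)) / 2"
      using normD norm_blinfun_compose[of "Y n" "Y n"] by simp
    also have "\<dots> \<le> (1 + y n * y n) / 2"
      using mult_mono[OF Suc Suc] y01[of n] by simp
    finally show ?case by (simp add: yS)
  qed (simp add: Y0 y0)
  have normS: "norm (Y (Suc n) - Y n) \<le> y (Suc n) - y n" for n
  proof (induction n)
    case 0
    then show ?case using normD by (simp add: YS Y0 yS y0)
  next
    case (Suc n)
    \<comment> \<open>A difference of two squares, which factors because the iterates commute; the
      majorant satisfies the same identity with numbers.\<close>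
    have "Y (Suc (Suc n)) - Y (Suc n) = (1/2) *\<^sub>R ((Y (Suc n) + Y n) o\<^sub>L (Y (Suc n) - Y n))"
    proof (rule blinfun_eqI)
      fix x
      have "Y (Suc (Suc n)) x - Y (Suc n) x = (1/2) *\<^sub>R (Y (Suc n) (Y (Suc n) x) - Y n (Y n x))"
        using arg_cong2[OF YSx[of "Suc n" x] YSx[of n x], of minus]
        by (simp add: scaleR_diff_right scaleR_add_right)
      also have "\<dots> = (1/2) *\<^sub>R ((Y (Suc n) + Y n) o\<^sub>L (Y (Suc n) - Y n)) x"
        using YY[of "Suc n" n x]
        by (simp add: blinfun.add_left blinfun.diff_left blinfun.diff_right blinfun.scaleR_left)
      finally show "(Y (Suc (Suc n)) - Y (Suc n)) x = ((1/2) *\<^sub>R ((Y (Suc n) + Y n) o\<^sub>L (Y (Suc n) - Y n))) x"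
        by (simp add: blinfun.diff_left blinfun.scaleR_left)
    qed
    then have "norm (Y (Suc (Suc n)) - Y (Suc n)) \<le> norm (Y (Suc n) + Y n) * norm (Y (Suc n) - Y n) / 2"
      using norm_blinfun_compose[of "Y (Suc n) + Y n" "Y (Suc n) - Y n"] by simp
    also have "norm (Y (Suc n) + Y n) \<le> y (Suc n) + y n"
      using norm_triangle_ineq[of "Y (Suc n)" "Y n"] normY[of n] normY[of "Suc n"] by linarith
    then have "norm (Y (Suc n) + Y n) * norm (Y (Suc n) - Y n) / 2 \<le> (y (Suc n) + y n) * (y (Suc n) - y n) / 2"
      using Suc by (intro divide_right_mono mult_mono) (auto intro: order_trans[OF norm_ge_zero])
    also have "\<dots> = y (Suc (Suc n)) - y (Suc n)"
      using arg_cong2[OF yS[of "Suc n"] yS[of n], of minus] by (simp add: field_simps)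
    finally show ?case .
  qed
  have dist_le: "norm (Y (n + k) - Y n) \<le> y (n + k) - y n" for n k
  proof (induction k)
    case (Suc k)
    have "norm (Y (n + Suc k) - Y n) \<le> norm (Y (Suc (n + k)) - Y (n + k)) + norm (Y (n + k) - Y n)"
      using norm_triangle_ineq[of "Y (Suc (n + k)) - Y (n + k)" "Y (n + k) - Y n"] by simp
    also have "\<dots> \<le> y (n + Suc k) - y n" using Suc normS[of "n + k"] by simp
    finally show ?case .
  qed simp
  have "incseq y"
  proof (rule incseq_SucI)
    show "y n \<le> y (Suc n)" for n using normS[of n] norm_ge_zero[of "Y (Suc n) - Y n"] by linarith
  qed
  then obtain l where "y \<longlonglongrightarrow> l" using y01 by (elim incseq_convergent) auto
  then have "Cauchy y" by (rule LIMSEQ_imp_Cauchy)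
  have "Cauchy Y"
  proof (rule metric_CauchyI)
    fix e :: real assume "e > 0"
    then obtain N where N: "\<And>m n. m \<ge> N \<Longrightarrow> n \<ge> N \<Longrightarrow> dist (y m) (y n) < e"
      using metric_CauchyD[OF \<open>Cauchy y\<close>] by meson
    have le: "dist (Y m) (Y n) < e" if "m \<ge> n" "n \<ge> N" for m n
      using dist_le[of n "m - n"] N[of m n] that by (simp add: dist_norm)
    have "dist (Y m) (Y n) < e" if "m \<ge> N" "n \<ge> N" for m n
      using le[of m n] le[of n m] that by (cases "m \<ge> n") (auto simp: dist_commute)
    then show "\<exists>N. \<forall>m\<ge>N. \<forall>n\<ge>N. dist (Y m) (Y n) < e" by blast
  qed
  then obtain L where L: "Y \<longlonglongrightarrow> L" by (auto dest!: Cauchy_convergent simp: convergent_def)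
  have Lx: "(\<lambda>n. Y n x) \<longlonglongrightarrow> L x" for x by (intro tendsto_intros L)
  \<comment> \<open>The fixed point equation says \<open>(1 - L)\<^sup>2 = 1 - D = A\<close>, so
    \<open>1 - L\<close> is the root.\<close>
  have "L = (1/2) *\<^sub>R (D + (L o\<^sub>L L))"
  proof (rule LIMSEQ_unique[OF LIMSEQ_Suc[OF L]])
    show "(\<lambda>n. Y (Suc n)) \<longlonglongrightarrow> (1/2) *\<^sub>R (D + (L o\<^sub>L L))"
      unfolding YS
      by (intro tendsto_intros L bounded_bilinear.tendsto[OF bounded_bilinear_blinfun_compose])
  qed
  then have "2 *\<^sub>R L = 2 *\<^sub>R ((1/2) *\<^sub>R (D + (L o\<^sub>L L)))" by (rule arg_cong)
  also have "\<dots> = D + (L o\<^sub>L L)" by simp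
  finally have "(2 *\<^sub>R L) x = (D + (L o\<^sub>L L)) x" for x by simp
  then have "2 *\<^sub>R L x = D x + L (L x)" for x by (simp add: blinfun.add_left blinfun.scaleR_left)
  then have LL: "L (L x) = 2 *\<^sub>R L x - x + A x" for x by (simp add: D)
  define B where "B x = x - L x" for x
  have Bx: "(\<lambda>n. x - Y n x) \<longlonglongrightarrow> B x" for x unfolding B_def by (intro tendsto_intros Lx)
  show thesis
  proof
    show "bounded_linear B" unfolding B_def
      by (intro bounded_linear_sub bounded_linear_ident blinfun.bounded_linear_right)
    have saY: "Y n x \<bullet> z = x \<bullet> Y n z" for n x z
      by (induction n arbitrary: x z)
         (simp_all add: Y0 YS blinfun.add_left blinfun.scaleR_left D inner_simps sa)
    have L1: "(\<lambda>n. (x - Y n x) \<bullet> z) \<longlonglongrightarrow> B x \<bullet> z"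
      and L2: "(\<lambda>n. x \<bullet> (z - Y n z)) \<longlonglongrightarrow> x \<bullet> B z" for x z
      by (intro tendsto_intros Bx)+
    have eq: "(x - Y n x) \<bullet> z = x \<bullet> (z - Y n z)" for n x z by (simp add: inner_simps saY)
    show "B x \<bullet> z = x \<bullet> B z" for x z by (rule LIMSEQ_unique[OF L1[unfolded eq] L2])
    show "B (B x) = A x" for x
      by (simp add: B_def blinfun.diff_right LL scaleR_2)
    have "C (B x) = B (C x)" if C: "bounded_linear C" and CA: "\<forall>x. C (A x) = A (C x)" for C x
    proof -
    have C': "blinfun_apply (Blinfun C) = C" using C by (rule bounded_linear_Blinfun_apply)
    have "C (D x) = D (C x)" for x
      by (simp add: D linear_diff[OF bounded_linear.linear[OF C]] CA)
    then have "C (Y n x) = Y n (C x)" for n using comm[of "Blinfun C" n x] by (simp add: C')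
    then have eq: "C (x - Y n x) = C x - Y n (C x)" for n by (simp add: linear_diff[OF bounded_linear.linear[OF C]])
    have "(\<lambda>n. C (x - Y n x)) \<longlonglongrightarrow> C (B x)" by (intro bounded_linear.tendsto[OF C] Bx)
    from LIMSEQ_unique[OF this[unfolded eq] Bx] show "C (B x) = B (C x)" .
    qed
    then show "\<forall>C. bounded_linear C \<longrightarrow> (\<forall>x. C (A x) = A (C x)) \<longrightarrow> (\<forall>x. C (B x) = B (C x))"
      by blast
  qed
qed

section \<open>Positive semidefinite kernels as Gram matrices\<close>

definition psd_kernel :: "('x \<Rightarrow> 'x \<Rightarrow> real) \<Rightarrow> bool" where
  "psd_kernel \<kappa> \<longleftrightarrow> (\<forall>x y. \<kappa> x y = \<kappa> y x) \<and>
     (\<forall>F c. finite F \<longrightarrow> 0 \<le> (\<Sum>x\<in>F. \<Sum>y\<in>F. c x * c y * \<kappa> x y))"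

lemma inner_sum_sum:
  "(\<Sum>x\<in>F. c x *\<^sub>R v x) \<bullet> (\<Sum>y\<in>F. d y *\<^sub>R w y) = (\<Sum>x\<in>F. \<Sum>y\<in>F. c x * d y * (v x \<bullet> w y))"
  unfolding inner_sum_left unfolding inner_sum_right by (simp add: mult_ac)

text \<open>Adjoining \<open>x\<close> to \<open>F\<close> with a free weight \<open>t\<close> turns
  the form into a quadratic polynomial in \<open>t\<close>. The result is the bound by which
  \<open>riesz_family\<close> finds the next vector of the Cholesky construction.\<close>

lemma psd_kernel_Cauchy_Schwarz:
  assumes \<kappa>: "psd_kernel \<kappa>" and F: "finite F" "x \<notin> F"
  shows "(\<Sum>y\<in>F. c y * \<kappa> x y)\<^sup>2 \<le> \<kappa> x x * (\<Sum>y\<in>F. \<Sum>z\<in>F. c y * c z * \<kappa> y z)"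
proof (rule quadratic_nonneg_imp)
  fix t :: real
  define d where "d = c(x := t)"
  have d: "d y = c y" if "y \<in> F" for y using that F by (auto simp: d_def)
  have dx: "d x = t" by (simp add: d_def)
  have sym: "\<kappa> y z = \<kappa> z y" for y z using \<kappa> by (simp add: psd_kernel_def)
  have "finite (insert x F)" using F by simp
  then have "0 \<le> (\<Sum>y\<in>insert x F. \<Sum>z\<in>insert x F. d y * d z * \<kappa> y z)"
    using \<kappa> unfolding psd_kernel_def by blast
  also have "\<dots> = d x * d x * \<kappa> x x + (\<Sum>z\<in>F. d x * d z * \<kappa> x z)
      + ((\<Sum>y\<in>F. d y * d x * \<kappa> y x) + (\<Sum>y\<in>F. \<Sum>z\<in>F. d y * d z * \<kappa> y z))"
    using F by (simp add: sum.distrib)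
  also have "(\<Sum>y\<in>F. d y * d x * \<kappa> y x) = t * (\<Sum>y\<in>F. c y * \<kappa> x y)"
    unfolding sum_distrib_left by (intro sum.cong refl) (simp add: d dx sym mult_ac)
  also have "(\<Sum>z\<in>F. d x * d z * \<kappa> x z) = t * (\<Sum>y\<in>F. c y * \<kappa> x y)"
    unfolding sum_distrib_left by (intro sum.cong refl) (simp add: d dx sym mult_ac)
  also have "(\<Sum>y\<in>F. \<Sum>z\<in>F. d y * d z * \<kappa> y z) = (\<Sum>y\<in>F. \<Sum>z\<in>F. c y * c z * \<kappa> y z)"
    by (intro sum.cong) (simp_all add: d)
  finally show "0 \<le> \<kappa> x x * t\<^sup>2 + 2 * (\<Sum>y\<in>F. c y * \<kappa> x y) * t + (\<Sum>y\<in>F. \<Sum>z\<in>F. c y * c z * \<kappa> y z)"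
    by (simp add: dx power2_eq_square algebra_simps)
qed

text \<open>
  Cholesky decomposition along a well-order of the index type.
\<close>

lemma psd_kernel_realization:
  fixes \<kappa> :: "'x \<Rightarrow> 'x \<Rightarrow> real"
  assumes \<kappa>: "psd_kernel \<kappa>"
  obtains v :: "'x \<Rightarrow> 'x ell2" where "\<And>x y. v x \<bullet> v y = \<kappa> x y"
proof -
  obtain r :: "('x \<times> 'x) set" where r: "well_order_on UNIV r"
    using well_order_on by blast
  define R where "R = r - Id"
  have wfR: "wf R" using r unfolding R_def well_order_on_def by blast
  have total: "(x, y) \<in> R \<or> x = y \<or> (y, x) \<in> R" for x y
    using r unfolding R_def well_order_on_def linear_order_on_def total_on_def by auto
  have asym: "(y, x) \<notin> R" if "(x, y) \<in> R" for x y using wfR that by (meson wf_asym)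
  have irr: "(x, x) \<notin> R" for x by (simp add: R_def)
  have trans: "(x, z) \<in> R" if "(x, y) \<in> R" "(y, z) \<in> R" for x y z
  proof -
    have "trans r"
      using r unfolding well_order_on_def linear_order_on_def partial_order_on_def preorder_on_def by simp
    then have "(x, z) \<in> r" using that unfolding R_def by (meson DiffD1 transD)
    then show ?thesis using asym[OF that(1)] that unfolding R_def by auto
  qed
  have sym: "\<kappa> y z = \<kappa> z y" for y z using \<kappa> by (simp add: psd_kernel_def)
  \<comment> \<open>The support condition is triangularity: the vector of \<open>x\<close> uses
    coordinates up to \<open>x\<close> only, so \<open>unit x\<close> is orthogonal to all earlier
    vectors.\<close>
  define P :: "('x \<Rightarrow> 'x ell2) \<Rightarrow> 'x \<Rightarrow> 'x ell2 \<Rightarrow> bool" where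
    "P f x u \<longleftrightarrow> (\<forall>i. coord u i \<noteq> 0 \<longrightarrow> (i, x) \<in> R \<or> i = x) \<and> u \<bullet> u = \<kappa> x x \<and> (\<forall>y. (y, x) \<in> R \<longrightarrow> u \<bullet> f y = \<kappa> x y)"
    for f x u
  have "\<exists>f. \<forall>x. P f x (f x)"
  proof (rule dependent_wf_choice[OF wfR])
    show "P f x u = P g x u" if "\<And>z. (z, x) \<in> R \<Longrightarrow> f z = g z" for f g x u
      using that by (auto simp: P_def)
    fix x f assume IH: "\<And>y. (y, x) \<in> R \<Longrightarrow> P f y (f y)"
    define S where "S = {y. (y, x) \<in> R}"
    have gram: "f y \<bullet> f z = \<kappa> y z" if "y \<in> S" "z \<in> S" for y z
      using total[of y z] IH[of y] IH[of z] that sym[of y z] inner_commute[of "f y" "f z"]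
      by (auto simp: P_def S_def)
    have "\<bar>\<Sum>y\<in>F. c y * \<kappa> x y\<bar> \<le> sqrt (\<kappa> x x) * norm (\<Sum>y\<in>F. c y *\<^sub>R f y)"
      if F: "finite F" "F \<subseteq> S" for F and c :: "'x \<Rightarrow> real"
    proof -
      have "x \<notin> F" using F irr by (auto simp: S_def)
      from psd_kernel_Cauchy_Schwarz[OF \<kappa> F(1) this, of c]
      have "(\<Sum>y\<in>F. c y * \<kappa> x y)\<^sup>2 \<le> \<kappa> x x * (\<Sum>y\<in>F. \<Sum>z\<in>F. c y * c z * \<kappa> y z)" .
      also have "(\<Sum>y\<in>F. \<Sum>z\<in>F. c y * c z * \<kappa> y z) = (norm (\<Sum>y\<in>F. c y *\<^sub>R f y))\<^sup>2"
        unfolding power2_norm_eq_inner inner_sum_sum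
        using F gram by (intro sum.cong refl) (auto simp: subset_iff)
      finally have "sqrt ((\<Sum>y\<in>F. c y * \<kappa> x y)\<^sup>2) \<le> sqrt (\<kappa> x x * (norm (\<Sum>y\<in>F. c y *\<^sub>R f y))\<^sup>2)"
        by (rule real_sqrt_le_mono)
      then show ?thesis by (simp add: real_sqrt_mult)
    qed
    from riesz_family[where Y = S, OF this] obtain z where z: "z \<in> closure (span (f ` S))"
      "\<And>y. y \<in> S \<Longrightarrow> z \<bullet> f y = \<kappa> x y" "norm z \<le> sqrt (\<kappa> x x) \<or> z = 0" by blast
    have supp: "coord z i = 0" if i: "(i, x) \<notin> R" for i
    proof -
      have "coord (f y) i = 0" if "y \<in> S" for y
        using IH[of y] that i trans[of i y x] by (auto simp: P_def S_def)
      then have "unit i \<bullet> z = 0"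
        by (intro orthogonal_closure_span[OF _ z(1)]) (auto simp: inner_unit_left)
      then show ?thesis by (simp add: inner_unit_left)
    qed
    have "0 \<le> \<kappa> x x"
      using \<kappa>[unfolded psd_kernel_def, THEN conjunct2, THEN spec, of "{x}", THEN spec, of "\<lambda>_. 1"] by simp
    moreover from this z(3) have "(norm z)\<^sup>2 \<le> \<kappa> x x"
      using power_mono[of "norm z" "sqrt (\<kappa> x x)" 2] by auto
    ultimately have zz: "z \<bullet> z \<le> \<kappa> x x" by (simp add: power2_norm_eq_inner)
    \<comment> \<open>\<open>z\<close> has the right products with the earlier vectors but may be
      too short; the missing length goes into the fresh coordinate \<open>x\<close>.\<close>
    define s where "s = sqrt (\<kappa> x x - z \<bullet> z)"
    have "P f x (z + s *\<^sub>R unit x)"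
      unfolding P_def
    proof (intro conjI allI impI)
      show "(i, x) \<in> R \<or> i = x" if "coord (z + s *\<^sub>R unit x) i \<noteq> 0" for i
        using that supp[of i] by (cases "i = x"; cases "(i, x) \<in> R") simp_all
      have "s * s = \<kappa> x x - z \<bullet> z" using zz by (simp add: s_def)
      then show "(z + s *\<^sub>R unit x) \<bullet> (z + s *\<^sub>R unit x) = \<kappa> x x"
        using supp[OF irr] by (simp add: inner_simps inner_unit_left inner_unit_right)
      show "(z + s *\<^sub>R unit x) \<bullet> f y = \<kappa> x y" if y: "(y, x) \<in> R" for y
      proof -
        have "coord (f y) x = 0" using IH[OF y] asym[OF y] y irr by (auto simp: P_def)
        then show ?thesis using z(2)[of y] y by (simp add: S_def inner_simps inner_unit_left)
      qed
    qed
    then show "\<exists>u. P f x u" by blast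
  qed
  then obtain v where v: "\<And>x. P v x (v x)" by blast
  have "v x \<bullet> v y = \<kappa> x y" for x y
    using total[of x y] v[of x] v[of y] sym[of x y] inner_commute[of "v x" "v y"] by (auto simp: P_def)
  with that show thesis by blast
qed

section \<open>Representations and their absolutely continuous part\<close>

lemma closure_image_subset_bounded_linear:
  assumes "bounded_linear T" "T ` S \<subseteq> closure S'" "x \<in> closure S"
  shows "T x \<in> closure S'"
proof -
  have "T ` closure S \<subseteq> closure (T ` S)"
    using assms(1) by (intro continuous_image_closure_subset[of UNIV] linear_continuous_on) auto
  also have "\<dots> \<subseteq> closure S'"
    using assms(2) by (simp add: closure_minimal)
  finally show ?thesis using assms(3) by blast
qed

lemma closure_span_image_subset:
  assumes T: "bounded_linear T" and "\<And>x. x \<in> S \<Longrightarrow> T x \<in> closure (span S')" "x \<in> closure (span S)"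
  shows "T x \<in> closure (span S')"
proof (rule closure_image_subset_bounded_linear[OF T _ assms(3)])
  have "T ` span S = span (T ` S)"
    using T by (simp add: linear_span_image bounded_linear.linear)
  also have "\<dots> \<subseteq> closure (span S')"
    using assms(2) by (intro span_minimal subspace_closure) auto
  finally show "T ` span S \<subseteq> closure (span S')" .
qed

text \<open>
  The operators only form a representation by partial isometries: off the range of the projection
  \<open>U \<one>\<close> they vanish.
\<close>

locale star_rep = group G for G :: "('g, 'm) monoid_scheme" (structure) +
  fixes U :: "'g \<Rightarrow> 'h::{real_inner,banach} \<Rightarrow> 'h"
  assumes bounded_linear: "g \<in> carrier G \<Longrightarrow> bounded_linear (U g)"
    and mult: "g \<in> carrier G \<Longrightarrow> h \<in> carrier G \<Longrightarrow> U g (U h x) = U (g \<otimes> h) x"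
    and adjoint: "g \<in> carrier G \<Longrightarrow> U g x \<bullet> y = x \<bullet> U (inv g) y"
begin

lemma linear: "g \<in> carrier G \<Longrightarrow> linear (U g)"
  by (rule bounded_linear.linear[OF bounded_linear])

text \<open>The vectors whose orbit map, sending weights \<open>c\<close> to the sum of the
  \<open>c g *\<^sub>R U g w\<close>, extends to a bounded operator on square-summable weights. That
  operator intertwines the regular representation with \<open>U\<close>.\<close>

definition bounded_vectors :: "'h set" where
  "bounded_vectors = {w. \<exists>C. \<forall>F c. finite F \<longrightarrow> F \<subseteq> carrier G \<longrightarrow>
      (norm (\<Sum>g\<in>F. c g *\<^sub>R U g w))\<^sup>2 \<le> C * (\<Sum>g\<in>F. (c g)\<^sup>2)}"

definition ac_part :: "'h set" where "ac_part = closure bounded_vectors"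

lemma subspace_bounded_vectors: "subspace bounded_vectors"
proof (rule subspaceI)
  have "(\<Sum>g\<in>F. c g *\<^sub>R U g 0) = 0" if "F \<subseteq> carrier G" for F c
    using that linear_0[OF linear] by (intro sum.neutral) auto
  then show "0 \<in> bounded_vectors"
    unfolding bounded_vectors_def by (auto intro!: exI[of _ 0])
next
  fix x y assume "x \<in> bounded_vectors" "y \<in> bounded_vectors"
  then obtain C D where
    C: "\<And>F c. finite F \<Longrightarrow> F \<subseteq> carrier G \<Longrightarrow> (norm (\<Sum>g\<in>F. c g *\<^sub>R U g x))\<^sup>2 \<le> C * (\<Sum>g\<in>F. (c g)\<^sup>2)" and
    D: "\<And>F c. finite F \<Longrightarrow> F \<subseteq> carrier G \<Longrightarrow> (norm (\<Sum>g\<in>F. c g *\<^sub>R U g y))\<^sup>2 \<le> D * (\<Sum>g\<in>F. (c g)\<^sup>2)"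
    unfolding bounded_vectors_def by blast
  have "(norm (\<Sum>g\<in>F. c g *\<^sub>R U g (x + y)))\<^sup>2 \<le> (2 * C + 2 * D) * (\<Sum>g\<in>F. (c g)\<^sup>2)"
    if F: "finite F" "F \<subseteq> carrier G" for F c
  proof -
    define a b where "a = (\<Sum>g\<in>F. c g *\<^sub>R U g x)" and "b = (\<Sum>g\<in>F. c g *\<^sub>R U g y)"
    have "(\<Sum>g\<in>F. c g *\<^sub>R U g (x + y)) = (\<Sum>g\<in>F. c g *\<^sub>R U g x + c g *\<^sub>R U g y)"
      using F by (intro sum.cong refl) (auto simp: linear_add[OF linear] scaleR_add_right)
    also have "\<dots> = a + b" by (simp add: a_def b_def sum.distrib)
    finally have "(norm (\<Sum>g\<in>F. c g *\<^sub>R U g (x + y)))\<^sup>2 = (norm (a + b))\<^sup>2" by simp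
    also have "\<dots> \<le> 2 * (norm a)\<^sup>2 + 2 * (norm b)\<^sup>2"
      using zero_le_power2[of "norm (a - b)"]
      by (simp add: power2_norm_eq_inner inner_simps inner_commute)
    also have "\<dots> \<le> 2 * (C * (\<Sum>g\<in>F. (c g)\<^sup>2)) + 2 * (D * (\<Sum>g\<in>F. (c g)\<^sup>2))"
      using C[OF F, of c] D[OF F, of c] unfolding a_def b_def by linarith
    finally show ?thesis by (simp add: algebra_simps)
  qed
  then show "x + y \<in> bounded_vectors" unfolding bounded_vectors_def by blast
next
  fix x and k :: real assume "x \<in> bounded_vectors"
  then obtain C where
    C: "\<And>F c. finite F \<Longrightarrow> F \<subseteq> carrier G \<Longrightarrow> (norm (\<Sum>g\<in>F. c g *\<^sub>R U g x))\<^sup>2 \<le> C * (\<Sum>g\<in>F. (c g)\<^sup>2)"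
    unfolding bounded_vectors_def by blast
  have "(norm (\<Sum>g\<in>F. c g *\<^sub>R U g (k *\<^sub>R x)))\<^sup>2 \<le> (k\<^sup>2 * C) * (\<Sum>g\<in>F. (c g)\<^sup>2)"
    if F: "finite F" "F \<subseteq> carrier G" for F c
  proof -
    have "(\<Sum>g\<in>F. c g *\<^sub>R U g (k *\<^sub>R x)) = k *\<^sub>R (\<Sum>g\<in>F. c g *\<^sub>R U g x)"
      unfolding scaleR_sum_right
      using F by (intro sum.cong refl) (auto simp: linear_scale[OF linear] mult.commute)
    then show ?thesis
      using mult_left_mono[OF C[OF F, of c], of "k\<^sup>2"] by (simp add: power_mult_distrib mult.assoc)
  qed
  then show "k *\<^sub>R x \<in> bounded_vectors" unfolding bounded_vectors_def by blast
qed

lemma ac_part: "subspace ac_part" "closed ac_part"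
  unfolding ac_part_def by (simp_all add: subspace_closure subspace_bounded_vectors)

lemma bounded_vectors_subset: "bounded_vectors \<subseteq> ac_part"
  unfolding ac_part_def by (rule closure_subset)

lemma one_mult: "g \<in> carrier G \<Longrightarrow> U g (U \<one> x) = U g x" "g \<in> carrier G \<Longrightarrow> U \<one> (U g x) = U g x"
  by (simp_all add: mult)

text \<open>The coefficient is the adjoint of the bounded orbit map of \<open>w\<close>, applied to
  \<open>y\<close>. The reindexing \<open>i\<close> is there for the inverse, which makes it the
  coefficient \<open>U g y \<bullet> w\<close>.\<close>

lemma square_summable_coefficient:
  assumes w: "w \<in> bounded_vectors" and i: "inj_on i (carrier G)" "i ` carrier G \<subseteq> carrier G"
  obtains t :: "'g ell2" where "\<And>g. g \<in> carrier G \<Longrightarrow> coord t g = y \<bullet> U (i g) w"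
proof -
  obtain C where
    C: "\<And>F c. finite F \<Longrightarrow> F \<subseteq> carrier G \<Longrightarrow> (norm (\<Sum>g\<in>F. c g *\<^sub>R U g w))\<^sup>2 \<le> C * (\<Sum>g\<in>F. (c g)\<^sup>2)"
    using w unfolding bounded_vectors_def by blast
  define c where "c g = (if g \<in> carrier G then y \<bullet> U (i g) w else 0)" for g
  have bound: "(\<Sum>g\<in>F. (c g)\<^sup>2) \<le> \<bar>C\<bar> * (norm y)\<^sup>2" if F: "finite F" "F \<subseteq> carrier G" for F
  proof -
    define S where "S = (\<Sum>g\<in>F. (c g)\<^sup>2)"
    have inj: "inj_on i F" using i F by (meson inj_on_subset)
    define d where "d h = c (the_inv_into F i h)" for h
    have d: "d (i g) = c g" if "g \<in> F" for g using the_inv_into_f_f[OF inj that] by (simp add: d_def)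
    \<comment> \<open>The coefficients themselves serve as weights, so the estimate bounds
      \<open>S * S\<close> by a constant times \<open>S\<close>, and one factor \<open>S\<close>
      cancels.\<close>
    have "S = (\<Sum>g\<in>F. c g * (y \<bullet> U (i g) w))"
      unfolding S_def using F by (intro sum.cong refl) (auto simp: c_def power2_eq_square)
    also have "\<dots> = y \<bullet> (\<Sum>h\<in>i ` F. d h *\<^sub>R U h w)"
      by (simp add: sum.reindex[OF inj] inner_sum_right d)
    also have "\<dots> \<le> norm y * norm (\<Sum>h\<in>i ` F. d h *\<^sub>R U h w)" by (rule norm_cauchy_schwarz)
    finally have "S\<^sup>2 \<le> (norm y * norm (\<Sum>h\<in>i ` F. d h *\<^sub>R U h w))\<^sup>2"
      by (intro power_mono) (auto simp: S_def intro: sum_nonneg)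
    also have "\<dots> \<le> (norm y)\<^sup>2 * (C * (\<Sum>h\<in>i ` F. (d h)\<^sup>2))"
      unfolding power_mult_distrib using F i by (intro mult_left_mono C) auto
    also have "(\<Sum>h\<in>i ` F. (d h)\<^sup>2) = S" by (simp add: sum.reindex[OF inj] S_def d)
    also have "(norm y)\<^sup>2 * (C * S) \<le> (norm y)\<^sup>2 * (\<bar>C\<bar> * S)"
      by (intro mult_left_mono mult_right_mono) (auto simp: S_def intro: sum_nonneg)
    finally have "S * S \<le> (\<bar>C\<bar> * (norm y)\<^sup>2) * S" by (simp add: power2_eq_square mult_ac)
    moreover have "S \<ge> 0" by (auto simp: S_def intro: sum_nonneg)
    ultimately have "S \<le> \<bar>C\<bar> * (norm y)\<^sup>2"
      by (cases "S = 0") simp_all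
    then show ?thesis by (simp add: S_def)
  qed
  have "(\<lambda>g. (c g)\<^sup>2) summable_on UNIV"
  proof (rule nonneg_bdd_above_summable_on)
    show "bdd_above (sum (\<lambda>g. (c g)\<^sup>2) ` {F. F \<subseteq> UNIV \<and> finite F})"
    proof (rule bdd_aboveI2)
      fix F :: "'g set" assume "F \<in> {F. F \<subseteq> UNIV \<and> finite F}"
      then have "sum (\<lambda>g. (c g)\<^sup>2) F = sum (\<lambda>g. (c g)\<^sup>2) (F \<inter> carrier G)"
        by (intro sum.mono_neutral_right) (auto simp: c_def)
      then show "sum (\<lambda>g. (c g)\<^sup>2) F \<le> \<bar>C\<bar> * (norm y)\<^sup>2"
        using bound[of "F \<inter> carrier G"] \<open>F \<in> _\<close> by auto
    qed
  qed simp
  then have "coord (Abs_ell2 c) = c" by (simp add: Abs_ell2_inverse)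
  with that[of "Abs_ell2 c"] show thesis by (simp add: c_def)
qed

lemma proj_commute:
  assumes N: "subspace N" "closed N" and inv: "\<And>g x. g \<in> carrier G \<Longrightarrow> x \<in> N \<Longrightarrow> U g x \<in> N"
    and g: "g \<in> carrier G"
  shows "proj N (U g x) = U g (proj N x)"
  using g by (intro proj_eqI[OF N]) (auto simp: inv proj_in[OF N] adjoint inner_proj[OF N])

end

locale rep_pair = U: star_rep G U + V: star_rep G V
  for G :: "('g, 'm) monoid_scheme" (structure)
    and U :: "'g \<Rightarrow> 'h::{real_inner,banach} \<Rightarrow> 'h" and V :: "'g \<Rightarrow> 'k::{real_inner,banach} \<Rightarrow> 'k"
begin

lemma intertwiner_bounded_vectors:
  assumes T: "bounded_linear T" and int: "\<And>g x. g \<in> carrier G \<Longrightarrow> T (U g x) = V g (T x)"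
    and w: "w \<in> U.bounded_vectors"
  shows "T w \<in> V.bounded_vectors"
proof -
  obtain C where
    C: "\<And>F c. finite F \<Longrightarrow> F \<subseteq> carrier G \<Longrightarrow> (norm (\<Sum>g\<in>F. c g *\<^sub>R U g w))\<^sup>2 \<le> C * (\<Sum>g\<in>F. (c g)\<^sup>2)"
    using w unfolding U.bounded_vectors_def by blast
  obtain K where K: "\<And>x. norm (T x) \<le> norm x * K" using bounded_linear.bounded[OF T] by blast
  have "(norm (\<Sum>g\<in>F. c g *\<^sub>R V g (T w)))\<^sup>2 \<le> (K\<^sup>2 * C) * (\<Sum>g\<in>F. (c g)\<^sup>2)"
    if F: "finite F" "F \<subseteq> carrier G" for F c
  proof -
    have "(\<Sum>g\<in>F. c g *\<^sub>R V g (T w)) = T (\<Sum>g\<in>F. c g *\<^sub>R U g w)"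
      using F bounded_linear.linear[OF T]
      by (simp add: linear_sum linear_scale) (intro sum.cong refl, auto simp: int)
    then have "(norm (\<Sum>g\<in>F. c g *\<^sub>R V g (T w)))\<^sup>2 \<le> (norm (\<Sum>g\<in>F. c g *\<^sub>R U g w) * K)\<^sup>2"
      using K by (simp add: power_mono)
    also have "\<dots> \<le> K\<^sup>2 * (C * (\<Sum>g\<in>F. (c g)\<^sup>2))"
      using C[OF F, of c] by (simp add: power_mult_distrib mult.commute mult_left_mono)
    finally show ?thesis by (simp add: mult.assoc)
  qed
  then show ?thesis unfolding V.bounded_vectors_def by blast
qed

text \<open>All that is used of disjointness: an intertwiner can produce no singular component from
  an absolutely continuous vector.\<close>

lemma intertwiner_ac_part:
  assumes T: "bounded_linear T" and int: "\<And>g x. g \<in> carrier G \<Longrightarrow> T (U g x) = V g (T x)"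
    and w: "w \<in> U.ac_part"
  shows "T w \<in> V.ac_part"
  unfolding V.ac_part_def
  by (rule closure_image_subset_bounded_linear[OF T _ w[unfolded U.ac_part_def]])
     (use intertwiner_bounded_vectors[OF T int] closure_subset in blast)

abbreviation prod_rep :: "'g \<Rightarrow> 'h \<times> 'k \<Rightarrow> 'h \<times> 'k" where
  "prod_rep \<equiv> \<lambda>g x. (U g (fst x), V g (snd x))"

lemma star_rep_prod: "star_rep G prod_rep"
proof (intro star_rep.intro star_rep_axioms.intro U.is_group)
  show "bounded_linear (prod_rep g)" if "g \<in> carrier G" for g
    using that by (intro bounded_linear_Pair bounded_linear_compose[OF U.bounded_linear]
        bounded_linear_compose[OF V.bounded_linear] bounded_linear_fst bounded_linear_snd)
qed (simp_all add: inner_prod_def U.mult V.mult U.adjoint V.adjoint)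

end

text \<open>Coordinates off the carrier are set to zero, so the operator at the identity is the
  projection onto the families supported on the carrier and not the identity map.\<close>

definition left_shift :: "('g, 'm) monoid_scheme \<Rightarrow> 'g \<Rightarrow> 'g ell2 \<Rightarrow> 'g ell2" where
  "left_shift G g f = Abs_ell2 (\<lambda>h. if h \<in> carrier G then coord f (inv\<^bsub>G\<^esub> g \<otimes>\<^bsub>G\<^esub> h) else 0)"

context group
begin

lemma bij_betw_mult_left: "g \<in> carrier G \<Longrightarrow> bij_betw (\<lambda>h. g \<otimes> h) (carrier G) (carrier G)"
  by (rule bij_betwI[where g = "\<lambda>h. inv g \<otimes> h"]) (auto simp: m_assoc[symmetric])

lemma coord_left_shift:
  assumes g: "g \<in> carrier G"
  shows "coord (left_shift G g f) h = (if h \<in> carrier G then coord f (inv g \<otimes> h) else 0)"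
proof -
  have "(\<lambda>h. (coord f h)\<^sup>2) summable_on carrier G"
    by (rule summable_on_subset_banach[OF coord_square_summable]) simp
  then have "(\<lambda>h. (coord f (inv g \<otimes> h))\<^sup>2) summable_on carrier G"
    using summable_on_reindex_bij_betw[OF bij_betw_mult_left[of "inv g"], of "\<lambda>h. (coord f h)\<^sup>2"] g by simp
  then have "(\<lambda>h. (if h \<in> carrier G then coord f (inv g \<otimes> h) else 0)\<^sup>2) summable_on UNIV"
    by (rule summable_on_cong_neutral[THEN iffD1, rotated -1]) auto
  then show ?thesis unfolding left_shift_def by (simp add: Abs_ell2_inverse)
qed

lemma star_rep_left_shift: "star_rep G (left_shift G)"
proof (intro star_rep.intro star_rep_axioms.intro is_group)
  fix g assume g: "g \<in> carrier G"
  have adj: "left_shift G g x \<bullet> y = x \<bullet> left_shift G (inv g) y" if g: "g \<in> carrier G" for g and x y :: "'a ell2"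
  proof -
    have "left_shift G g x \<bullet> y = (\<Sum>\<^sub>\<infinity>h\<in>carrier G. coord x (inv g \<otimes> h) * coord y h)"
      unfolding inner_ell2_def using g by (intro infsum_cong_neutral) (auto simp: coord_left_shift)
    also have "\<dots> = (\<Sum>\<^sub>\<infinity>h\<in>carrier G. coord x (inv g \<otimes> (g \<otimes> h)) * coord y (g \<otimes> h))"
      by (rule infsum_reindex_bij_betw[OF bij_betw_mult_left[OF g], symmetric])
    also have "\<dots> = x \<bullet> left_shift G (inv g) y"
      unfolding inner_ell2_def using g
      by (intro infsum_cong_neutral) (auto simp: coord_left_shift m_assoc[symmetric])
    finally show ?thesis .
  qed
  show "left_shift G g x \<bullet> y = x \<bullet> left_shift G (inv g) y" for x y :: "'a ell2"
    using g by (rule adj)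
  show "left_shift G g (left_shift G h x) = left_shift G (g \<otimes> h) x" if "h \<in> carrier G" for h and x :: "'a ell2"
    using g that by (intro ell2_eqI) (auto simp: coord_left_shift inv_mult_group m_assoc)
  have le: "norm (left_shift G g x) \<le> norm x" for x :: "'a ell2"
  proof -
    have "(norm (left_shift G g x))\<^sup>2 = x \<bullet> left_shift G (inv g) (left_shift G g x)"
      using adj[OF g] by (simp add: power2_norm_eq_inner)
    also have "\<dots> = (\<Sum>\<^sub>\<infinity>h\<in>carrier G. coord x h * coord x h)"
      unfolding inner_ell2_def using g
      by (intro infsum_cong_neutral) (auto simp: coord_left_shift m_assoc[symmetric])
    also have "\<dots> \<le> (\<Sum>\<^sub>\<infinity>h\<in>UNIV. coord x h * coord x h)"
      using coord_square_summable[of x]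
      by (intro infsum_mono_neutral summable_on_subset_banach[of _ UNIV "carrier G"])
         (auto simp: power2_eq_square)
    also have "\<dots> = (norm x)\<^sup>2" by (simp add: power2_norm_eq_inner inner_ell2_def)
    finally show ?thesis by (rule power2_le_imp_le) simp
  qed
  show "bounded_linear (left_shift G g :: 'a ell2 \<Rightarrow> _)"
    by (rule bounded_linear_intro[where K = 1])
       (auto intro!: ell2_eqI simp: coord_left_shift[OF g] le)
qed

lemma left_shift_unit: "g \<in> carrier G \<Longrightarrow> left_shift G g (unit \<one>) = unit g"
  by (intro ell2_eqI) (auto simp: coord_left_shift inv_solve_left')

end

lemma in_closure_span: "x \<in> S \<Longrightarrow> x \<in> closure (span S)"
  by (rule closure_subset[THEN subsetD]) (rule span_base)

context star_rep
begin

abbreviation aug_rep :: "'g \<Rightarrow> 'h \<times> 'g ell2 \<Rightarrow> 'h \<times> 'g ell2" where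
  "aug_rep \<equiv> \<lambda>g x. (U g (fst x), left_shift G g (snd x))"

text \<open>Closure of a graph: the generators are the pairs \<open>(U g Z, unit g)\<close>. That
  the coefficient of \<open>Z\<close> against \<open>Y\<close> equals a square-summable
  \<open>y0\<close> means that \<open>(Y, - y0)\<close> is orthogonal to this space.\<close>

abbreviation orbit_span :: "'h \<Rightarrow> ('h \<times> 'g ell2) set" where
  "orbit_span Z \<equiv> closure (span ((\<lambda>g. aug_rep g (Z, unit \<one>)) ` carrier G))"

lemma rep_pair_aug: "rep_pair G U (left_shift G)"
  by (intro rep_pair.intro star_rep_axioms star_rep_left_shift)

lemma star_rep_aug: "star_rep G aug_rep"
  by (rule rep_pair.star_rep_prod[OF rep_pair_aug])

lemma orbit_span: "subspace (orbit_span Z)" "closed (orbit_span Z)"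
  by (simp_all add: subspace_closure)

lemma orbit_span_invariant:
  assumes g: "g \<in> carrier G" and x: "x \<in> orbit_span Z"
  shows "aug_rep g x \<in> orbit_span Z"
proof (rule closure_span_image_subset[OF _ _ x])
  interpret R: star_rep G aug_rep by (rule star_rep_aug)
  show "bounded_linear (aug_rep g)" using g by (rule R.bounded_linear)
  fix x assume "x \<in> (\<lambda>g. aug_rep g (Z, unit \<one>)) ` carrier G"
  then obtain h where h: "h \<in> carrier G" "x = aug_rep h (Z, unit \<one>)" by blast
  then have "aug_rep g x = aug_rep (g \<otimes> h) (Z, unit \<one>)" using R.mult[OF g] by blast
  then have "aug_rep g x \<in> (\<lambda>g. aug_rep g (Z, unit \<one>)) ` carrier G" using g h by blast
  then show "aug_rep g x \<in> orbit_span Z" by (rule in_closure_span)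
qed

lemma orbit_in_orbit_span: "g \<in> carrier G \<Longrightarrow> aug_rep g (Z, unit \<one>) \<in> orbit_span Z"
  by (intro in_closure_span) blast

lemma cyclic_in_orbit_span: "U \<one> Z = Z \<Longrightarrow> (Z, unit \<one>) \<in> orbit_span Z"
  using orbit_in_orbit_span[of \<one> Z] by (simp add: left_shift_unit)

lemma embed_ac_part: "w \<in> ac_part \<Longrightarrow> (w, 0) \<in> star_rep.ac_part G aug_rep"
proof -
  interpret L: star_rep G "left_shift G" by (rule star_rep_left_shift)
  interpret R: rep_pair G U aug_rep
    by (intro rep_pair.intro star_rep_axioms star_rep_aug)
  show "w \<in> ac_part \<Longrightarrow> (w, 0) \<in> star_rep.ac_part G aug_rep"
    by (rule R.intertwiner_ac_part[where T = "\<lambda>w. (w, 0)"])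
       (auto intro!: bounded_linear_Pair bounded_linear_ident bounded_linear_zero simp: linear_0[OF L.linear])
qed

lemma unit_bounded: "unit \<one> \<in> star_rep.bounded_vectors G (left_shift G)"
proof -
  interpret L: star_rep G "left_shift G" by (rule star_rep_left_shift)
  have "(norm (\<Sum>g\<in>F. c g *\<^sub>R left_shift G g (unit \<one>)))\<^sup>2 \<le> 1 * (\<Sum>g\<in>F. (c g)\<^sup>2)"
    if F: "finite F" "F \<subseteq> carrier G" for F c
  proof -
    have "(\<Sum>g\<in>F. c g *\<^sub>R left_shift G g (unit \<one>)) = (\<Sum>g\<in>F. c g *\<^sub>R unit g)"
      using F by (intro sum.cong refl) (auto simp: left_shift_unit)
    then have "(norm (\<Sum>g\<in>F. c g *\<^sub>R left_shift G g (unit \<one>)))\<^sup>2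
        = (\<Sum>g\<in>F. \<Sum>h\<in>F. if g = h then c g * c h else 0)"
      unfolding power2_norm_eq_inner
      by (simp only: inner_sum_sum) (intro sum.cong refl, auto simp: inner_unit_right)
    also have "\<dots> = (\<Sum>g\<in>F. (c g)\<^sup>2)"
      using F by (intro sum.cong refl) (simp add: power2_eq_square)
    finally show ?thesis by simp
  qed
  then show ?thesis unfolding L.bounded_vectors_def by blast
qed

lemma embed_unit: "(0, unit \<one>) \<in> star_rep.ac_part G aug_rep"
proof -
  interpret L: star_rep G "left_shift G" by (rule star_rep_left_shift)
  interpret R: rep_pair G "left_shift G" aug_rep
    by (intro rep_pair.intro star_rep_left_shift star_rep_aug)
  show ?thesis
    by (rule R.intertwiner_ac_part[where T = "\<lambda>w. (0, w)"])
       (use unit_bounded L.bounded_vectors_subset in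
         \<open>auto intro!: bounded_linear_Pair bounded_linear_ident bounded_linear_zero simp: linear_0[OF linear]\<close>)
qed

lemma ac_part_invariant:
  assumes h: "h \<in> carrier G" and w: "w \<in> ac_part"
  shows "U h w \<in> ac_part"
  unfolding ac_part_def
proof (rule closure_image_subset_bounded_linear[OF bounded_linear[OF h] _ w[unfolded ac_part_def]], safe)
  fix w assume "w \<in> bounded_vectors"
  then obtain C where
    C: "\<And>F c. finite F \<Longrightarrow> F \<subseteq> carrier G \<Longrightarrow> (norm (\<Sum>g\<in>F. c g *\<^sub>R U g w))\<^sup>2 \<le> C * (\<Sum>g\<in>F. (c g)\<^sup>2)"
    unfolding bounded_vectors_def by blast
  have "(norm (\<Sum>g\<in>F. c g *\<^sub>R U g (U h w)))\<^sup>2 \<le> C * (\<Sum>g\<in>F. (c g)\<^sup>2)"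
    if F: "finite F" "F \<subseteq> carrier G" for F c
  proof -
    \<comment> \<open>Right translation by \<open>h\<close> moves \<open>U h\<close> into the index
      and leaves the sum of squares unchanged.\<close>
    define c' where "c' k = c (k \<otimes> inv h)" for k
    have c': "c' (g \<otimes> h) = c g" if "g \<in> F" for g
      using that F h by (auto simp: c'_def m_assoc subset_iff)
    have inj: "inj_on (\<lambda>g. g \<otimes> h) F"
      using F h by (auto intro!: inj_onI simp: subset_iff)
    have "(\<Sum>g\<in>F. c g *\<^sub>R U g (U h w)) = (\<Sum>k\<in>(\<lambda>g. g \<otimes> h) ` F. c' k *\<^sub>R U k w)"
      unfolding sum.reindex[OF inj] using F h
      by (intro sum.cong refl) (auto simp: c' mult subset_iff)
    moreover have "(\<Sum>k\<in>(\<lambda>g. g \<otimes> h) ` F. (c' k)\<^sup>2) = (\<Sum>g\<in>F. (c g)\<^sup>2)"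
      unfolding sum.reindex[OF inj] by (intro sum.cong refl) (simp add: c')
    moreover have "(\<lambda>g. g \<otimes> h) ` F \<subseteq> carrier G" using F h by auto
    ultimately show ?thesis using C[of "(\<lambda>g. g \<otimes> h) ` F" c'] F by simp
  qed
  then have "U h w \<in> bounded_vectors" unfolding bounded_vectors_def by blast
  then show "U h w \<in> closure bounded_vectors" using closure_subset by blast
qed

text \<open>
  The cyclic subspace of \<open>(Z, \<delta>)\<close> splits along the disjoint summands, so it contains the singular
  component \<open>(Z - proj ac_part Z, 0)\<close>, while by hypothesis it is orthogonal to \<open>(Y, - y0)\<close>.
\<close>

lemma singular_coefficient_zero:
  assumes Z: "U \<one> Z = Z" and y0: "\<And>g. g \<in> carrier G \<Longrightarrow> U g Z \<bullet> Y = coord y0 g"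
    and g: "g \<in> carrier G"
  shows "U g (Z - proj ac_part Z) \<bullet> Y = 0"
proof -
  interpret L: star_rep G "left_shift G" by (rule star_rep_left_shift)
  interpret R: star_rep G aug_rep by (rule star_rep_aug)
  interpret RR: rep_pair G aug_rep aug_rep by (intro rep_pair.intro star_rep_aug)
  interpret RU: rep_pair G aug_rep U by (intro rep_pair.intro star_rep_aug star_rep_axioms)
  define N where "N = orbit_span Z"
  have N: "subspace N" "closed N" unfolding N_def by (rule orbit_span)+
  define q where "q = Z - proj ac_part Z"
  define T where "T x = x - proj N x" for x
  have T_linear: "bounded_linear T"
    unfolding T_def by (intro bounded_linear_sub bounded_linear_ident bounded_linear_proj N)
  have T_int: "T (aug_rep h x) = aug_rep h (T x)" if h: "h \<in> carrier G" for h x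
  proof -
    have "proj N (aug_rep h x) = aug_rep h (proj N x)"
      by (rule R.proj_commute[OF N _ h]) (unfold N_def, rule orbit_span_invariant)
    moreover have "aug_rep h (x - proj N x) = aug_rep h x - aug_rep h (proj N x)"
      by (rule linear_diff[OF R.linear[OF h]])
    ultimately show ?thesis unfolding T_def by (simp only:)
  qed
  have T_sa: "T x \<bullet> y = x \<bullet> T y" for x y
    unfolding T_def using proj_selfadjoint[OF N, of x y] by (simp only: inner_diff_left inner_diff_right)
  \<comment> \<open>\<open>T\<close> kills the cyclic vector, so on the singular component it agrees
    up to sign with its value on an absolutely continuous vector.\<close>
  have T_sum: "T (q, 0) = - T (proj ac_part Z, unit \<one>)"
  proof -
    have "T (Z, unit \<one>) = 0"
      unfolding T_def using proj_id[OF N] cyclic_in_orbit_span[OF Z] by (simp add: N_def)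
    moreover have "(Z, unit \<one>) = (q, 0) + (proj ac_part Z, unit \<one>)" by (simp add: q_def)
    ultimately have "T (q, 0) + T (proj ac_part Z, unit \<one>) = 0"
      using linear_add[OF bounded_linear.linear[OF T_linear], of "(q, 0)" "(proj ac_part Z, unit \<one>)"] by simp
    then show ?thesis by (rule eq_neg_iff_add_eq_0[THEN iffD2])
  qed
  have "(proj ac_part Z, unit \<one>) = (proj ac_part Z, 0) + (0, unit \<one>)" by simp
  also have "\<dots> \<in> R.ac_part"
    by (intro subspace_add R.ac_part embed_ac_part embed_unit proj_in ac_part)
  finally have "T (proj ac_part Z, unit \<one>) \<in> R.ac_part"
    by (intro RR.intertwiner_ac_part[OF T_linear] T_int)
  then have in_ac: "T (q, 0) \<in> R.ac_part"
    unfolding T_sum by (rule subspace_neg[OF R.ac_part(1)])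
  \<comment> \<open>Moving the self-adjoint \<open>T\<close> to the other side shows that
    \<open>T (q, 0)\<close> is also orthogonal to the absolutely continuous part; lying in it as
    well, it is 0.\<close>
  have perp: "T (q, 0) \<bullet> d = 0" if d: "d \<in> R.ac_part" for d
  proof -
    have "T d \<in> R.ac_part" using d by (intro RR.intertwiner_ac_part[OF T_linear] T_int)
    then have "fst (T d) \<in> ac_part"
      by (intro RU.intertwiner_ac_part[OF bounded_linear_fst]) simp_all
    then have "q \<bullet> fst (T d) = 0"
      unfolding q_def by (rule proj_orth[OF ac_part])
    then show ?thesis unfolding T_sa by (simp add: inner_prod_def)
  qed
  from perp[OF in_ac] have "T (q, 0) = 0" by simp
  then have "(q, 0) \<in> N" using proj_in[OF N, of "(q, 0)"] by (simp add: T_def)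
  then have "aug_rep g (q, 0) \<in> orbit_span Z"
    unfolding N_def by (rule orbit_span_invariant[OF g])
  then have "(Y, - y0) \<bullet> aug_rep g (q, 0) = 0"
  proof (rule orthogonal_closure_span[rotated])
    fix w assume "w \<in> (\<lambda>g. aug_rep g (Z, unit \<one>)) ` carrier G"
    then obtain h where h: "h \<in> carrier G" "w = aug_rep h (Z, unit \<one>)" by blast
    then show "(Y, - y0) \<bullet> w = 0"
      using y0[OF h(1)] by (simp add: inner_prod_def left_shift_unit inner_unit_right inner_commute)
  qed
  then have "Y \<bullet> U g q = 0" by (simp add: inner_prod_def linear_0[OF L.linear[OF g]])
  then show ?thesis unfolding q_def by (subst inner_commute)
qed

text \<open>
  The second coordinate is injective on the cyclic subspace of \<open>(w, \<delta>)\<close>; its polar decomposition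
  embeds that subspace isometrically into the regular representation.
\<close>

lemma ac_coefficient_regular:
  assumes w: "w \<in> ac_part"
  obtains \<zeta> :: "'g ell2" where
    "\<And>Y y0. \<exists>y. \<forall>g\<in>carrier G. U g w \<bullet> Y + coord y0 g = left_shift G g \<zeta> \<bullet> y"
proof -
  interpret L: star_rep G "left_shift G" by (rule star_rep_left_shift)
  interpret R: star_rep G aug_rep by (rule star_rep_aug)
  define N where "N = orbit_span w"
  have N: "subspace N" "closed N" unfolding N_def by (rule orbit_span)+
  \<comment> \<open>\<open>S'\<close> is the adjoint of the second coordinate restricted to
    \<open>N\<close>, and \<open>A\<close> is that restriction composed with its adjoint, hence
    positive.\<close>
  define S' where "S' z = proj N (0, z)" for z :: "'g ell2"
  define A where "A z = snd (S' z)" for z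
  have S'_linear: "bounded_linear S'"
    unfolding S'_def
    by (intro bounded_linear_compose[OF bounded_linear_proj[OF N]] bounded_linear_Pair
        bounded_linear_zero bounded_linear_ident)
  have A_linear: "bounded_linear A"
    unfolding A_def by (intro bounded_linear_compose[OF bounded_linear_snd S'_linear])
  have S'S': "S' z \<bullet> S' z' = A z \<bullet> z'" for z z'
    unfolding A_def S'_def using inner_proj[OF N proj_in[OF N], of "(0, z')" "(0, z)"]
    by (simp add: inner_prod_def inner_commute)
  have A_sa: "A z \<bullet> z' = z \<bullet> A z'" for z z'
    by (metis S'S' inner_commute)
  have A_contr: "norm (z - A z) \<le> norm z" for z
  proof -
    have "(norm (z - A z))\<^sup>2 \<le> (norm ((0, z) - S' z))\<^sup>2"
      by (simp add: power2_norm_eq_inner inner_prod_def A_def)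
    also have "\<dots> = (norm z)\<^sup>2 - S' z \<bullet> S' z"
      using inner_proj[OF N proj_in[OF N], of "(0, z)" "(0, z)"]
      by (simp add: power2_norm_eq_inner inner_diff_left inner_diff_right inner_commute S'_def
          inner_prod_def[of "(0, z)" "(0, z)"])
    also have "\<dots> \<le> (norm z)\<^sup>2" by simp
    finally show ?thesis by (rule power2_le_imp_le) simp
  qed
  have S'_int: "S' (left_shift G g z) = aug_rep g (S' z)" if g: "g \<in> carrier G" for g z
  proof -
    have "proj N (aug_rep g (0, z)) = aug_rep g (proj N (0, z))"
      by (rule R.proj_commute[OF N _ g]) (unfold N_def, rule orbit_span_invariant)
    then show ?thesis unfolding S'_def by (simp add: linear_0[OF linear[OF g]])
  qed
  have A_int: "left_shift G g (A z) = A (left_shift G g z)" if "g \<in> carrier G" for g z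
    using that by (simp add: A_def S'_int)
  obtain B where B: "bounded_linear B" "\<And>x y. B x \<bullet> y = x \<bullet> B y" "\<And>x. B (B x) = A x"
    "\<forall>C. bounded_linear C \<longrightarrow> (\<forall>x. C (A x) = A (C x)) \<longrightarrow> (\<forall>x. C (B x) = B (C x))"
    using selfadjoint_sqrt[OF A_linear A_sa A_contr] by blast
  have B_int: "left_shift G g (B z) = B (left_shift G g z)" if "g \<in> carrier G" for g z
    using B(4) L.bounded_linear[OF that] A_int[OF that] by blast
  have BB: "B z \<bullet> B z' = S' z \<bullet> S' z'" for z z'
    using B(2)[of z "B z'"] by (simp add: B(3) S'S' A_sa)
  define M where "M = closure (range B)"
  have "span (range B) = range B"
    using linear_subspace_image[OF bounded_linear.linear[OF B(1)] subspace_UNIV]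
    by (rule span_eq_iff[THEN iffD2])
  then have M: "M = closure (span (range B))" by (simp only: M_def)
  \<comment> \<open>Sending \<open>B z\<close> to \<open>S' z\<close> preserves inner products.
    \<open>V\<close> is the adjoint of this map, the partial isometry of the polar decomposition,
    and takes \<open>S' z\<close> back to \<open>B z\<close>.\<close>
  have "\<exists>v. v \<in> M \<and> (\<forall>z. v \<bullet> B z = x \<bullet> S' z) \<and> norm v \<le> norm x" for x
  proof -
    have "\<bar>\<Sum>z\<in>F. c z * (x \<bullet> S' z)\<bar> \<le> norm x * norm (\<Sum>z\<in>F. c z *\<^sub>R B z)" for F c
    proof -
      have "(\<Sum>z\<in>F. c z * (x \<bullet> S' z)) = x \<bullet> S' (\<Sum>z\<in>F. c z *\<^sub>R z)"
        using bounded_linear.linear[OF S'_linear] by (simp add: linear_sum linear_scale inner_sum_right)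
      moreover have "(\<Sum>z\<in>F. c z *\<^sub>R B z) = B (\<Sum>z\<in>F. c z *\<^sub>R z)"
        using bounded_linear.linear[OF B(1)] by (simp add: linear_sum linear_scale)
      moreover have "norm (B z) = norm (S' z)" for z by (simp add: norm_eq_sqrt_inner BB)
      ultimately show ?thesis by (simp add: Cauchy_Schwarz_ineq2)
    qed
    from riesz_family[of UNIV "\<lambda>z. x \<bullet> S' z" "norm x" B, OF this] show ?thesis
      unfolding M by (metis UNIV_I norm_ge_zero norm_zero)
  qed
  then obtain V where V: "\<And>x. V x \<in> M" "\<And>x z. V x \<bullet> B z = x \<bullet> S' z" "\<And>x. norm (V x) \<le> norm x"
    by metis
  have M_sub: "subspace M" unfolding M by (intro subspace_closure) simp
  have V_unique: "V x = v" if v: "v \<in> M" "\<And>z. v \<bullet> B z = x \<bullet> S' z" for x v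
  proof -
    have "V x - v \<in> M" using M_sub V(1) v(1) by (rule subspace_diff)
    then have "(V x - v) \<bullet> (V x - v) = 0"
      unfolding M by (rule orthogonal_closure_span[rotated]) (auto simp: inner_diff_left V(2) v(2))
    then show ?thesis by simp
  qed
  have V_linear: "bounded_linear V"
  proof (rule bounded_linear_intro[where K = 1])
    show "V (x + y) = V x + V y" for x y
      using M_sub by (intro V_unique) (auto simp: subspace_add V inner_add_left)
    show "V (r *\<^sub>R x) = r *\<^sub>R V x" for r x
      using M_sub by (intro V_unique) (auto simp: subspace_scale V)
  qed (simp add: V)
  have V_int: "V (aug_rep g x) = left_shift G g (V x)" if g: "g \<in> carrier G" for g x
  proof (rule V_unique)
    show "left_shift G g (V x) \<in> M"
      unfolding M
      by (rule closure_span_image_subset[OF L.bounded_linear[OF g] _ V(1)[of x, unfolded M]])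
         (auto simp: B_int[OF g] intro: in_closure_span)
    show "left_shift G g (V x) \<bullet> B z = aug_rep g x \<bullet> S' z" for z
      using g by (simp add: L.adjoint R.adjoint B_int V(2) S'_int)
  qed
  have V_S': "V (S' z) = B z" for z
    by (rule V_unique) (auto simp: M_def BB intro: closure_subset[THEN subsetD])
  have V_iso: "V x \<bullet> V y = x \<bullet> y" if x: "x \<in> closure (range S')" for x y
  proof -
    have "closed {x. V x \<bullet> V y = x \<bullet> y}"
      by (intro closed_Collect_eq continuous_intros linear_continuous_on V_linear)
    moreover have "V (S' z) \<bullet> V y = S' z \<bullet> y" for z
      using V(2)[of y z] by (simp add: V_S' inner_commute)
    then have "range S' \<subseteq> {x. V x \<bullet> V y = x \<bullet> y}" by auto
    ultimately have "closure (range S') \<subseteq> {x. V x \<bullet> V y = x \<bullet> y}" by (simp add: closure_minimal)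
    with x show ?thesis by blast
  qed
  define Q where "Q = closure (range S')"
  have Q: "subspace Q" "closed Q"
    unfolding Q_def using linear_subspace_image[OF bounded_linear.linear[OF S'_linear] subspace_UNIV]
    by (simp_all add: subspace_closure)
  have "Q \<subseteq> N"
    unfolding Q_def by (rule closure_minimal) (use N proj_in[OF N] in \<open>auto simp: S'_def\<close>)
  \<comment> \<open>Density of the range of \<open>S'\<close> in \<open>N\<close> amounts to
    injectivity of the second coordinate on \<open>N\<close>. A vector \<open>r\<close> of
    \<open>N\<close> orthogonal to that range has second coordinate 0; its first one is absolutely
    continuous and orthogonal to every bounded vector.\<close>
  have "N \<subseteq> Q"
  proof
    fix y assume y: "y \<in> N"
    define r where "r = y - proj Q y"
    have rN: "r \<in> N"
      unfolding r_def using subsetD[OF \<open>Q \<subseteq> N\<close> proj_in[OF Q, of y]] by (rule subspace_diff[OF N(1) y])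
    have "snd r \<bullet> z = 0" for z
    proof -
      have "S' z \<in> Q" unfolding Q_def by (rule closure_subset[THEN subsetD]) simp
      then have "r \<bullet> S' z = 0" unfolding r_def by (rule proj_orth[OF Q])
      then have "r \<bullet> (0, z) = 0"
        using inner_proj[OF N rN, of "(0, z)"] by (simp add: S'_def inner_commute)
      then show ?thesis by (simp add: inner_prod_def)
    qed
    from this[of "snd r"] have snd0: "snd r = 0" by simp
    have perp: "fst r \<bullet> d = 0" if d: "d \<in> bounded_vectors" for d
    proof -
      have "m_inv G ` carrier G \<subseteq> carrier G" by auto
      from square_summable_coefficient[OF d inv_inj this, of w] obtain t :: "'g ell2"
        where t: "\<And>g. g \<in> carrier G \<Longrightarrow> coord t g = w \<bullet> U (inv g) d" by blast
      \<comment> \<open>\<open>t\<close> is chosen so that \<open>(d, - t)\<close> is orthogonal to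
        every generator of \<open>N\<close>.\<close>
      have "(d, - t) \<bullet> r = 0"
        using rN unfolding N_def
      proof (rule orthogonal_closure_span[rotated])
        fix x assume "x \<in> (\<lambda>g. aug_rep g (w, unit \<one>)) ` carrier G"
        then obtain h where h: "h \<in> carrier G" "x = aug_rep h (w, unit \<one>)" by blast
        then show "(d, - t) \<bullet> x = 0"
          using adjoint[OF h(1), of w d] t[OF h(1)]
          by (simp add: inner_prod_def left_shift_unit inner_unit_right inner_commute)
      qed
      then show ?thesis using snd0 by (simp add: inner_prod_def inner_commute)
    qed
    have "fst r \<in> closure (span ac_part)"
    proof (rule closure_span_image_subset[OF bounded_linear_fst _ rN[unfolded N_def]])
      fix x assume "x \<in> (\<lambda>g. aug_rep g (w, unit \<one>)) ` carrier G"
      then obtain h where h: "h \<in> carrier G" "x = aug_rep h (w, unit \<one>)" by blast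
      have "U h w \<in> ac_part" using h(1) w by (rule ac_part_invariant)
      then show "fst x \<in> closure (span ac_part)"
        using h by (simp add: in_closure_span)
    qed
    also have "closure (span ac_part) = ac_part"
      using ac_part by (simp add: span_eq_iff[THEN iffD2])
    finally have "fst r \<in> ac_part" .
    moreover have "fst r \<bullet> d = 0" if "d \<in> ac_part" for d
    proof -
      have "closed {d. fst r \<bullet> d = 0}" by (intro closed_Collect_eq continuous_intros)
      with perp have "ac_part \<subseteq> {d. fst r \<bullet> d = 0}"
        unfolding ac_part_def by (intro closure_minimal) auto
      with that show ?thesis by blast
    qed
    ultimately have "fst r \<bullet> fst r = 0" by blast
    with snd0 have "r = 0" by (simp add: prod_eq_iff)
    then show "y \<in> Q" using proj_in[OF Q, of y] by (simp add: r_def)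
  qed
  \<comment> \<open>The witness depends on \<open>w\<close> alone, so several coefficients of
    \<open>w\<close> share it. The second coordinate \<open>unit \<one>\<close> of the cyclic vector
    lets \<open>y0\<close> enter as an arbitrary square-summable perturbation.\<close>
  show thesis
  proof
    fix Y :: 'h and y0 :: "'g ell2"
    have "U g w \<bullet> Y + coord y0 g = left_shift G g (V (w, unit \<one>)) \<bullet> V (Y, y0)"
      if g: "g \<in> carrier G" for g
    proof -
      have "aug_rep g (w, unit \<one>) \<in> closure (range S')"
        using orbit_in_orbit_span[OF g, of w] \<open>N \<subseteq> Q\<close> unfolding N_def Q_def by blast
      from V_iso[OF this, of "(Y, y0)"] show ?thesis
        unfolding V_int[OF g] using g
        by (simp add: inner_prod_def left_shift_unit inner_unit_left)
    qed
    then show "\<exists>y. \<forall>g\<in>carrier G. U g w \<bullet> Y + coord y0 g = left_shift G g (V (w, unit \<one>)) \<bullet> y"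
      by blast
  qed
qed

end

section \<open>Locally compact groups\<close>

locale lc_group = group K for K :: "('k, 'n) monoid_scheme" (structure) +
  fixes T :: "'k topology"
  assumes lc_group: "locally_compact_group K T"
begin

lemma topspace_eq [simp]: "topspace T = carrier K"
  using lc_group by (simp add: locally_compact_group_def)

lemma Hausdorff: "Hausdorff_space T" and locally_compact: "locally_compact_space T"
  using lc_group by (simp_all add: locally_compact_group_def)

lemma completely_regular: "completely_regular_space T"
  by (simp add: Hausdorff locally_compact locally_compact_regular_imp_completely_regular_space)

lemma continuous_map_mult:
  assumes "continuous_map X T f" "continuous_map X T g"
  shows "continuous_map X T (\<lambda>x. f x \<otimes> g x)"
proof -
  have "continuous_map (prod_topology T T) T (\<lambda>(x, y). x \<otimes> y)"
    using lc_group by (simp add: locally_compact_group_def)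
  from continuous_map_compose[OF continuous_map_pairedI[OF assms] this] show ?thesis
    by (simp add: o_def)
qed

lemma continuous_map_inv: "continuous_map X T f \<Longrightarrow> continuous_map X T (\<lambda>x. inv (f x))"
proof -
  have "continuous_map T T (\<lambda>x. inv x)"
    using lc_group by (simp add: locally_compact_group_def)
  then show "continuous_map X T f \<Longrightarrow> continuous_map X T (\<lambda>x. inv (f x))"
    using continuous_map_compose[of X T f T "\<lambda>x. inv x"] by (simp add: o_def)
qed

lemma continuous_map_const_T: "x \<in> carrier K \<Longrightarrow> continuous_map X T (\<lambda>_. x)"
  by simp

lemma continuous_map_ident_T: "continuous_map T T (\<lambda>x. x)"
  using continuous_map_id[of T] by (simp add: id_def)

lemma continuous_map_mult_left: "x \<in> carrier K \<Longrightarrow> continuous_map T T (\<lambda>k. x \<otimes> k)"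
  by (rule continuous_map_mult[OF continuous_map_const_T continuous_map_ident_T])

lemma continuous_map_mult_prod: "continuous_map (prod_topology T T) T (\<lambda>z. fst z \<otimes> snd z)"
  by (rule continuous_map_mult[OF continuous_map_fst continuous_map_snd])

lemma openin_carrier: "openin T V \<Longrightarrow> x \<in> V \<Longrightarrow> x \<in> carrier K"
  using openin_subset[of T V] by auto

lemma compactin_carrier: "compactin T C \<Longrightarrow> x \<in> C \<Longrightarrow> x \<in> carrier K"
  using compactin_subset_topspace[of T C] by auto

lemma nbhd_vimage:
  assumes "continuous_map T T f" "openin T U" "f \<one> \<in> U"
  obtains V where "openin T V" "\<one> \<in> V" "\<And>x. x \<in> V \<Longrightarrow> f x \<in> U"
proof
  show "openin T {x \<in> topspace T. f x \<in> U}"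
    using assms(1,2) by (rule openin_continuous_map_preimage)
qed (use assms in auto)

lemma nbhd_mult:
  assumes U: "openin T U" "\<one> \<in> U"
  obtains V where "openin T V" "\<one> \<in> V" "\<And>x y. x \<in> V \<Longrightarrow> y \<in> V \<Longrightarrow> x \<otimes> y \<in> U"
proof -
  let ?W = "{z \<in> topspace (prod_topology T T). (\<lambda>z. fst z \<otimes> snd z) z \<in> U}"
  have W: "openin (prod_topology T T) ?W"
    by (rule openin_continuous_map_preimage[OF continuous_map_mult_prod U(1)])
  have mem: "(\<one>, \<one>) \<in> ?W" using U by simp
  from W[unfolded openin_prod_topology_alt, rule_format, OF mem]
  obtain V1 V2 where V: "openin T V1" "openin T V2" "\<one> \<in> V1" "\<one> \<in> V2" "V1 \<times> V2 \<subseteq> ?W"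
    by auto
  show thesis
  proof
    show "openin T (V1 \<inter> V2)" "\<one> \<in> V1 \<inter> V2" using V by auto
    show "x \<otimes> y \<in> U" if "x \<in> V1 \<inter> V2" "y \<in> V1 \<inter> V2" for x y
      using that V(5) by auto
  qed
qed

lemma compact_nbhd:
  assumes "openin T U" "\<one> \<in> U"
  obtains V C where "openin T V" "\<one> \<in> V" "compactin T C" "V \<subseteq> C" "C \<subseteq> U"
proof -
  have "neighbourhood_base_of (compactin T) T"
    using locally_compact Hausdorff locally_compact_space_neighbourhood_base by blast
  from neighbourhood_base_of[THEN iffD1, OF this, rule_format, of U \<one>] assms show thesis
    using that by blast
qed

lemma compact_nbhd_one:
  obtains V C where "openin T V" "\<one> \<in> V" "compactin T C" "V \<subseteq> C"
  using compact_nbhd[of "topspace T"] by (metis one_closed openin_topspace topspace_eq)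

lemma compactin_image2:
  assumes "compactin T A" "compactin T B" "continuous_map (prod_topology T T) T (\<lambda>z. f (fst z) (snd z))"
  shows "compactin T ((\<lambda>z. f (fst z) (snd z)) ` (A \<times> B))"
  using assms by (intro image_compactin[of "prod_topology T T"]) (simp_all add: compactin_Times)

definition set_mult2 :: "'k set \<Rightarrow> 'k set \<Rightarrow> 'k set" where
  "set_mult2 A B = (\<lambda>z. fst z \<otimes> snd z) ` (A \<times> B)"

lemma compactin_set_mult2: "compactin T A \<Longrightarrow> compactin T B \<Longrightarrow> compactin T (set_mult2 A B)"
  unfolding set_mult2_def
  by (rule compactin_image2[OF _ _ continuous_map_mult_prod])

lemma set_mult2_iff: "x \<in> set_mult2 A B \<longleftrightarrow> (\<exists>a\<in>A. \<exists>b\<in>B. x = a \<otimes> b)"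
  unfolding set_mult2_def by force

lemma compactin_inv_image: "compactin T A \<Longrightarrow> compactin T ((\<lambda>x. inv x) ` A)"
  by (rule image_compactin[OF _ continuous_map_inv[OF continuous_map_ident_T]])

lemma closedin_compact: "compactin T C \<Longrightarrow> closedin T C"
  using Hausdorff compactin_imp_closedin by blast

subsection \<open>Continuous functions with compact support\<close>

text \<open>The support condition ranges over the whole type, so members vanish off the carrier and
  identities such as \<open>translate \<one> f = f\<close> hold as equalities of functions.\<close>

definition Cc :: "('k \<Rightarrow> real) set" where
  "Cc = {f. continuous_map T euclideanreal f \<and> (\<exists>C. compactin T C \<and> (\<forall>x. f x \<noteq> 0 \<longrightarrow> x \<in> C))}"

lemma Cc_continuous: "f \<in> Cc \<Longrightarrow> continuous_map T euclideanreal f"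
  by (simp add: Cc_def)

lemma Cc_outside: "f \<in> Cc \<Longrightarrow> x \<notin> carrier K \<Longrightarrow> f x = 0"
  unfolding Cc_def using compactin_carrier by blast

lemma CcI:
  "continuous_map T euclideanreal f \<Longrightarrow> compactin T C \<Longrightarrow> (\<And>x. f x \<noteq> 0 \<Longrightarrow> x \<in> C) \<Longrightarrow> f \<in> Cc"
  unfolding Cc_def by blast

lemma Cc_support:
  assumes "f \<in> Cc"
  obtains C where "compactin T C" "\<And>x. f x \<noteq> 0 \<Longrightarrow> x \<in> C"
  using assms unfolding Cc_def by blast

lemma Cc_mult:
  assumes f: "f \<in> Cc" and g: "continuous_map T euclideanreal g"
  shows "(\<lambda>x. g x * f x) \<in> Cc"
proof -
  obtain C where C: "compactin T C" "\<And>x. f x \<noteq> 0 \<Longrightarrow> x \<in> C" using Cc_support[OF f] by blast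
  show ?thesis
  proof (rule CcI[OF _ C(1)])
    show "continuous_map T euclideanreal (\<lambda>x. g x * f x)"
      using g Cc_continuous[OF f] by (rule continuous_map_real_mult)
  qed (simp add: C(2))
qed

lemma Cc_times: "f \<in> Cc \<Longrightarrow> g \<in> Cc \<Longrightarrow> (\<lambda>x. g x * f x) \<in> Cc"
  by (intro Cc_mult Cc_continuous)

lemma Cc_cmult: "f \<in> Cc \<Longrightarrow> (\<lambda>x. c * f x) \<in> Cc"
  by (intro Cc_mult) auto

lemma Cc_zero: "(\<lambda>x. 0) \<in> Cc"
  by (rule CcI[of _ "{}"]) auto

lemma Cc_add:
  assumes f: "f \<in> Cc" and g: "g \<in> Cc"
  shows "(\<lambda>x. f x + g x) \<in> Cc"
proof -
  obtain C where C: "compactin T C" "\<And>x. f x \<noteq> 0 \<Longrightarrow> x \<in> C" using Cc_support[OF f] by blast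
  obtain D where D: "compactin T D" "\<And>x. g x \<noteq> 0 \<Longrightarrow> x \<in> D" using Cc_support[OF g] by blast
  show ?thesis
  proof (rule CcI[OF _ compactin_Un[OF C(1) D(1)]])
    show "continuous_map T euclideanreal (\<lambda>x. f x + g x)"
      using Cc_continuous[OF f] Cc_continuous[OF g] by (rule continuous_map_add)
    show "x \<in> C \<union> D" if "f x + g x \<noteq> 0" for x
      using that C(2)[of x] D(2)[of x] by (cases "f x = 0") auto
  qed
qed

lemma Cc_diff: "f \<in> Cc \<Longrightarrow> g \<in> Cc \<Longrightarrow> (\<lambda>x. f x - g x) \<in> Cc"
  using Cc_add[OF _ Cc_cmult[of g "-1"]] by simp

lemma Cc_sum: "(\<And>i. i \<in> F \<Longrightarrow> f i \<in> Cc) \<Longrightarrow> (\<lambda>x. \<Sum>i\<in>F. f i x) \<in> Cc"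
  by (induction F rule: infinite_finite_induct) (auto intro: Cc_zero Cc_add)

lemma Cc_max:
  assumes f: "f \<in> Cc"
  shows "(\<lambda>x. max (f x) 0) \<in> Cc"
proof -
  obtain C where C: "compactin T C" "\<And>x. f x \<noteq> 0 \<Longrightarrow> x \<in> C" using Cc_support[OF f] by blast
  show ?thesis
  proof (rule CcI[OF _ C(1)])
    show "continuous_map T euclideanreal (\<lambda>x. max (f x) 0)"
      using Cc_continuous[OF f] by (intro continuous_map_real_max) auto
    show "x \<in> C" if "max (f x) 0 \<noteq> 0" for x
      using that C(2)[of x] by (cases "f x = 0") auto
  qed
qed

lemma Cc_bounded:
  assumes "f \<in> Cc"
  obtains M where "M > 0" "\<And>x. \<bar>f x\<bar> \<le> M"
proof -
  obtain C where C: "compactin T C" "\<And>x. f x \<noteq> 0 \<Longrightarrow> x \<in> C" using Cc_support[OF assms] by blast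
  have "compactin euclideanreal (f ` C)" by (intro image_compactin[OF C(1)] Cc_continuous assms)
  then have "bounded (f ` C)" by (simp add: compact_imp_bounded)
  then obtain M where "M > 0" "\<And>x. x \<in> C \<Longrightarrow> \<bar>f x\<bar> \<le> M" by (auto simp: bounded_pos)
  then have "\<bar>f x\<bar> \<le> M" for x using C(2)[of x] by (cases "f x = 0") auto
  with that \<open>M > 0\<close> show thesis by blast
qed

definition translate :: "'k \<Rightarrow> ('k \<Rightarrow> real) \<Rightarrow> 'k \<Rightarrow> real" where
  "translate x f k = (if k \<in> carrier K then f (inv x \<otimes> k) else 0)"

lemma continuous_map_real_cong:
  "continuous_map T euclideanreal g \<Longrightarrow> (\<And>x. x \<in> carrier K \<Longrightarrow> f x = g x) \<Longrightarrow> continuous_map T euclideanreal f"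
  using continuous_map_eq[of T euclideanreal g f] by simp

lemma continuous_map_real_compose:
  "continuous_map T euclideanreal f \<Longrightarrow> continuous_map X T g \<Longrightarrow> continuous_map X euclideanreal (\<lambda>x. f (g x))"
  using continuous_map_compose[of X T g euclideanreal f] by (simp add: o_def)

lemma Cc_translate:
  assumes f: "f \<in> Cc" and x: "x \<in> carrier K"
  shows "translate x f \<in> Cc"
proof -
  obtain C where C: "compactin T C" "\<And>x. f x \<noteq> 0 \<Longrightarrow> x \<in> C" using Cc_support[OF f] by blast
  show ?thesis
  proof (rule CcI)
    show "continuous_map T euclideanreal (translate x f)"
    proof (rule continuous_map_real_cong)
      show "continuous_map T euclideanreal (\<lambda>k. f (inv x \<otimes> k))"
        using x by (intro continuous_map_real_compose[OF Cc_continuous[OF f] continuous_map_mult_left]) simp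
    qed (simp add: translate_def)
    show "compactin T ((\<lambda>k. x \<otimes> k) ` C)"
      by (rule image_compactin[OF C(1) continuous_map_mult_left[OF x]])
    show "k \<in> (\<lambda>k. x \<otimes> k) ` C" if "translate x f k \<noteq> 0" for k
    proof -
      have "k \<in> carrier K" "inv x \<otimes> k \<in> C" using that C(2) by (auto simp: translate_def split: if_splits)
      moreover from this x have "k = x \<otimes> (inv x \<otimes> k)" by (simp add: m_assoc[symmetric])
      ultimately show ?thesis by blast
    qed
  qed
qed

lemma translate_translate:
  "x \<in> carrier K \<Longrightarrow> y \<in> carrier K \<Longrightarrow> translate x (translate y f) = translate (x \<otimes> y) f"
  by (auto simp: translate_def inv_mult_group m_assoc)

lemma translate_one: "f \<in> Cc \<Longrightarrow> translate \<one> f = f"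
  by (auto simp: translate_def Cc_outside)

lemma translate_times: "translate x (\<lambda>k. f k * g k) = (\<lambda>k. translate x f k * translate x g k)"
  by (auto simp: translate_def)

lemma left_uniform:
  assumes f: "f \<in> Cc" and e: "e > 0"
  obtains V where "openin T V" "\<one> \<in> V" "\<And>k s. k \<in> carrier K \<Longrightarrow> s \<in> V \<Longrightarrow> \<bar>f (k \<otimes> s) - f k\<bar> < e"
proof -
  obtain C where C: "compactin T C" "\<And>x. f x \<noteq> 0 \<Longrightarrow> x \<in> C" using Cc_support[OF f] by blast
  obtain W0 Cw where W: "openin T W0" "\<one> \<in> W0" "compactin T Cw" "W0 \<subseteq> Cw"
    using compact_nbhd_one by blast
  \<comment> \<open>If \<open>k\<close> lies outside \<open>D\<close>, neither \<open>k\<close> nor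
    \<open>k \<otimes> s\<close> with \<open>s\<close> in \<open>W0\<close> meets the support; on
    the compact \<open>D\<close> the tube lemma gives uniformity.\<close>
  define D where "D = set_mult2 C ((\<lambda>x. inv x) ` Cw)"
  have D: "compactin T D" unfolding D_def by (intro compactin_set_mult2 compactin_inv_image C W)
  let ?W = "{z \<in> topspace (prod_topology T T). \<bar>f (fst z \<otimes> snd z) - f (fst z)\<bar> \<in> {..<e}}"
  have "continuous_map (prod_topology T T) euclideanreal (\<lambda>z. \<bar>f (fst z \<otimes> snd z) - f (fst z)\<bar>)"
    by (intro continuous_map_real_abs continuous_map_diff
        continuous_map_real_compose[OF Cc_continuous[OF f] continuous_map_mult_prod]
        continuous_map_real_compose[OF Cc_continuous[OF f] continuous_map_fst])
  then have "openin (prod_topology T T) ?W"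
    by (rule openin_continuous_map_preimage) simp
  moreover have "D \<times> {\<one>} \<subseteq> ?W"
    using compactin_carrier[OF D] e by auto
  ultimately obtain U V where UV: "openin T U" "openin T V" "D \<subseteq> U" "\<one> \<in> V" "U \<times> V \<subseteq> ?W"
    using tube_lemma_left[of T T ?W D \<one>] D by auto
  show thesis
  proof
    show "openin T (V \<inter> W0)" "\<one> \<in> V \<inter> W0" using UV W by auto
    fix k s assume k: "k \<in> carrier K" and s: "s \<in> V \<inter> W0"
    then have sK: "s \<in> carrier K" using UV openin_carrier by blast
    show "\<bar>f (k \<otimes> s) - f k\<bar> < e"
    proof (cases "k \<in> D")
      case True
      then have "(k, s) \<in> U \<times> V" using s UV(3) by auto
      then have "(k, s) \<in> ?W" using UV(5) by blast
      then show ?thesis by simp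
    next
      case False
      have "f (k \<otimes> s) = 0"
      proof (rule ccontr)
        assume "f (k \<otimes> s) \<noteq> 0"
        then have "k \<otimes> s \<in> C" by (rule C(2))
        moreover have "k = (k \<otimes> s) \<otimes> inv s" using k sK by (simp add: m_assoc)
        ultimately show False using False s W by (auto simp: D_def set_mult2_iff)
      qed
      moreover have "f k = 0"
      proof (rule ccontr)
        assume "f k \<noteq> 0"
        then have "k \<in> C" by (rule C(2))
        then have "k \<otimes> inv \<one> \<in> D" unfolding D_def set_mult2_iff using W by blast
        then show False using False k by simp
      qed
      ultimately show ?thesis using e by simp
    qed
  qed
qed

lemma right_uniform:
  assumes f: "f \<in> Cc" and e: "e > 0"
  obtains V where "openin T V" "\<one> \<in> V" "\<And>k s. k \<in> carrier K \<Longrightarrow> s \<in> V \<Longrightarrow> \<bar>f (s \<otimes> k) - f k\<bar> < e"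
proof -
  \<comment> \<open>Inversion exchanges left and right translations.\<close>
  define g where "g k = (if k \<in> carrier K then f (inv k) else 0)" for k
  obtain C where C: "compactin T C" "\<And>x. f x \<noteq> 0 \<Longrightarrow> x \<in> C" using Cc_support[OF f] by blast
  have "g \<in> Cc"
  proof (rule CcI)
    show "continuous_map T euclideanreal g"
    proof (rule continuous_map_real_cong)
      show "continuous_map T euclideanreal (\<lambda>k. f (inv k))"
        by (rule continuous_map_real_compose[OF Cc_continuous[OF f] continuous_map_inv[OF continuous_map_ident_T]])
    qed (simp add: g_def)
    show "compactin T ((\<lambda>x. inv x) ` C)" by (rule compactin_inv_image[OF C(1)])
    show "k \<in> (\<lambda>x. inv x) ` C" if "g k \<noteq> 0" for k
      using that C(2)[of "inv k"] by (force simp: g_def image_iff split: if_splits)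
  qed
  then obtain V where V: "openin T V" "\<one> \<in> V" "\<And>k s. k \<in> carrier K \<Longrightarrow> s \<in> V \<Longrightarrow> \<bar>g (k \<otimes> s) - g k\<bar> < e"
    using left_uniform e by metis
  obtain V' where V': "openin T V'" "\<one> \<in> V'" "\<And>s. s \<in> V' \<Longrightarrow> inv s \<in> V"
    using nbhd_vimage[of "\<lambda>x. inv x" V] V continuous_map_inv[OF continuous_map_ident_T] by auto
  show thesis
  proof
    fix k s assume k: "k \<in> carrier K" and s: "s \<in> V'"
    then have sK: "s \<in> carrier K" using V' openin_carrier by blast
    from V(3)[of "inv k" "inv s"] k s V' sK show "\<bar>f (s \<otimes> k) - f k\<bar> < e"
      by (simp add: g_def inv_mult_group)
  qed (use V' in auto)
qed

text \<open>The compact \<open>S\<close> around the support still misses \<open>F\<close>. A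
  function that merely vanishes on \<open>F\<close> would not provide a compact set to which the
  next separation can be applied.\<close>

lemma Urysohn_Cc:
  assumes Q: "compactin T Q" and F: "closedin T F" "Q \<inter> F = {}"
  obtains f S where "f \<in> Cc" "\<And>x. 0 \<le> f x" "\<And>x. x \<in> Q \<Longrightarrow> f x = 1"
    "compactin T S" "\<And>x. f x \<noteq> 0 \<Longrightarrow> x \<in> S" "S \<inter> F = {}"
proof -
  obtain U C where U: "openin T U" "\<one> \<in> U" "compactin T C" "U \<subseteq> C"
    using compact_nbhd_one by blast
  define D where "D = set_mult2 Q C"
  have D: "compactin T D" unfolding D_def by (intro compactin_set_mult2 Q U)
  define O' where "O' = (\<Union>q\<in>Q. {k \<in> topspace T. inv q \<otimes> k \<in> U})"
  have O': "openin T O'"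
    unfolding O'_def
  proof (rule openin_Union, safe)
    fix q assume "q \<in> Q"
    then have "inv q \<in> carrier K" using compactin_carrier[OF Q] by simp
    from openin_continuous_map_preimage[OF continuous_map_mult_left[OF this] U(1)]
    show "openin T {k \<in> topspace T. inv q \<otimes> k \<in> U}" .
  qed
  have QO: "Q \<subseteq> O'" using compactin_carrier[OF Q] U by (auto simp: O'_def)
  have OD: "O' \<subseteq> D"
  proof
    fix k assume "k \<in> O'"
    then obtain q where q: "q \<in> Q" "k \<in> carrier K" "inv q \<otimes> k \<in> U" by (auto simp: O'_def)
    then have "k = q \<otimes> (inv q \<otimes> k)" using compactin_carrier[OF Q] by (simp add: m_assoc[symmetric])
    with q U show "k \<in> D" by (auto simp: D_def set_mult2_iff)
  qed
  have "closedin T (F \<union> (topspace T - O'))" using F(1) O' by (intro closedin_Un closedin_diff closedin_topspace)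
  moreover have "disjnt Q (F \<union> (topspace T - O'))" using F QO by (auto simp: disjnt_def)
  ultimately obtain g where g: "continuous_map T (top_of_set {0..1}) g"
    "g ` (F \<union> (topspace T - O')) \<subseteq> {0}" "g ` Q \<subseteq> {1::real}"
    using Urysohn_completely_regular_compact_closed[OF _ completely_regular Q, of 0 1] by (metis zero_le_one)
  have gc: "continuous_map T euclideanreal g" and g01: "\<And>x. x \<in> carrier K \<Longrightarrow> 0 \<le> g x \<and> g x \<le> 1"
    using g(1) by (auto simp: continuous_map_in_subtopology image_subset_iff Pi_iff)
  \<comment> \<open>\<open>g\<close> is cut off at level 1/2, so that the support lies in the closed
    set where \<open>g\<close> is at least 1/2, away from \<open>F\<close>.\<close>
  define f where "f x = (if x \<in> carrier K then max (2 * g x - 1) 0 else 0)" for x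
  define S where "S = D \<inter> {x \<in> topspace T. g x \<in> {1/2..}}"
  show thesis
  proof
    have fc: "continuous_map T euclideanreal f"
    proof (rule continuous_map_real_cong)
      show "continuous_map T euclideanreal (\<lambda>x. max (2 * g x - 1) 0)"
        by (intro continuous_map_real_max continuous_map_diff continuous_map_real_mult gc) auto
    qed (simp add: f_def)
    show SC: "compactin T S"
      unfolding S_def by (intro compact_Int_closedin D closedin_continuous_map_preimage[OF gc]) auto
    show fS: "x \<in> S" if "f x \<noteq> 0" for x
    proof -
      have x: "x \<in> carrier K" "g x > 1/2" using that by (auto simp: f_def max_def split: if_splits)
      then have "x \<in> O'" using g(2) by fastforce
      with x OD show ?thesis by (auto simp: S_def)
    qed
    show "f \<in> Cc" by (rule CcI[OF fc SC fS])
    show "0 \<le> f x" for x by (simp add: f_def)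
    show "f x = 1" if "x \<in> Q" for x using that g(3) compactin_carrier[OF Q that] by (auto simp: f_def)
    show "S \<inter> F = {}" using g(2) by (fastforce simp: S_def)
  qed
qed

end

subsection \<open>The Haar functional\<close>

context lc_group
begin

definition Cp :: "('k \<Rightarrow> real) set" where "Cp = {f \<in> Cc. \<forall>x. 0 \<le> f x}"

text \<open>Lists rather than finite sets of weighted translates: concatenation then adds two
  coverings even when a translate occurs in both.\<close>

definition covers :: "('k \<Rightarrow> real) \<Rightarrow> ('k \<Rightarrow> real) \<Rightarrow> (real \<times> 'k) list \<Rightarrow> bool" where
  "covers g f L \<longleftrightarrow> set L \<subseteq> {0..} \<times> carrier K \<and>
     (\<forall>x\<in>carrier K. f x \<le> (\<Sum>(c, s)\<leftarrow>L. c * g (inv s \<otimes> x)))"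

definition cover_sums :: "('k \<Rightarrow> real) \<Rightarrow> ('k \<Rightarrow> real) \<Rightarrow> real set" where
  "cover_sums g f = {sum_list (map fst L) | L. covers g f L}"

text \<open>The index \<open>(f : g)\<close> of the Haar-Weil construction.\<close>

definition cover_number :: "('k \<Rightarrow> real) \<Rightarrow> ('k \<Rightarrow> real) \<Rightarrow> real" where
  "cover_number g f = Inf (cover_sums g f)"

text \<open>What a majorizing function must satisfy for coverings to exist. Indicators of
  neighbourhoods qualify as well as nonzero members of \<open>Cp\<close>, so the shrinking functions
  of the construction need not be continuous.\<close>

definition bump :: "('k \<Rightarrow> real) \<Rightarrow> bool" where
  "bump g \<longleftrightarrow> (\<forall>x. 0 \<le> g x) \<and>
     (\<exists>x0\<in>carrier K. \<exists>W e. openin T W \<and> \<one> \<in> W \<and> 0 < e \<and> (\<forall>w\<in>W. e \<le> g (x0 \<otimes> w)))"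

definition ind :: "'k set \<Rightarrow> 'k \<Rightarrow> real" where "ind V x = of_bool (x \<in> V)"

lemma bump_nonneg: "bump g \<Longrightarrow> 0 \<le> g x" by (simp add: bump_def)

lemma CpD: "f \<in> Cp \<Longrightarrow> f \<in> Cc" "f \<in> Cp \<Longrightarrow> 0 \<le> f x" by (simp_all add: Cp_def)

lemma Cp_add: "f \<in> Cp \<Longrightarrow> g \<in> Cp \<Longrightarrow> (\<lambda>x. f x + g x) \<in> Cp"
  by (simp add: Cp_def Cc_add)

lemma Cp_cmult: "f \<in> Cp \<Longrightarrow> 0 \<le> c \<Longrightarrow> (\<lambda>x. c * f x) \<in> Cp"
  by (simp add: Cp_def Cc_cmult)

lemma Cp_translate: "f \<in> Cp \<Longrightarrow> x \<in> carrier K \<Longrightarrow> translate x f \<in> Cp"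
  by (simp add: Cp_def Cc_translate) (simp add: translate_def)

lemma bump_ind: "openin T V \<Longrightarrow> \<one> \<in> V \<Longrightarrow> bump (ind V)"
  unfolding bump_def ind_def
  by (intro conjI allI bexI[of _ \<one>] exI[of _ V] exI[of _ 1]) (auto dest: openin_carrier)

lemma bump_Cp:
  assumes f: "f \<in> Cp" and x0: "f x0 > 0"
  shows "bump f"
proof -
  have x0K: "x0 \<in> carrier K" using x0 Cc_outside[OF CpD(1)[OF f], of x0] by auto
  obtain V where V: "openin T V" "\<one> \<in> V" "\<And>k s. k \<in> carrier K \<Longrightarrow> s \<in> V \<Longrightarrow> \<bar>f (k \<otimes> s) - f k\<bar> < f x0 / 2"
    using left_uniform[OF CpD(1)[OF f], of "f x0 / 2"] x0 by auto
  have "f x0 / 2 \<le> f (x0 \<otimes> w)" if "w \<in> V" for w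
    using V(3)[OF x0K that] unfolding abs_less_iff by (simp add: field_simps)
  with V x0K x0 f show ?thesis unfolding bump_def
    by (intro conjI bexI[of _ x0] exI[of _ V] exI[of _ "f x0 / 2"]) (auto simp: Cp_def)
qed

lemma sum_list_pair_nonneg:
  fixes g :: "'k \<Rightarrow> real"
  assumes "set L \<subseteq> {0..} \<times> carrier K" "\<And>x. 0 \<le> g x"
  shows "0 \<le> (\<Sum>(c, s)\<leftarrow>L. c * g (inv s \<otimes> x))"
  using assms(1) by (induction L) (auto intro!: add_nonneg_nonneg mult_nonneg_nonneg assms(2))

lemma member_le_sum_list_pair:
  fixes g :: "'k \<Rightarrow> real"
  assumes "set L \<subseteq> {0..} \<times> carrier K" "\<And>x. 0 \<le> g x" "(c, s) \<in> set L"
  shows "c * g (inv s \<otimes> x) \<le> (\<Sum>(c, s)\<leftarrow>L. c * g (inv s \<otimes> x))"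
  using assms(1,3)
proof (induction L)
  case (Cons p L)
  then have L: "0 \<le> (\<Sum>(c, s)\<leftarrow>L. c * g (inv s \<otimes> x))" using sum_list_pair_nonneg[of L g x] assms(2) by auto
  obtain d t where p: "p = (d, t)" by fastforce
  have "0 \<le> d * g (inv t \<otimes> x)" using Cons.prems p assms(2) by auto
  with Cons L p show ?case by auto
qed simp

lemma cover_sums_nonneg: "r \<in> cover_sums g f \<Longrightarrow> 0 \<le> r"
  unfolding cover_sums_def covers_def by (force intro!: sum_list_nonneg)

lemma cover_exists:
  assumes f: "f \<in> Cc" and g: "bump g"
  shows "cover_sums g f \<noteq> {}"
proof -
  obtain x0 W e where x0: "x0 \<in> carrier K" "openin T W" "\<one> \<in> W" "0 < e" "\<And>w. w \<in> W \<Longrightarrow> e \<le> g (x0 \<otimes> w)"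
    using g unfolding bump_def by blast
  obtain C where C: "compactin T C" "\<And>x. f x \<noteq> 0 \<Longrightarrow> x \<in> C" using Cc_support[OF f] by blast
  obtain M where M: "M > 0" "\<And>x. \<bar>f x\<bar> \<le> M" using Cc_bounded[OF f] by blast
  define U where "U c = {k \<in> topspace T. inv c \<otimes> k \<in> W}" for c
  have "\<forall>V\<in>U ` C. openin T V"
  proof safe
    fix c assume "c \<in> C"
    then have "inv c \<in> carrier K" using compactin_carrier[OF C(1)] by simp
    from openin_continuous_map_preimage[OF continuous_map_mult_left[OF this] x0(2)]
    show "openin T (U c)" by (simp add: U_def)
  qed
  moreover have "C \<subseteq> \<Union>(U ` C)"
    using compactin_carrier[OF C(1)] x0(3) by (auto simp: U_def)
  ultimately obtain \<F> where "finite \<F>" "\<F> \<subseteq> U ` C" "C \<subseteq> \<Union>\<F>"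
    using C(1) unfolding compactin_def by meson
  then obtain D where D: "D \<subseteq> C" "finite D" "C \<subseteq> \<Union>(U ` D)"
    using finite_subset_image[of \<F> U C] by auto
  then obtain cs where cs: "set cs = D" using finite_list by blast
  have csK: "c \<in> carrier K" if "c \<in> set cs" for c using that cs D compactin_carrier[OF C(1)] by auto
  \<comment> \<open>The translate by \<open>c \<otimes> inv x0\<close> carries the region where
    \<open>g\<close> is at least \<open>e\<close> to a neighbourhood of \<open>c\<close>, and the
    weight lifts \<open>e\<close> to \<open>M\<close>.\<close>
  define L where "L = map (\<lambda>c. (M / e, c \<otimes> inv x0)) cs"
  have LK: "set L \<subseteq> {0..} \<times> carrier K"
    using M x0 csK by (auto simp: L_def)
  have "f x \<le> (\<Sum>(c, s)\<leftarrow>L. c * g (inv s \<otimes> x))" if x: "x \<in> carrier K" for x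
  proof (cases "f x = 0")
    case True
    then show ?thesis using sum_list_pair_nonneg[OF LK, of g x] bump_nonneg[OF g] by simp
  next
    case False
    then have "x \<in> C" by (rule C(2))
    then obtain c where "c \<in> D" "x \<in> U c" using D(3) by blast
    then have c: "c \<in> set cs" "inv c \<otimes> x \<in> W" by (simp_all add: cs U_def)
    have "inv (c \<otimes> inv x0) \<otimes> x = x0 \<otimes> (inv c \<otimes> x)"
      using csK[OF c(1)] x0(1) x by (simp add: inv_mult_group m_assoc)
    then have e: "e \<le> g (inv (c \<otimes> inv x0) \<otimes> x)" using x0(5)[OF c(2)] by simp
    have "f x \<le> M" using M(2)[of x] by simp
    also have "\<dots> = M / e * e" using x0(4) by simp
    also have "\<dots> \<le> M / e * g (inv (c \<otimes> inv x0) \<otimes> x)"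
      using e M x0(4) by (intro mult_left_mono) auto
    also have "\<dots> \<le> (\<Sum>(c, s)\<leftarrow>L. c * g (inv s \<otimes> x))"
      using c by (intro member_le_sum_list_pair[OF LK bump_nonneg[OF g]]) (auto simp: L_def)
    finally show ?thesis .
  qed
  then have "covers g f L" unfolding covers_def using LK by blast
  then show ?thesis unfolding cover_sums_def by blast
qed

lemma cover_number_le: "r \<in> cover_sums g f \<Longrightarrow> cover_number g f \<le> r"
  unfolding cover_number_def by (rule cInf_lower) (auto intro!: bdd_belowI[of _ 0] cover_sums_nonneg)

lemma le_cover_number:
  "f \<in> Cc \<Longrightarrow> bump g \<Longrightarrow> (\<And>r. r \<in> cover_sums g f \<Longrightarrow> B \<le> r) \<Longrightarrow> B \<le> cover_number g f"
  unfolding cover_number_def using cover_exists by (intro cInf_greatest) auto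

lemma cover_number_nonneg: "f \<in> Cc \<Longrightarrow> bump g \<Longrightarrow> 0 \<le> cover_number g f"
  by (rule le_cover_number) (auto intro: cover_sums_nonneg)

lemma cover_number_add:
  assumes f1: "f1 \<in> Cc" and f2: "f2 \<in> Cc" and g: "bump g"
  shows "cover_number g (\<lambda>x. f1 x + f2 x) \<le> cover_number g f1 + cover_number g f2"
proof -
  have sum: "cover_number g (\<lambda>x. f1 x + f2 x) \<le> r1 + r2"
    if r: "r1 \<in> cover_sums g f1" "r2 \<in> cover_sums g f2" for r1 r2
  proof -
    obtain L1 L2 where L: "r1 = sum_list (map fst L1)" "covers g f1 L1" "r2 = sum_list (map fst L2)" "covers g f2 L2"
      using r unfolding cover_sums_def by blast
    then have "covers g (\<lambda>x. f1 x + f2 x) (L1 @ L2)"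
      unfolding covers_def by (auto intro!: add_mono)
    moreover have "r1 + r2 = sum_list (map fst (L1 @ L2))" using L by simp
    ultimately have "r1 + r2 \<in> cover_sums g (\<lambda>x. f1 x + f2 x)" unfolding cover_sums_def by blast
    then show ?thesis by (rule cover_number_le)
  qed
  have "cover_number g (\<lambda>x. f1 x + f2 x) - r2 \<le> cover_number g f1" if "r2 \<in> cover_sums g f2" for r2
    using sum[OF _ that] by (intro le_cover_number[OF f1 g]) (simp add: algebra_simps)
  then have "cover_number g (\<lambda>x. f1 x + f2 x) - cover_number g f1 \<le> r2" if "r2 \<in> cover_sums g f2" for r2
    using that by (simp add: algebra_simps)
  then have "cover_number g (\<lambda>x. f1 x + f2 x) - cover_number g f1 \<le> cover_number g f2"
    by (rule le_cover_number[OF f2 g])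
  then show ?thesis by simp
qed

lemma cover_number_mono:
  assumes "f2 \<in> Cc" "bump g" "\<And>x. x \<in> carrier K \<Longrightarrow> f1 x \<le> f2 x"
  shows "cover_number g f1 \<le> cover_number g f2"
proof (rule le_cover_number[OF assms(1,2)])
  fix r assume "r \<in> cover_sums g f2"
  then obtain L where L: "r = sum_list (map fst L)" "covers g f2 L" unfolding cover_sums_def by blast
  then have "covers g f1 L" unfolding covers_def by (auto intro: order_trans[OF assms(3)])
  with L(1) have "r \<in> cover_sums g f1" unfolding cover_sums_def by blast
  then show "cover_number g f1 \<le> r" by (rule cover_number_le)
qed

lemma cover_number_cmult_le:
  assumes f: "f \<in> Cc" and g: "bump g" and c: "c > 0"
  shows "cover_number g (\<lambda>x. c * f x) \<le> c * cover_number g f"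
proof -
  have "cover_number g (\<lambda>x. c * f x) / c \<le> cover_number g f"
  proof (rule le_cover_number[OF f g])
    fix r assume "r \<in> cover_sums g f"
    then obtain L where L: "r = sum_list (map fst L)" "covers g f L" unfolding cover_sums_def by blast
    define L' where "L' = map (\<lambda>(d, s). (c * d, s)) L"
    have s: "(\<Sum>(d, s)\<leftarrow>L'. d * g (inv s \<otimes> x)) = c * (\<Sum>(d, s)\<leftarrow>L. d * g (inv s \<otimes> x))" for x
      unfolding L'_def by (induction L) (auto simp: algebra_simps)
    have "set L' \<subseteq> {0..} \<times> carrier K" using L(2) c by (auto simp: covers_def L'_def)
    then have "covers g (\<lambda>x. c * f x) L'"
      using L(2) c unfolding covers_def s by (auto intro: mult_left_mono)
    moreover have "c * r = sum_list (map fst L')"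
      unfolding L(1) L'_def by (induction L) (auto simp: algebra_simps)
    ultimately have "c * r \<in> cover_sums g (\<lambda>x. c * f x)" unfolding cover_sums_def by blast
    from cover_number_le[OF this] show "cover_number g (\<lambda>x. c * f x) / c \<le> r"
      using c by (simp add: field_simps)
  qed
  then show ?thesis using c by (simp add: field_simps)
qed

lemma cover_number_zero:
  assumes "bump g"
  shows "cover_number g (\<lambda>x. 0) = 0"
proof -
  have "covers g (\<lambda>x. 0) []" by (simp add: covers_def)
  then have "0 \<in> cover_sums g (\<lambda>x. 0)" unfolding cover_sums_def by force
  from cover_number_le[OF this] cover_number_nonneg[OF Cc_zero assms] show ?thesis by simp
qed

lemma cover_number_cmult:
  assumes f: "f \<in> Cc" and g: "bump g" and c: "c \<ge> 0"
  shows "cover_number g (\<lambda>x. c * f x) = c * cover_number g f"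
proof (cases "c = 0")
  case True
  then show ?thesis using cover_number_zero[OF g] by simp
next
  case False
  with c have c: "c > 0" by simp
  have "cover_number g (\<lambda>x. inverse c * (c * f x)) \<le> inverse c * cover_number g (\<lambda>x. c * f x)"
    using c by (intro cover_number_cmult_le Cc_cmult f g) simp
  also have "(\<lambda>x. inverse c * (c * f x)) = f" using c by auto
  finally show ?thesis using cover_number_cmult_le[OF f g c] c by (simp add: field_simps)
qed

lemma cover_number_translate:
  assumes f: "f \<in> Cc" and x: "x \<in> carrier K"
  shows "cover_number g (translate x f) = cover_number g f"
proof -
  have sub: "cover_sums g f \<subseteq> cover_sums g (translate x f)" if x: "x \<in> carrier K" for x f
  proof
    fix r assume "r \<in> cover_sums g f"
    then obtain L where L: "r = sum_list (map fst L)" "covers g f L" unfolding cover_sums_def by blast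
    define L' where "L' = map (\<lambda>(d, s). (d, x \<otimes> s)) L"
    have s: "(\<Sum>(d, s)\<leftarrow>L'. d * g (inv s \<otimes> y)) = (\<Sum>(d, s)\<leftarrow>L. d * g (inv s \<otimes> (inv x \<otimes> y)))"
      if y: "y \<in> carrier K" for y
      using L(2) y x unfolding L'_def covers_def
      by (intro arg_cong[of _ _ sum_list]) (auto simp: inv_mult_group m_assoc subset_iff)
    have "set L' \<subseteq> {0..} \<times> carrier K" using L(2) x by (auto simp: covers_def L'_def)
    moreover have "translate x f y \<le> (\<Sum>(d, s)\<leftarrow>L'. d * g (inv s \<otimes> y))" if y: "y \<in> carrier K" for y
      using L(2) x y unfolding s[OF y] by (simp add: covers_def translate_def)
    ultimately have "covers g (translate x f) L'" unfolding covers_def by blast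
    moreover have "r = sum_list (map fst L')"
      unfolding L(1) L'_def by (intro arg_cong[of _ _ sum_list]) auto
    ultimately show "r \<in> cover_sums g (translate x f)" unfolding cover_sums_def by blast
  qed
  have "translate (inv x) (translate x f) = f"
    using x f by (simp add: translate_translate translate_one)
  with sub[of "inv x" "translate x f"] sub[of x f] x show ?thesis
    unfolding cover_number_def by (simp add: subset_antisym)
qed

text \<open>It bounds the normalized quotient \<open>cover_number h f / cover_number h f0\<close>
  from above and, with the roles of \<open>f\<close> and \<open>f0\<close> exchanged, from below,
  both independently of \<open>h\<close>.\<close>

lemma cover_number_trans:
  assumes f: "f \<in> Cc" and g: "g \<in> Cc" "bump g" and h: "bump h"
  shows "cover_number h f \<le> cover_number g f * cover_number h g"
proof -
  have list: "(\<lambda>x. \<Sum>(c, s)\<leftarrow>L. c * translate s g x) \<in> Cc \<and>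
      cover_number h (\<lambda>x. \<Sum>(c, s)\<leftarrow>L. c * translate s g x) \<le> sum_list (map fst L) * cover_number h g"
    if "set L \<subseteq> {0..} \<times> carrier K" for L
    using that
  proof (induction L)
    case Nil
    then show ?case using Cc_zero cover_number_zero[OF h] by simp
  next
    case (Cons p L)
    obtain c s where p: "p = (c, s)" by fastforce
    have c: "c \<ge> 0" "s \<in> carrier K" using Cons.prems p by auto
    have IH: "(\<lambda>x. \<Sum>(c, s)\<leftarrow>L. c * translate s g x) \<in> Cc"
      "cover_number h (\<lambda>x. \<Sum>(c, s)\<leftarrow>L. c * translate s g x) \<le> sum_list (map fst L) * cover_number h g"
      using Cons by auto
    have t: "translate s g \<in> Cc" using g c by (simp add: Cc_translate)
    have "cover_number h (\<lambda>x. c * translate s g x + (\<Sum>(c, s)\<leftarrow>L. c * translate s g x))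
        \<le> cover_number h (\<lambda>x. c * translate s g x) + cover_number h (\<lambda>x. \<Sum>(c, s)\<leftarrow>L. c * translate s g x)"
      by (intro cover_number_add Cc_cmult t IH h)
    also have "cover_number h (\<lambda>x. c * translate s g x) = c * cover_number h g"
      using c g by (simp add: cover_number_cmult[OF t h] cover_number_translate)
    also have "c * cover_number h g + cover_number h (\<lambda>x. \<Sum>(c, s)\<leftarrow>L. c * translate s g x)
        \<le> (c + sum_list (map fst L)) * cover_number h g"
      using IH(2) by (simp add: algebra_simps)
    finally show ?case using Cc_add[OF Cc_cmult[OF t] IH(1)] by (simp add: p)
  qed
  have le: "cover_number h f \<le> r * cover_number h g" if r: "r \<in> cover_sums g f" for r
  proof -
    obtain L where L: "r = sum_list (map fst L)" "covers g f L" using r unfolding cover_sums_def by blast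
    then have LK: "set L \<subseteq> {0..} \<times> carrier K" by (simp add: covers_def)
    have "(\<Sum>(c, s)\<leftarrow>L. c * translate s g x) = (\<Sum>(c, s)\<leftarrow>L. c * g (inv s \<otimes> x))" if "x \<in> carrier K" for x
      using that by (simp add: translate_def)
    then have "cover_number h f \<le> cover_number h (\<lambda>x. \<Sum>(c, s)\<leftarrow>L. c * translate s g x)"
      using L(2) list[OF LK] h by (intro cover_number_mono) (auto simp: covers_def)
    with list[OF LK] L(1) show ?thesis by simp
  qed
  show ?thesis
  proof (cases "cover_number h g = 0")
    case True
    obtain r where "r \<in> cover_sums g f" using cover_exists[OF f g(2)] by blast
    from le[OF this] True show ?thesis by simp
  next
    case False
    then have pos: "cover_number h g > 0" using cover_number_nonneg[OF g(1) h] by simp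
    have "cover_number h f / cover_number h g \<le> cover_number g f"
      using le pos by (intro le_cover_number[OF f g(2)]) (simp add: field_simps)
    then show ?thesis using pos by (simp add: field_simps)
  qed
qed

lemma cover_number_pos:
  assumes f: "f \<in> Cc" "f x0 > 0" and g: "bump g" "\<And>x. g x \<le> M"
  shows "cover_number g f > 0"
proof -
  have x0: "x0 \<in> carrier K" using Cc_outside[OF f(1), of x0] f(2) by auto
  have M: "M > 0"
  proof -
    obtain x1 e where "0 < e" "e \<le> g x1" using g(1) unfolding bump_def by blast
    then show ?thesis using g(2)[of x1] by linarith
  qed
  have "f x0 / M \<le> cover_number g f"
  proof (rule le_cover_number[OF f(1) g(1)])
    fix r assume "r \<in> cover_sums g f"
    then obtain L where L: "r = sum_list (map fst L)" "covers g f L" unfolding cover_sums_def by blast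
    then have LK: "set L \<subseteq> {0..} \<times> carrier K" by (simp add: covers_def)
    have "f x0 \<le> (\<Sum>(c, s)\<leftarrow>L. c * g (inv s \<otimes> x0))" using L x0 by (simp add: covers_def)
    also have "\<dots> \<le> sum_list (map fst L) * M"
      using LK
    proof (induction L)
      case (Cons p L)
      have "fst p * g (inv (snd p) \<otimes> x0) \<le> fst p * M" using Cons.prems g(2) by (intro mult_left_mono) auto
      with Cons show ?case by (simp add: algebra_simps case_prod_beta)
    qed simp
    finally show "f x0 / M \<le> r" using M L(1) by (simp add: field_simps)
  qed
  moreover have "f x0 / M > 0" using f(2) M by simp
  ultimately show ?thesis by linarith
qed

text \<open>
  A covering of \<open>g = f1 + f2 + \<delta> f'\<close> is split in the proportions \<open>f1 / g\<close> and \<open>f2 / g\<close>, which are nearly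
  constant on the translates of a small \<open>V\<close>.
\<close>

lemma cover_number_superadd:
  assumes f: "f1 \<in> Cp" "f2 \<in> Cp" and f': "f' \<in> Cp" "\<And>x. f1 x \<noteq> 0 \<or> f2 x \<noteq> 0 \<Longrightarrow> 1 \<le> f' x"
    and \<delta>: "\<delta> > 0" and \<eta>: "\<eta> > 0"
  obtains V0 where "openin T V0" "\<one> \<in> V0" "\<And>V. openin T V \<Longrightarrow> \<one> \<in> V \<Longrightarrow> V \<subseteq> V0 \<Longrightarrow>
    cover_number (ind V) f1 + cover_number (ind V) f2
      \<le> (1 + 2 * \<eta>) * (cover_number (ind V) (\<lambda>x. f1 x + f2 x) + \<delta> * cover_number (ind V) f')"
proof -
  define g where "g x = f1 x + f2 x + \<delta> * f' x" for x
  have gCp: "g \<in> Cp" unfolding g_def using f f' \<delta> by (intro Cp_add Cp_cmult) auto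
  have quot: "(\<lambda>x. f x / max (g x) \<delta>) \<in> Cc" if "f \<in> Cc" for f
  proof -
    have "continuous_map T euclideanreal (\<lambda>x. max (g x) \<delta>)"
      by (intro continuous_map_real_max Cc_continuous[OF CpD(1)[OF gCp]]) simp
    then have "continuous_map T euclideanreal (\<lambda>x. 1 / max (g x) \<delta>)"
      using \<delta> by (intro continuous_map_real_divide) auto
    from Cc_mult[OF that this] show ?thesis by simp
  qed
  \<comment> \<open>Where \<open>f1\<close> or \<open>f2\<close> is nonzero,
    \<open>\<delta> * f'\<close> keeps \<open>g\<close> at least \<open>\<delta>\<close>, so the
    maximum changes nothing there; elsewhere it keeps the quotient continuous.\<close>
  define h1 h2 where "h1 x = f1 x / max (g x) \<delta>" and "h2 x = f2 x / max (g x) \<delta>" for x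
  have gpos: "max (g x) \<delta> > 0" for x using \<delta> by (simp add: max_def)
  have gsupp: "max (g x) \<delta> = g x" if "f1 x \<noteq> 0 \<or> f2 x \<noteq> 0" for x
  proof -
    have "\<delta> * 1 \<le> \<delta> * f' x" using f'(2)[OF that] \<delta> by (intro mult_left_mono) auto
    then show ?thesis using f CpD(2)[OF f(1), of x] CpD(2)[OF f(2), of x] by (simp add: g_def max_def)
  qed
  have h0: "0 \<le> h1 x" "0 \<le> h2 x" for x
    using gpos[of x] CpD(2)[OF f(1), of x] CpD(2)[OF f(2), of x] by (simp_all add: h1_def h2_def)
  have f1h: "f1 x = g x * h1 x" and f2h: "f2 x = g x * h2 x" for x
    using gsupp[of x] gpos[of x] by (cases "f1 x = 0"; cases "f2 x = 0"; simp add: h1_def h2_def)+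
  have hsum: "h1 x + h2 x \<le> 1" for x
  proof -
    have "f1 x + f2 x \<le> max (g x) \<delta>"
      using \<delta> CpD(2)[OF f'(1), of x] by (simp add: g_def max_def) (smt (verit) mult_nonneg_nonneg)
    then show ?thesis using gpos[of x] by (simp add: h1_def h2_def field_simps flip: add_divide_distrib)
  qed
  have "h1 \<in> Cc" "h2 \<in> Cc" unfolding h1_def h2_def using f by (auto intro: quot CpD)
  then obtain V1 V2 where
    V1: "openin T V1" "\<one> \<in> V1" "\<And>k s. k \<in> carrier K \<Longrightarrow> s \<in> V1 \<Longrightarrow> \<bar>h1 (k \<otimes> s) - h1 k\<bar> < \<eta>" and
    V2: "openin T V2" "\<one> \<in> V2" "\<And>k s. k \<in> carrier K \<Longrightarrow> s \<in> V2 \<Longrightarrow> \<bar>h2 (k \<otimes> s) - h2 k\<bar> < \<eta>"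
    using left_uniform \<eta> by metis
  show thesis
  proof
    show "openin T (V1 \<inter> V2)" "\<one> \<in> V1 \<inter> V2" using V1 V2 by auto
    fix V assume V: "openin T V" "\<one> \<in> V" "V \<subseteq> V1 \<inter> V2"
    note bV = bump_ind[OF V(1,2)]
    have main: "cover_number (ind V) f1 + cover_number (ind V) f2 \<le> (1 + 2 * \<eta>) * r"
      if r: "r \<in> cover_sums (ind V) g" for r
    proof -
      obtain L where L: "r = sum_list (map fst L)" "covers (ind V) g L" using r unfolding cover_sums_def by blast
      then have LK: "set L \<subseteq> {0..} \<times> carrier K" by (simp add: covers_def)
      \<comment> \<open>\<open>h\<close> exceeds \<open>h s\<close> by less than
        \<open>\<eta>\<close> on the translate of \<open>V\<close> by \<open>s\<close>, so scaling
        each weight \<open>c\<close> of a covering of \<open>g\<close> by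
        \<open>h s + \<eta>\<close> yields a covering of the product of \<open>g\<close> and
        \<open>h\<close>.\<close>
      have bound: "cover_number (ind V) f \<le> (\<Sum>(c, s)\<leftarrow>L. c * (h s + \<eta>))"
        if fh: "\<And>x. f x = g x * h x" and h0: "\<And>x. 0 \<le> h x"
          and unif: "\<And>k s. k \<in> carrier K \<Longrightarrow> s \<in> V \<Longrightarrow> \<bar>h (k \<otimes> s) - h k\<bar> < \<eta>" for f h
      proof -
        define L' where "L' = map (\<lambda>(c, s). (c * (h s + \<eta>), s)) L"
        have L'K: "set L' \<subseteq> {0..} \<times> carrier K"
          using LK h0 \<eta> by (fastforce simp: L'_def intro!: mult_nonneg_nonneg add_nonneg_nonneg)
        have "f x \<le> (\<Sum>(c, s)\<leftarrow>L'. c * ind V (inv s \<otimes> x))" if x: "x \<in> carrier K" for x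
        proof -
          have "f x \<le> (\<Sum>(c, s)\<leftarrow>L. c * ind V (inv s \<otimes> x)) * h x"
            unfolding fh using L(2) x h0 by (intro mult_right_mono) (auto simp: covers_def)
          also have "\<dots> = (\<Sum>(c, s)\<leftarrow>L. c * ind V (inv s \<otimes> x) * h x)"
            by (induction L) (auto simp: algebra_simps)
          also have "\<dots> \<le> (\<Sum>(c, s)\<leftarrow>L. c * (h s + \<eta>) * ind V (inv s \<otimes> x))"
          proof (rule sum_list_mono)
            fix p assume "p \<in> set L"
            then obtain c s where p: "p = (c, s)" "c \<ge> 0" "s \<in> carrier K" using LK by auto
            have "c * ind V (inv s \<otimes> x) * h x \<le> c * (h s + \<eta>) * ind V (inv s \<otimes> x)"
            proof (cases "inv s \<otimes> x \<in> V")
              case True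
              have "s \<otimes> (inv s \<otimes> x) = x" using p x by (simp add: m_assoc[symmetric])
              with unif[OF p(3) True] have "h x \<le> h s + \<eta>" by simp
              then show ?thesis using p True by (simp add: ind_def mult_left_mono)
            qed (simp add: ind_def)
            then show "(case p of (c, s) \<Rightarrow> c * ind V (inv s \<otimes> x) * h x)
                \<le> (case p of (c, s) \<Rightarrow> c * (h s + \<eta>) * ind V (inv s \<otimes> x))" by (simp add: p)
          qed
          also have "\<dots> = (\<Sum>(c, s)\<leftarrow>L'. c * ind V (inv s \<otimes> x))"
            unfolding L'_def by (intro arg_cong[of _ _ sum_list]) auto
          finally show ?thesis .
        qed
        with L'K have "covers (ind V) f L'" unfolding covers_def by blast
        moreover have "(\<Sum>(c, s)\<leftarrow>L. c * (h s + \<eta>)) = sum_list (map fst L')"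
          unfolding L'_def by (intro arg_cong[of _ _ sum_list]) auto
        ultimately have "(\<Sum>(c, s)\<leftarrow>L. c * (h s + \<eta>)) \<in> cover_sums (ind V) f" unfolding cover_sums_def by blast
        then show ?thesis by (rule cover_number_le)
      qed
      have "cover_number (ind V) f1 + cover_number (ind V) f2
          \<le> (\<Sum>(c, s)\<leftarrow>L. c * (h1 s + \<eta>)) + (\<Sum>(c, s)\<leftarrow>L. c * (h2 s + \<eta>))"
        using V V1 V2 by (intro add_mono bound[OF f1h h0(1)] bound[OF f2h h0(2)]) auto
      also have "\<dots> \<le> (1 + 2 * \<eta>) * sum_list (map fst L)"
        using LK
      proof (induction L)
        case (Cons p L)
        obtain c s where p: "p = (c, s)" "c \<ge> 0" using Cons.prems by fastforce
        have "c * (h1 s + \<eta>) + c * (h2 s + \<eta>) = c * (h1 s + h2 s) + 2 * \<eta> * c" by (simp add: algebra_simps)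
        also have "\<dots> \<le> c * 1 + 2 * \<eta> * c" using p mult_left_mono[OF hsum[of s], of c] by simp
        finally show ?case using Cons p by (simp add: algebra_simps)
      qed simp
      finally show ?thesis using L(1) by simp
    qed
    have "cover_number (ind V) f1 + cover_number (ind V) f2 \<le> (1 + 2 * \<eta>) * cover_number (ind V) g"
    proof -
      have "(cover_number (ind V) f1 + cover_number (ind V) f2) / (1 + 2 * \<eta>) \<le> cover_number (ind V) g"
        using main \<eta> by (intro le_cover_number[OF CpD(1)[OF gCp] bV]) (simp add: field_simps)
      then show ?thesis using \<eta> by (simp add: field_simps)
    qed
    also have "\<dots> \<le> (1 + 2 * \<eta>) * (cover_number (ind V) (\<lambda>x. f1 x + f2 x) + \<delta> * cover_number (ind V) f')"
    proof (rule mult_left_mono)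
      have "cover_number (ind V) g \<le> cover_number (ind V) (\<lambda>x. f1 x + f2 x) + cover_number (ind V) (\<lambda>x. \<delta> * f' x)"
        unfolding g_def using f f' by (intro cover_number_add Cc_add Cc_cmult bV CpD)
      then show "cover_number (ind V) g \<le> cover_number (ind V) (\<lambda>x. f1 x + f2 x) + \<delta> * cover_number (ind V) f'"
        using cover_number_cmult[OF CpD(1)[OF f'(1)] bV, of \<delta>] \<delta> by simp
    qed (use \<eta> in simp)
    finally show "cover_number (ind V) f1 + cover_number (ind V) f2
      \<le> (1 + 2 * \<eta>) * (cover_number (ind V) (\<lambda>x. f1 x + f2 x) + \<delta> * cover_number (ind V) f')" .
  qed
qed

end

context lc_group
begin

lemma ex_Cc_one:
  assumes "compactin T Q"
  shows "\<exists>f\<in>Cc. (\<forall>x. 0 \<le> f x) \<and> (\<forall>x\<in>Q. f x = 1)"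
  by (rule Urysohn_Cc[OF assms, of "{}"]) auto

text \<open>The functional is a cluster point of normalized covering numbers as the neighbourhood
  shrinks. Invariance, homogeneity and subadditivity are closed conditions that hold at every stage;
  superadditivity holds only up to an error that is made arbitrarily small.\<close>

lemma haar_on_Cp:
  obtains J :: "('k \<Rightarrow> real) \<Rightarrow> real" where
    "\<And>f. f \<in> Cp \<Longrightarrow> 0 \<le> J f"
    "\<And>f g. f \<in> Cp \<Longrightarrow> g \<in> Cp \<Longrightarrow> J (\<lambda>x. f x + g x) = J f + J g"
    "\<And>f c. f \<in> Cp \<Longrightarrow> 0 \<le> c \<Longrightarrow> J (\<lambda>x. c * f x) = c * J f"
    "\<And>f x. f \<in> Cp \<Longrightarrow> x \<in> carrier K \<Longrightarrow> J (translate x f) = J f"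
    "\<And>f x. f \<in> Cp \<Longrightarrow> f x > 0 \<Longrightarrow> J f > 0"
proof -
  obtain f0 where f0: "f0 \<in> Cc" "\<And>x. 0 \<le> f0 x" "f0 \<one> = 1"
    using ex_Cc_one[of "{\<one>}"] by auto
  then have f0p: "f0 \<in> Cp" and f0b: "bump f0" using bump_Cp[of f0 \<one>] by (auto simp: Cp_def)
  define nb where "nb V \<longleftrightarrow> openin T V \<and> \<one> \<in> V" for V
  define D where "D V = cover_number (ind V) f0" for V
  define J where "J V f = (if f \<in> Cp then cover_number (ind V) f / D V else 0)" for V f
  define B where "B f = (if f \<in> Cp then cover_number f0 f else 0)" for f
  have bump_nb: "bump (ind V)" if "nb V" for V using that bump_ind by (simp add: nb_def)
  have D: "D V > 0" if "nb V" for V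
    unfolding D_def by (rule cover_number_pos[OF f0(1) _ bump_nb[OF that], of \<one> 1]) (simp_all add: f0 ind_def)
  have range: "J V f \<in> {0..B f}" if V: "nb V" for V f
  proof (cases "f \<in> Cp")
    case True
    have "cover_number (ind V) f \<le> cover_number f0 f * D V"
      unfolding D_def by (rule cover_number_trans[OF CpD(1)[OF True] f0(1) f0b bump_nb[OF V]])
    then show ?thesis
      using True D[OF V] cover_number_nonneg[OF CpD(1)[OF True] bump_nb[OF V]]
      by (simp add: J_def B_def field_simps)
  qed (simp add: J_def B_def)
  \<comment> \<open>Product of the intervals given by the uniform upper bounds, compact by
    Tychonoff.\<close>
  define S where "S = PiE UNIV (\<lambda>f. {0..B f})"
  have "compactin (product_topology (\<lambda>_. euclideanreal) UNIV) S"
    unfolding S_def compactin_PiE by simp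
  then have S: "compact S" by (simp only: euclidean_product_topology compactin_euclidean_iff)
  define A where "A V = closure {J W | W. nb W \<and> W \<subseteq> V}" for V
  have "S \<inter> (\<Inter>V\<in>Collect nb. A V) \<noteq> {}"
  proof (rule compact_imp_fip_image[OF S])
    show "closed (A V)" for V unfolding A_def by simp
    fix I assume I: "finite I" "I \<subseteq> Collect nb"
    define W where "W = \<Inter>(insert (topspace T) I)"
    have W: "nb W"
      unfolding nb_def
    proof
      show "openin T W" unfolding W_def using I openin_topspace[of T] by (intro openin_Inter) (auto simp: nb_def)
      show "\<one> \<in> W" using I by (auto simp: W_def nb_def)
    qed
    have "J W \<in> S" using range[OF W] unfolding S_def by (intro PiE_I) auto
    moreover have "J W \<in> A V" if "V \<in> I" for V
      unfolding A_def using W that by (intro closure_subset[THEN subsetD]) (auto simp: W_def)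
    ultimately show "S \<inter> (\<Inter>V\<in>I. A V) \<noteq> {}" by blast
  qed
  then obtain J0 where J0: "J0 \<in> S" "\<And>V. nb V \<Longrightarrow> J0 \<in> A V" by auto
  have transfer: "J0 \<in> P" if P: "closed P" and V: "nb V" and W: "\<And>W. nb W \<Longrightarrow> W \<subseteq> V \<Longrightarrow> J W \<in> P" for P V
  proof -
    have "A V \<subseteq> P" unfolding A_def by (rule closure_minimal[OF _ P]) (use W in auto)
    with J0(2)[OF V] show ?thesis by blast
  qed
  have nbT: "nb (topspace T)" using openin_topspace[of T] by (simp add: nb_def)
  have cont: "continuous_on UNIV (\<lambda>J. J f)" for f :: "'k \<Rightarrow> real" and J :: "('k \<Rightarrow> real) \<Rightarrow> real"
    by (rule continuous_on_product_coordinates)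
  have nonneg: "0 \<le> J0 f" for f using J0(1) by (auto simp: S_def PiE_def Pi_def)
  have J0_translate: "J0 (translate x f) = J0 f" if f: "f \<in> Cp" and x: "x \<in> carrier K" for f x
  proof -
    have "J0 \<in> {J. J (translate x f) = J f}"
    proof (rule transfer[OF _ nbT])
      show "closed {J :: ('k \<Rightarrow> real) \<Rightarrow> real. J (translate x f) = J f}"
        by (intro closed_Collect_eq continuous_on_product_coordinates)
      show "J W \<in> {J. J (translate x f) = J f}" for W
        using cover_number_translate[OF CpD(1)[OF f] x] Cp_translate[OF f x] f by (simp add: J_def)
    qed
    then show ?thesis by simp
  qed
  have J0_cmult: "J0 (\<lambda>x. c * f x) = c * J0 f" if f: "f \<in> Cp" and c: "0 \<le> c" for f c
  proof -
    have "J0 \<in> {J. J (\<lambda>x. c * f x) = c * J f}"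
    proof (rule transfer[OF _ nbT])
      show "closed {J :: ('k \<Rightarrow> real) \<Rightarrow> real. J (\<lambda>x. c * f x) = c * J f}"
        by (intro closed_Collect_eq continuous_intros continuous_on_product_coordinates)
      show "J W \<in> {J. J (\<lambda>x. c * f x) = c * J f}" if W: "nb W" for W
        using cover_number_cmult[OF CpD(1)[OF f] bump_nb[OF W] c] Cp_cmult[OF f c] f by (simp add: J_def)
    qed
    then show ?thesis by simp
  qed
  have J0_sub: "J0 (\<lambda>x. f x + g x) \<le> J0 f + J0 g" if f: "f \<in> Cp" and g: "g \<in> Cp" for f g
  proof -
    have "J0 \<in> {J. J (\<lambda>x. f x + g x) \<le> J f + J g}"
    proof (rule transfer[OF _ nbT])
      show "closed {J :: ('k \<Rightarrow> real) \<Rightarrow> real. J (\<lambda>x. f x + g x) \<le> J f + J g}"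
        by (intro closed_Collect_le continuous_intros continuous_on_product_coordinates)
      show "J W \<in> {J. J (\<lambda>x. f x + g x) \<le> J f + J g}" if W: "nb W" for W
        using cover_number_add[OF CpD(1)[OF f] CpD(1)[OF g] bump_nb[OF W]] Cp_add[OF f g] f g D[OF W]
        by (simp add: J_def divide_right_mono flip: add_divide_distrib)
    qed
    then show ?thesis by simp
  qed
  have J0_super: "J0 f + J0 g \<le> J0 (\<lambda>x. f x + g x)" if f: "f \<in> Cp" and g: "g \<in> Cp" for f g
  proof (rule field_le_epsilon)
    fix e :: real assume e: "0 < e"
    obtain C1 where C1: "compactin T C1" "\<And>x. f x \<noteq> 0 \<Longrightarrow> x \<in> C1" using Cc_support[OF CpD(1)[OF f]] by blast
    obtain C2 where C2: "compactin T C2" "\<And>x. g x \<noteq> 0 \<Longrightarrow> x \<in> C2" using Cc_support[OF CpD(1)[OF g]] by blast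
    obtain f' where f': "f' \<in> Cc" "\<And>x. 0 \<le> f' x" "\<And>x. x \<in> C1 \<union> C2 \<Longrightarrow> f' x = 1"
      using ex_Cc_one[OF compactin_Un[OF C1(1) C2(1)]] by blast
    then have f'p: "f' \<in> Cp" by (simp add: Cp_def)
    have f'1: "1 \<le> f' x" if "f x \<noteq> 0 \<or> g x \<noteq> 0" for x using that f'(3)[of x] C1(2)[of x] C2(2)[of x] by auto
    define N where "N = B (\<lambda>x. f x + g x)"
    define N' where "N' = B f'"
    have N: "N \<ge> 0" "N' \<ge> 0" using range[OF nbT] unfolding N_def N'_def by (meson atLeastAtMost_iff order_trans)+
    \<comment> \<open>The error at a stage is at most
      \<open>2 * \<eta> * N + (1 + 2 * \<eta>) * (\<delta> * N')\<close>. With \<open>\<eta>\<close>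
      at most 1/2 these constants keep each of the two terms below \<open>e / 2\<close>.\<close>
    define \<eta> where "\<eta> = min (1/2) (e / (4 * (N + 1)))"
    define \<delta> where "\<delta> = e / (4 * (N' + 1))"
    have \<eta>: "\<eta> > 0" "\<eta> \<le> 1/2" and \<delta>: "\<delta> > 0"
    proof -
      have "0 < 4 * (N + 1)" "0 < 4 * (N' + 1)" using N by simp_all
      then show "\<delta> > 0" "\<eta> > 0" using e unfolding \<delta>_def \<eta>_def min_less_iff_conj by simp_all
      show "\<eta> \<le> 1/2" unfolding \<eta>_def by (rule min.cobounded1)
    qed
    have "\<eta> \<le> e / (4 * (N + 1))" unfolding \<eta>_def by (rule min.cobounded2)
    then have "\<eta> * (4 * (N + 1)) \<le> e" using N by (subst (asm) pos_le_divide_eq) simp_all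
    then have \<eta>N: "2 * \<eta> * N \<le> e / 2" using \<eta> by (simp add: algebra_simps)
    have "\<delta> * (4 * (N' + 1)) = e" using N by (simp add: \<delta>_def)
    then have \<delta>N: "2 * (\<delta> * N') \<le> e / 2" using \<delta> by (simp add: algebra_simps)
    obtain V0 where V0: "openin T V0" "\<one> \<in> V0" "\<And>V. openin T V \<Longrightarrow> \<one> \<in> V \<Longrightarrow> V \<subseteq> V0 \<Longrightarrow>
        cover_number (ind V) f + cover_number (ind V) g
          \<le> (1 + 2 * \<eta>) * (cover_number (ind V) (\<lambda>x. f x + g x) + \<delta> * cover_number (ind V) f')"
      using cover_number_superadd[OF f g f'p f'1 \<delta> \<eta>(1)] by blast
    have "J0 \<in> {J. J f + J g \<le> J (\<lambda>x. f x + g x) + e}"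
    proof (rule transfer)
      show "nb V0" using V0 by (simp add: nb_def)
      show "closed {J :: ('k \<Rightarrow> real) \<Rightarrow> real. J f + J g \<le> J (\<lambda>x. f x + g x) + e}"
        by (intro closed_Collect_le continuous_intros continuous_on_product_coordinates)
      fix V assume V: "nb V" "V \<subseteq> V0"
      define s where "s = J V (\<lambda>x. f x + g x)"
      define t where "t = J V f'"
      have "(cover_number (ind V) f + cover_number (ind V) g) / D V
          \<le> (1 + 2 * \<eta>) * (cover_number (ind V) (\<lambda>x. f x + g x) + \<delta> * cover_number (ind V) f') / D V"
        using V0(3)[of V] V D[OF V(1)] by (intro divide_right_mono) (auto simp: nb_def)
      then have "J V f + J V g \<le> (1 + 2 * \<eta>) * (s + \<delta> * t)"
        using f g f'p Cp_add[OF f g] by (simp add: J_def s_def t_def add_divide_distrib flip: times_divide_eq_right)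
      also have "\<dots> = s + 2 * \<eta> * s + (1 + 2 * \<eta>) * (\<delta> * t)" by (simp add: algebra_simps)
      also have "\<dots> \<le> s + 2 * \<eta> * N + 2 * (\<delta> * N')"
      proof (intro add_mono order_refl)
        have st: "0 \<le> s" "s \<le> N" "0 \<le> t" "t \<le> N'"
          using range[OF V(1)] unfolding s_def t_def N_def N'_def by auto
        show "2 * \<eta> * s \<le> 2 * \<eta> * N" using st \<eta> by (intro mult_left_mono) auto
        show "(1 + 2 * \<eta>) * (\<delta> * t) \<le> 2 * (\<delta> * N')"
          using st \<eta> \<delta> by (intro mult_mono) auto
      qed
      also have "\<dots> \<le> s + e" using \<eta>N \<delta>N by simp
      finally show "J V \<in> {J. J f + J g \<le> J (\<lambda>x. f x + g x) + e}" by (simp add: s_def)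
    qed
    then show "J0 f + J0 g \<le> J0 (\<lambda>x. f x + g x) + e" by simp
  qed
  have J0_pos: "J0 f > 0" if f: "f \<in> Cp" and x: "f x > 0" for f x
  proof -
    have fb: "bump f" using bump_Cp f x by blast
    obtain M where M: "M > 0" "\<And>x. \<bar>f x\<bar> \<le> M" using Cc_bounded[OF CpD(1)[OF f]] by blast
    define m where "m = cover_number f f0"
    have m: "m > 0" unfolding m_def
      by (rule cover_number_pos[OF f0(1) _ fb, of \<one> M]) (use f0 M in \<open>auto simp: abs_le_iff\<close>)
    \<comment> \<open>\<open>1 / m\<close> is a lower bound independent of the stage, so positivity
      survives the limit.\<close>
    have "J0 \<in> {J. 1 / m \<le> J f}"
    proof (rule transfer[OF _ nbT])
      show "closed {J :: ('k \<Rightarrow> real) \<Rightarrow> real. 1 / m \<le> J f}"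
        by (intro closed_Collect_le continuous_intros continuous_on_product_coordinates)
      show "J W \<in> {J. 1 / m \<le> J f}" if W: "nb W" for W
        using cover_number_trans[OF f0(1) CpD(1)[OF f] fb bump_nb[OF W]] f D[OF W] m
        by (simp add: J_def D_def m_def field_simps)
    qed
    then show ?thesis using m by (simp add: less_le_trans[of 0 "1/m"])
  qed
  show thesis
    by (rule that[of J0]) (auto intro: nonneg J0_translate J0_cmult J0_pos antisym[OF J0_sub J0_super])
qed

theorem haar_functional:
  obtains I :: "('k \<Rightarrow> real) \<Rightarrow> real" where
    "\<And>f g. f \<in> Cc \<Longrightarrow> g \<in> Cc \<Longrightarrow> I (\<lambda>x. f x + g x) = I f + I g"
    "\<And>f c. f \<in> Cc \<Longrightarrow> I (\<lambda>x. c * f x) = c * I f"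
    "\<And>f. f \<in> Cc \<Longrightarrow> (\<And>x. 0 \<le> f x) \<Longrightarrow> 0 \<le> I f"
    "\<And>f x. f \<in> Cc \<Longrightarrow> (\<And>x. 0 \<le> f x) \<Longrightarrow> f x > 0 \<Longrightarrow> I f > 0"
    "\<And>f x. f \<in> Cc \<Longrightarrow> x \<in> carrier K \<Longrightarrow> I (translate x f) = I f"
proof -
  obtain J :: "('k \<Rightarrow> real) \<Rightarrow> real" where
    J0: "\<And>f. f \<in> Cp \<Longrightarrow> 0 \<le> J f" and
    Jadd: "\<And>f g. f \<in> Cp \<Longrightarrow> g \<in> Cp \<Longrightarrow> J (\<lambda>x. f x + g x) = J f + J g" and
    Jcmult: "\<And>f c. f \<in> Cp \<Longrightarrow> 0 \<le> c \<Longrightarrow> J (\<lambda>x. c * f x) = c * J f" and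
    Jtr: "\<And>f x. f \<in> Cp \<Longrightarrow> x \<in> carrier K \<Longrightarrow> J (translate x f) = J f" and
    Jpos: "\<And>f x. f \<in> Cp \<Longrightarrow> f x > 0 \<Longrightarrow> J f > 0"
    using haar_on_Cp by blast
  define I where "I f = J (\<lambda>x. max (f x) 0) - J (\<lambda>x. max (- f x) 0)" for f
  have neg: "(\<lambda>x. - f x) \<in> Cc" if "f \<in> Cc" for f using Cc_cmult[OF that, of "-1"] by simp
  have p: "(\<lambda>x. max (f x) 0) \<in> Cp" "(\<lambda>x. max (- f x) 0) \<in> Cp" if "f \<in> Cc" for f
    using Cc_max[OF that] Cc_max[OF neg[OF that]] by (simp_all add: Cp_def)
  \<comment> \<open>Any decomposition into a difference of members of \<open>Cp\<close> gives the
    same value, so each law is checked on whichever decomposition is convenient.\<close>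
  have Ieq: "I f = J a - J b" if "f \<in> Cc" "a \<in> Cp" "b \<in> Cp" "\<And>x. f x = a x - b x" for f a b
  proof -
    have "(\<lambda>x. max (f x) 0 + b x) = (\<lambda>x. max (- f x) 0 + a x)" using that(4) by (auto simp: max_def)
    then have "J (\<lambda>x. max (f x) 0) + J b = J (\<lambda>x. max (- f x) 0) + J a"
      using Jadd[OF p(1)[OF that(1)] that(3)] Jadd[OF p(2)[OF that(1)] that(2)] by simp
    then show ?thesis by (simp add: I_def)
  qed
  have I_Cp: "I f = J f" if f: "f \<in> Cp" for f
  proof -
    have z: "(\<lambda>x. 0) \<in> Cp" by (simp add: Cp_def Cc_zero)
    have "J (\<lambda>x. 0) = 0" using Jcmult[OF z, of 0] by simp
    with Ieq[OF CpD(1)[OF f] f z] show ?thesis by simp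
  qed
  show thesis
  proof
    fix f g assume f: "f \<in> Cc" and g: "g \<in> Cc"
    have "I (\<lambda>x. f x + g x) = J (\<lambda>x. max (f x) 0 + max (g x) 0) - J (\<lambda>x. max (- f x) 0 + max (- g x) 0)"
      by (rule Ieq[OF Cc_add[OF f g] Cp_add[OF p(1)[OF f] p(1)[OF g]] Cp_add[OF p(2)[OF f] p(2)[OF g]]])
         (simp add: max_def)
    then show "I (\<lambda>x. f x + g x) = I f + I g"
      using Jadd[OF p(1)[OF f] p(1)[OF g]] Jadd[OF p(2)[OF f] p(2)[OF g]] by (simp add: I_def)
  next
    fix f and c :: real assume f: "f \<in> Cc"
    show "I (\<lambda>x. c * f x) = c * I f"
    proof (cases "c \<ge> 0")
      case True
      have "I (\<lambda>x. c * f x) = J (\<lambda>x. c * max (f x) 0) - J (\<lambda>x. c * max (- f x) 0)"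
        by (rule Ieq[OF Cc_cmult[OF f] Cp_cmult[OF p(1)[OF f] True] Cp_cmult[OF p(2)[OF f] True]])
           (simp add: max_def)
      then show ?thesis using Jcmult[OF p(1)[OF f] True] Jcmult[OF p(2)[OF f] True]
        by (simp add: I_def algebra_simps)
    next
      case False
      then have c: "0 \<le> - c" by simp
      have "I (\<lambda>x. c * f x) = J (\<lambda>x. (- c) * max (- f x) 0) - J (\<lambda>x. (- c) * max (f x) 0)"
        by (rule Ieq[OF Cc_cmult[OF f] Cp_cmult[OF p(2)[OF f] c] Cp_cmult[OF p(1)[OF f] c]])
           (simp add: max_def)
      then show ?thesis using Jcmult[OF p(1)[OF f] c] Jcmult[OF p(2)[OF f] c]
        by (simp add: I_def algebra_simps)
    qed
  next
    fix f x assume f: "f \<in> Cc" and x: "x \<in> carrier K"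
    have "I (translate x f) = J (translate x (\<lambda>x. max (f x) 0)) - J (translate x (\<lambda>x. max (- f x) 0))"
      by (rule Ieq[OF Cc_translate[OF f x] Cp_translate[OF p(1)[OF f] x] Cp_translate[OF p(2)[OF f] x]])
         (simp add: translate_def max_def)
    then show "I (translate x f) = I f" using Jtr[OF p(1)[OF f] x] Jtr[OF p(2)[OF f] x] by (simp add: I_def)
  next
    fix f assume "f \<in> Cc" "\<And>x. 0 \<le> f x"
    then have f: "f \<in> Cp" by (simp add: Cp_def)
    then show "0 \<le> I f" by (simp add: I_Cp J0)
    show "I f > 0" if "f x > 0" for x using Jpos[OF f that] I_Cp[OF f] by simp
  qed
qed

end

section \<open>The tensor product with the regular representation\<close>

text \<open>Only the functional is kept. Inner products of functions on the group are written
  \<open>I (\<lambda>z. a z * b z)\<close>, and no space of square-integrable functions is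
  formed.\<close>

locale haar_group = lc_group K T for K :: "('k, 'n) monoid_scheme" (structure) and T :: "'k topology" +
  fixes I :: "('k \<Rightarrow> real) \<Rightarrow> real"
  assumes I_add: "f \<in> Cc \<Longrightarrow> g \<in> Cc \<Longrightarrow> I (\<lambda>x. f x + g x) = I f + I g"
    and I_cmult: "f \<in> Cc \<Longrightarrow> I (\<lambda>x. c * f x) = c * I f"
    and I_nonneg: "f \<in> Cc \<Longrightarrow> (\<And>x. 0 \<le> f x) \<Longrightarrow> 0 \<le> I f"
    and I_pos: "f \<in> Cc \<Longrightarrow> (\<And>x. 0 \<le> f x) \<Longrightarrow> f x > 0 \<Longrightarrow> I f > 0"
    and I_translate: "f \<in> Cc \<Longrightarrow> x \<in> carrier K \<Longrightarrow> I (translate x f) = I f"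
begin

lemma I_zero: "I (\<lambda>x. 0) = 0"
  using I_cmult[OF Cc_zero, of 0] by simp

lemma I_sum: "(\<And>i. i \<in> F \<Longrightarrow> f i \<in> Cc) \<Longrightarrow> I (\<lambda>x. \<Sum>i\<in>F. f i x) = (\<Sum>i\<in>F. I (f i))"
  by (induction F rule: infinite_finite_induct) (auto simp: I_zero I_add Cc_sum)

lemma I_diff: "f \<in> Cc \<Longrightarrow> g \<in> Cc \<Longrightarrow> I (\<lambda>x. f x - g x) = I f - I g"
  using I_add[of f "\<lambda>x. (-1) * g x"] I_cmult[of g "-1"] Cc_cmult[of g "-1"] by simp

lemma I_mono: "f \<in> Cc \<Longrightarrow> g \<in> Cc \<Longrightarrow> (\<And>x. f x \<le> g x) \<Longrightarrow> I f \<le> I g"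
  using I_nonneg[of "\<lambda>x. g x - f x"] I_diff[of g f] Cc_diff[of g f] by simp

text \<open>\<open>conv a b\<close> is the convolution of \<open>a\<close> with the reflection of \<open>b\<close>.\<close>

definition conv :: "('k \<Rightarrow> real) \<Rightarrow> ('k \<Rightarrow> real) \<Rightarrow> 'k \<Rightarrow> real" where
  "conv a b z = (if z \<in> carrier K then I (\<lambda>y. a y * translate z b y) else 0)"

lemma Cc_abs: "f \<in> Cc \<Longrightarrow> (\<lambda>x. \<bar>f x\<bar>) \<in> Cc"
proof -
  assume f: "f \<in> Cc"
  have "(\<lambda>x. max (f x) 0 + max (-1 * f x) 0) \<in> Cc"
    by (intro Cc_add Cc_max Cc_cmult f)
  moreover have "(\<lambda>x. max (f x) 0 + max (-1 * f x) 0) = (\<lambda>x. \<bar>f x\<bar>)" by auto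
  ultimately show ?thesis by simp
qed

lemma I_abs:
  assumes f: "f \<in> Cc"
  shows "\<bar>I f\<bar> \<le> I (\<lambda>x. \<bar>f x\<bar>)"
proof -
  have "I f \<le> I (\<lambda>x. \<bar>f x\<bar>)" by (rule I_mono[OF f Cc_abs[OF f]]) simp
  moreover have "I (\<lambda>x. -1 * f x) \<le> I (\<lambda>x. \<bar>f x\<bar>)" by (rule I_mono[OF Cc_cmult[OF f] Cc_abs[OF f]]) simp
  moreover have "I (\<lambda>x. -1 * f x) = - I f" using I_cmult[OF f, of "-1"] by simp
  ultimately show ?thesis by simp
qed

lemma continuous_map_conv:
  assumes a: "a \<in> Cc" and b: "b \<in> Cc"
  shows "continuous_map T euclideanreal (conv a b)"
  unfolding continuous_map
proof (intro conjI allI impI)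
  fix U :: "real set" assume U: "openin euclideanreal U"
  show "openin T {z \<in> topspace T. conv a b z \<in> U}"
  proof (subst openin_subopen, intro ballI)
    fix z0 assume "z0 \<in> {z \<in> topspace T. conv a b z \<in> U}"
    then have z0: "z0 \<in> carrier K" "conv a b z0 \<in> U" by auto
    obtain e where e: "e > 0" "ball (conv a b z0) e \<subseteq> U"
      using U z0(2) by (meson open_contains_ball open_openin)
    define N where "N = I (\<lambda>x. \<bar>a x\<bar>)"
    have N: "N \<ge> 0" unfolding N_def by (rule I_nonneg[OF Cc_abs[OF a]]) simp
    define d where "d = e / (N + 1)"
    have d: "d > 0" using e N by (simp add: d_def)
    obtain V where V: "openin T V" "\<one> \<in> V"
      "\<And>k s. k \<in> carrier K \<Longrightarrow> s \<in> V \<Longrightarrow> \<bar>b (s \<otimes> k) - b k\<bar> < d"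
      using right_uniform[OF b d] by metis
    define W where "W = {z \<in> topspace T. inv z \<otimes> z0 \<in> V}"
    have "continuous_map T T (\<lambda>z. inv z \<otimes> z0)"
      by (rule continuous_map_mult[OF continuous_map_inv[OF continuous_map_ident_T] continuous_map_const_T[OF z0(1)]])
    then have W: "openin T W" unfolding W_def using V(1) by (rule openin_continuous_map_preimage)
    have "z0 \<in> W" using z0 V by (simp add: W_def)
    moreover have "W \<subseteq> {z \<in> topspace T. conv a b z \<in> U}"
    proof
      fix z assume "z \<in> W"
      then have z: "z \<in> carrier K" "inv z \<otimes> z0 \<in> V" by (simp_all add: W_def)
      have le: "\<bar>a y * translate z b y - a y * translate z0 b y\<bar> \<le> d * \<bar>a y\<bar>" for y
      proof (cases "y \<in> carrier K")
        case True
        \<comment> \<open>This isolates the small factor on the left, where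
          \<open>right_uniform\<close> applies.\<close>
        have "inv z \<otimes> y = (inv z \<otimes> z0) \<otimes> (inv z0 \<otimes> y)"
        proof -
          have "(inv z \<otimes> z0) \<otimes> (inv z0 \<otimes> y) = inv z \<otimes> (z0 \<otimes> (inv z0 \<otimes> y))"
            using z z0 True by (simp add: m_assoc)
          also have "z0 \<otimes> (inv z0 \<otimes> y) = y" using z0 True by (simp add: m_assoc[symmetric])
          finally show ?thesis by simp
        qed
        then have "\<bar>b (inv z \<otimes> y) - b (inv z0 \<otimes> y)\<bar> \<le> d"
          using V(3)[of "inv z0 \<otimes> y" "inv z \<otimes> z0"] z z0 True by simp
        then have "\<bar>a y\<bar> * \<bar>b (inv z \<otimes> y) - b (inv z0 \<otimes> y)\<bar> \<le> \<bar>a y\<bar> * d"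
          by (intro mult_left_mono) auto
        then show ?thesis
          using True by (simp add: translate_def mult.commute flip: abs_mult right_diff_distrib left_diff_distrib)
      next
        case False
        then show ?thesis using Cc_outside[OF a False] by simp
      qed
      have c1: "(\<lambda>y. a y * translate z b y) \<in> Cc" "(\<lambda>y. a y * translate z0 b y) \<in> Cc"
        using z z0 by (auto intro!: Cc_times a b Cc_translate)
      have "\<bar>conv a b z - conv a b z0\<bar> = \<bar>I (\<lambda>y. a y * translate z b y - a y * translate z0 b y)\<bar>"
        using z z0 by (simp add: conv_def I_diff[OF c1])
      also have "\<dots> \<le> I (\<lambda>y. \<bar>a y * translate z b y - a y * translate z0 b y\<bar>)"
        by (rule I_abs[OF Cc_diff[OF c1]])
      also have "\<dots> \<le> I (\<lambda>y. d * \<bar>a y\<bar>)"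
        by (rule I_mono[OF Cc_abs[OF Cc_diff[OF c1]] Cc_cmult[OF Cc_abs[OF a]] le])
      also have "\<dots> = d * N" unfolding N_def by (rule I_cmult[OF Cc_abs[OF a]])
      also have "\<dots> < e" using e N by (simp add: d_def field_simps)
      finally have "conv a b z \<in> ball (conv a b z0) e" by (simp add: dist_real_def abs_minus_commute)
      then show "z \<in> {z \<in> topspace T. conv a b z \<in> U}" using e z by auto
    qed
    ultimately show "\<exists>W. openin T W \<and> z0 \<in> W \<and> W \<subseteq> {z \<in> topspace T. conv a b z \<in> U}"
      using W by blast
  qed
qed simp

lemma conv_bounded:
  assumes a: "a \<in> Cc" and b: "b \<in> Cc"
  obtains M where "M \<ge> 0" "\<And>z. \<bar>conv a b z\<bar> \<le> M"
proof -
  obtain C where C: "C > 0" "\<And>x. \<bar>b x\<bar> \<le> C" using Cc_bounded[OF b] by blast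
  define N where "N = I (\<lambda>x. \<bar>a x\<bar>)"
  have N: "N \<ge> 0" unfolding N_def by (rule I_nonneg[OF Cc_abs[OF a]]) simp
  have "\<bar>conv a b z\<bar> \<le> C * N" for z
  proof (cases "z \<in> carrier K")
    case True
    have c: "(\<lambda>y. a y * translate z b y) \<in> Cc" using True by (auto intro!: Cc_times a b Cc_translate)
    have "\<bar>conv a b z\<bar> \<le> I (\<lambda>y. \<bar>a y * translate z b y\<bar>)"
      using I_abs[OF c] True by (simp add: conv_def)
    also have "\<dots> \<le> I (\<lambda>y. C * \<bar>a y\<bar>)"
    proof (rule I_mono[OF Cc_abs[OF c] Cc_cmult[OF Cc_abs[OF a]]])
      show "\<bar>a y * translate z b y\<bar> \<le> C * \<bar>a y\<bar>" for y
        using mult_right_mono[OF C(2)[of "inv z \<otimes> y"], of "\<bar>a y\<bar>"] C(1)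
        by (simp add: translate_def abs_mult mult.commute)
    qed
    also have "\<dots> = C * N" unfolding N_def by (rule I_cmult[OF Cc_abs[OF a]])
    finally show ?thesis .
  qed (use C N in \<open>simp add: conv_def\<close>)
  then show thesis using C N by (intro that[of "C * N"]) auto
qed

text \<open>Translation of the multiplier is absorbed by \<open>a\<close> while \<open>b\<close>
  stays fixed; hence the estimates along an orbit share one constant, the square norm of
  \<open>b\<close>.\<close>

lemma translate_conv:
  assumes a: "a \<in> Cc" and b: "b \<in> Cc" and g: "g \<in> carrier K"
  shows "translate g (conv a b) = conv (translate g a) b"
proof
  fix z
  show "translate g (conv a b) z = conv (translate g a) b z"
  proof (cases "z \<in> carrier K")
    case True
    have b': "translate (inv g \<otimes> z) b \<in> Cc" using True g b by (simp add: Cc_translate)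
    have eq: "translate g (translate (inv g \<otimes> z) b) = translate z b"
      using g True by (simp add: translate_translate m_assoc[symmetric])
    have "conv a b (inv g \<otimes> z) = I (\<lambda>y. a y * translate (inv g \<otimes> z) b y)"
      using True g by (simp add: conv_def)
    also have "\<dots> = I (translate g (\<lambda>y. a y * translate (inv g \<otimes> z) b y))"
      using Cc_times[OF b' a] g by (simp add: I_translate)
    also have "\<dots> = I (\<lambda>y. translate g a y * translate z b y)"
      unfolding translate_times eq ..
    finally show ?thesis using True by (simp add: translate_def[of g "conv a b"] conv_def)
  qed (simp add: translate_def conv_def)
qed

lemma norm_sum_sq: "(norm (\<Sum>i\<in>F. c i *\<^sub>R e i))\<^sup>2 = (\<Sum>i\<in>F. \<Sum>j\<in>F. c i * c j * (e i \<bullet> e j))"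
  by (simp add: power2_norm_eq_inner inner_sum_sum)

text \<open>Cauchy--Schwarz for the vector-valued function \<open>\<Sum>i. A i *\<^sub>R e i\<close> against \<open>translate z b\<close>.\<close>

lemma conv_Cauchy_Schwarz:
  fixes e :: "'i \<Rightarrow> 'h::real_inner"
  assumes F: "finite F" and A: "\<And>i. i \<in> F \<Longrightarrow> A i \<in> Cc" and b: "b \<in> Cc" and z: "z \<in> carrier K"
    and \<beta>: "I (\<lambda>y. b y * b y) > 0"
  shows "(norm (\<Sum>i\<in>F. (d i * conv (A i) b z) *\<^sub>R e i))\<^sup>2
    \<le> I (\<lambda>y. b y * b y) * (\<Sum>i\<in>F. \<Sum>j\<in>F. d i * d j * (e i \<bullet> e j) * I (\<lambda>y. A i y * A j y))"
proof -
  define \<beta> where "\<beta> = I (\<lambda>y. b y * b y)"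
  define B where "B = translate z b"
  define \<phi> where "\<phi> i = conv (A i) b z" for i
  have B: "B \<in> Cc" unfolding B_def using b z by (simp add: Cc_translate)
  have \<phi>: "\<phi> i = I (\<lambda>y. A i y * B y)" for i using z by (simp add: \<phi>_def conv_def B_def)
  have BB: "I (\<lambda>y. B y * B y) = \<beta>"
    using I_translate[OF Cc_times[OF b b] z] by (simp add: \<beta>_def B_def translate_times)
  \<comment> \<open>\<open>\<beta>\<close> times the component of \<open>A i\<close> orthogonal to
    \<open>B\<close>. Nonnegativity of the resulting form is the claim multiplied by
    \<open>\<beta>\<close>.\<close>
  define D where "D i y = \<beta> * A i y - \<phi> i * B y" for i y
  have D: "D i \<in> Cc" if "i \<in> F" for i unfolding D_def using that by (intro Cc_diff Cc_cmult A B)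
  have I_DD: "I (\<lambda>y. D i y * D j y) = \<beta>\<^sup>2 * I (\<lambda>y. A i y * A j y) - \<beta> * (\<phi> i * \<phi> j)" if ij: "i \<in> F" "j \<in> F" for i j
  proof -
    have c: "(\<lambda>y. \<beta>\<^sup>2 * (A i y * A j y)) \<in> Cc" "(\<lambda>y. (\<beta> * \<phi> j) * (A i y * B y)) \<in> Cc"
      "(\<lambda>y. (\<beta> * \<phi> i) * (A j y * B y)) \<in> Cc" "(\<lambda>y. (\<phi> i * \<phi> j) * (B y * B y)) \<in> Cc"
      using ij by (auto intro!: Cc_cmult Cc_times A B)
    have "(\<lambda>y. D i y * D j y) = (\<lambda>y. (\<beta>\<^sup>2 * (A i y * A j y) - (\<beta> * \<phi> j) * (A i y * B y))
        - ((\<beta> * \<phi> i) * (A j y * B y) - (\<phi> i * \<phi> j) * (B y * B y)))"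
      by (auto simp: D_def algebra_simps power2_eq_square)
    then have "I (\<lambda>y. D i y * D j y) = (I (\<lambda>y. \<beta>\<^sup>2 * (A i y * A j y)) - I (\<lambda>y. (\<beta> * \<phi> j) * (A i y * B y)))
        - (I (\<lambda>y. (\<beta> * \<phi> i) * (A j y * B y)) - I (\<lambda>y. (\<phi> i * \<phi> j) * (B y * B y)))"
      by (simp only: I_diff[OF Cc_diff[OF c(1,2)] Cc_diff[OF c(3,4)]] I_diff[OF c(1,2)] I_diff[OF c(3,4)])
    also have "\<dots> = (\<beta>\<^sup>2 * I (\<lambda>y. A i y * A j y) - (\<beta> * \<phi> j) * \<phi> i) - ((\<beta> * \<phi> i) * \<phi> j - (\<phi> i * \<phi> j) * \<beta>)"
      by (simp only: I_cmult[OF Cc_times[OF A[OF ij(2)] A[OF ij(1)]]] I_cmult[OF Cc_times[OF B A[OF ij(1)]]]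
          I_cmult[OF Cc_times[OF B A[OF ij(2)]]] I_cmult[OF Cc_times[OF B B]] \<phi>[symmetric] BB)
    also have "\<dots> = \<beta>\<^sup>2 * I (\<lambda>y. A i y * A j y) - \<beta> * (\<phi> i * \<phi> j)"
      by (simp add: algebra_simps)
    finally show ?thesis .
  qed
  have t: "(\<lambda>y. (d i * d j * (e i \<bullet> e j)) * (D i y * D j y)) \<in> Cc" if "i \<in> F" "j \<in> F" for i j
    using that by (intro Cc_cmult Cc_times D)
  have "0 \<le> I (\<lambda>y. \<Sum>i\<in>F. \<Sum>j\<in>F. (d i * d j * (e i \<bullet> e j)) * (D i y * D j y))"
  proof (rule I_nonneg)
    show "(\<lambda>y. \<Sum>i\<in>F. \<Sum>j\<in>F. (d i * d j * (e i \<bullet> e j)) * (D i y * D j y)) \<in> Cc"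
      using t by (intro Cc_sum)
    fix y
    have "(\<Sum>i\<in>F. \<Sum>j\<in>F. (d i * d j * (e i \<bullet> e j)) * (D i y * D j y)) = (norm (\<Sum>i\<in>F. (d i * D i y) *\<^sub>R e i))\<^sup>2"
      unfolding norm_sum_sq by (intro sum.cong refl) (simp add: algebra_simps)
    then show "0 \<le> (\<Sum>i\<in>F. \<Sum>j\<in>F. (d i * d j * (e i \<bullet> e j)) * (D i y * D j y))" by simp
  qed
  also have "\<dots> = (\<Sum>i\<in>F. \<Sum>j\<in>F. (d i * d j * (e i \<bullet> e j)) * I (\<lambda>y. D i y * D j y))"
    using t D by (simp add: I_sum Cc_sum I_cmult Cc_times)
  also have "\<dots> = (\<Sum>i\<in>F. \<Sum>j\<in>F. \<beta> * (\<beta> * (d i * d j * (e i \<bullet> e j) * I (\<lambda>y. A i y * A j y))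
      - (d i * \<phi> i) * (d j * \<phi> j) * (e i \<bullet> e j)))"
    by (intro sum.cong refl) (simp add: I_DD algebra_simps power2_eq_square)
  also have "\<dots> = \<beta> * (\<beta> * (\<Sum>i\<in>F. \<Sum>j\<in>F. d i * d j * (e i \<bullet> e j) * I (\<lambda>y. A i y * A j y))
      - (norm (\<Sum>i\<in>F. (d i * \<phi> i) *\<^sub>R e i))\<^sup>2)"
    unfolding norm_sum_sq by (simp add: sum_distrib_left[symmetric] sum_subtractf)
  finally show ?thesis
    using \<beta> by (simp add: \<beta>_def[symmetric] \<phi>_def zero_le_mult_iff)
qed

end

text \<open>
  The adjoint of \<open>v y \<mapsto> v (t y)\<close> on the closed span of the family \<open>v\<close>; if \<open>t'\<close> is adjoint to \<open>t\<close> on the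
  index set, it is the linear extension of \<open>v y \<mapsto> v (t' y)\<close>, and it vanishes on the complement.
\<close>

definition kop :: "('x \<Rightarrow> 'h::{real_inner,banach}) \<Rightarrow> 'x set \<Rightarrow> ('x \<Rightarrow> 'x) \<Rightarrow> 'h \<Rightarrow> 'h" where
  "kop v X t w = (SOME z. z \<in> closure (span (v ` X)) \<and> (\<forall>y\<in>X. z \<bullet> v y = w \<bullet> v (t y)))"

text \<open>Operators are described by maps of labels. The inequality guarantees that relations
  among the \<open>v y\<close> carry over to the \<open>v (t y)\<close>, and \<open>dual\<close>
  identifies on the generators the operator that \<open>riesz_family\<close> delivers.\<close>

locale kop_pair =
  fixes v :: "'x \<Rightarrow> 'h::{real_inner,banach}" and X :: "'x set" and t t' :: "'x \<Rightarrow> 'x" and M :: real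
  assumes bound: "finite F \<Longrightarrow> F \<subseteq> X \<Longrightarrow> norm (\<Sum>y\<in>F. c y *\<^sub>R v (t y)) \<le> M * norm (\<Sum>y\<in>F. c y *\<^sub>R v y)"
    and M: "0 \<le> M"
    and closed: "x \<in> X \<Longrightarrow> t' x \<in> X"
    and dual: "x \<in> X \<Longrightarrow> y \<in> X \<Longrightarrow> v (t x) \<bullet> v y = v x \<bullet> v (t' y)"
begin

abbreviation "\<H> \<equiv> closure (span (v ` X))"

lemma \<H>: "subspace \<H>" "closed \<H>" by (simp_all add: subspace_closure)

lemma in_\<H>: "x \<in> X \<Longrightarrow> v x \<in> \<H>" by (intro in_closure_span) simp

lemma eq_\<H>I:
  assumes "z \<in> \<H>" "z' \<in> \<H>" "\<And>y. y \<in> X \<Longrightarrow> z \<bullet> v y = z' \<bullet> v y"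
  shows "z = z'"
proof -
  have "z - z' \<in> \<H>" using \<H>(1) assms(1,2) by (rule subspace_diff)
  then have "(z - z') \<bullet> (z - z') = 0"
    by (rule orthogonal_closure_span[rotated]) (auto simp: inner_diff_left assms(3))
  then show ?thesis by simp
qed

lemma ex_kop: "\<exists>z. z \<in> \<H> \<and> (\<forall>y\<in>X. z \<bullet> v y = w \<bullet> v (t y)) \<and> norm z \<le> norm w * M"
proof -
  have "\<bar>\<Sum>y\<in>F. c y * (w \<bullet> v (t y))\<bar> \<le> (norm w * M) * norm (\<Sum>y\<in>F. c y *\<^sub>R v y)"
    if F: "finite F" "F \<subseteq> X" for F c
  proof -
    have "\<bar>\<Sum>y\<in>F. c y * (w \<bullet> v (t y))\<bar> = \<bar>w \<bullet> (\<Sum>y\<in>F. c y *\<^sub>R v (t y))\<bar>"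
      by (simp add: inner_sum_right)
    also have "\<dots> \<le> norm w * norm (\<Sum>y\<in>F. c y *\<^sub>R v (t y))" by (rule Cauchy_Schwarz_ineq2)
    also have "\<dots> \<le> norm w * (M * norm (\<Sum>y\<in>F. c y *\<^sub>R v y))"
      by (intro mult_left_mono bound F) simp
    finally show ?thesis by (simp add: mult.assoc)
  qed
  from riesz_family[OF this] obtain z where
    z: "z \<in> \<H>" "\<And>y. y \<in> X \<Longrightarrow> z \<bullet> v y = w \<bullet> v (t y)" "norm z \<le> norm w * M \<or> z = 0" by blast
  from z(3) M have "norm z \<le> norm w * M" by auto
  with z(1,2) show ?thesis by blast
qed

lemma kop: "kop v X t w \<in> \<H> \<and> (\<forall>y\<in>X. kop v X t w \<bullet> v y = w \<bullet> v (t y))"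
  unfolding kop_def by (rule someI_ex) (use ex_kop in blast)

lemma kop_in: "kop v X t w \<in> \<H>" using kop by blast

lemma inner_kop: "y \<in> X \<Longrightarrow> kop v X t w \<bullet> v y = w \<bullet> v (t y)" using kop by blast

lemma kop_eqI: "z \<in> \<H> \<Longrightarrow> (\<And>y. y \<in> X \<Longrightarrow> z \<bullet> v y = w \<bullet> v (t y)) \<Longrightarrow> kop v X t w = z"
  by (rule eq_\<H>I[OF kop_in]) (simp_all add: inner_kop)

lemma norm_kop: "norm (kop v X t w) \<le> norm w * M"
  using ex_kop[of w] kop_eqI[of _ w] by blast

lemma bounded_linear_kop: "bounded_linear (kop v X t)"
proof (rule bounded_linear_intro[where K = M])
  show "kop v X t (x + y) = kop v X t x + kop v X t y" for x y
    using \<H>(1) by (intro kop_eqI) (auto simp: subspace_add kop_in inner_kop inner_add_left)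
  show "kop v X t (r *\<^sub>R x) = r *\<^sub>R kop v X t x" for r x
    using \<H>(1) by (intro kop_eqI) (auto simp: subspace_scale kop_in inner_kop)
qed (rule norm_kop)

lemma kop_v: "y \<in> X \<Longrightarrow> kop v X t (v y) = v (t' y)"
proof (rule kop_eqI)
  fix x assume "y \<in> X" "x \<in> X"
  then show "v (t' y) \<bullet> v x = v y \<bullet> v (t x)"
    using dual[of x y] by (simp only: inner_commute[of "v (t' y)"] inner_commute[of "v y"])
qed (simp add: in_\<H> closed)


end

text \<open>Adjointness is read off on generators. Both operators have values in the closed span and
  vanish on its complement, so \<open>u\<close> may be replaced by its projection, and density does
  the rest.\<close>

lemma kop_selfdual:
  assumes "kop_pair v X t t' M" "kop_pair v X t' t M'" and tX: "\<And>x. x \<in> X \<Longrightarrow> t x \<in> X"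
  shows "kop v X t' w \<bullet> u = w \<bullet> kop v X t u"
proof -
  interpret a: kop_pair v X t t' M by fact
  interpret b: kop_pair v X t' t M' by fact
  define p where "p = proj a.\<H> u"
  have pH: "p \<in> a.\<H>" unfolding p_def by (rule proj_in[OF a.\<H>])
  have 1: "kop v X t' w \<bullet> u = kop v X t' w \<bullet> p"
    using proj_orth[OF a.\<H> b.kop_in, of u w]
    by (simp add: p_def inner_diff_left inner_commute[of "kop v X t' w"])
  have "kop v X t u = kop v X t p"
  proof (rule a.kop_eqI[OF a.kop_in])
    fix y assume "y \<in> X"
    then show "kop v X t p \<bullet> v y = u \<bullet> v (t y)"
      using inner_proj[OF a.\<H> a.in_\<H>[OF tX], of y u] by (simp add: a.inner_kop p_def)
  qed
  moreover have "kop v X t' w \<bullet> p = w \<bullet> kop v X t p"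
  proof -
    have "linear (\<lambda>p. kop v X t' w \<bullet> p - w \<bullet> kop v X t p)"
      by (intro linearI) (simp_all add: inner_simps algebra_simps
          linear_add[OF bounded_linear.linear[OF a.bounded_linear_kop]]
          linear_scale[OF bounded_linear.linear[OF a.bounded_linear_kop]])
    then have sub: "subspace {p. kop v X t' w \<bullet> p - w \<bullet> kop v X t p = 0}"
      by (rule linear_subspace_kernel)
    have "v ` X \<subseteq> {p. kop v X t' w \<bullet> p - w \<bullet> kop v X t p = 0}"
      by (auto simp: b.inner_kop a.kop_v)
    then have "span (v ` X) \<subseteq> {p. kop v X t' w \<bullet> p - w \<bullet> kop v X t p = 0}"
      using sub by (rule span_minimal)
    moreover have "closed {p. kop v X t' w \<bullet> p - w \<bullet> kop v X t p = 0}"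
      by (intro closed_Collect_eq continuous_intros linear_continuous_on a.bounded_linear_kop)
    ultimately have "a.\<H> \<subseteq> {p. kop v X t' w \<bullet> p - w \<bullet> kop v X t p = 0}" by (rule closure_minimal)
    with pH show ?thesis by auto
  qed
  ultimately show ?thesis using 1 by simp
qed

text \<open>\<open>e (g, s)\<close> stands for the image under \<open>g\<close> of a vector tagged
  \<open>s\<close>. The representation enters only through these vectors, with invariance of their
  Gram matrix in place of unitarity.\<close>

locale tensor_rep = G: group G + haar_group K T I
  for G :: "('g, 'm) monoid_scheme" and K :: "('k, 'n) monoid_scheme" and T :: "'k topology" and I +
  fixes \<alpha> :: "'g \<Rightarrow> 'k" and e :: "'g \<times> 's \<Rightarrow> 'h::real_inner"
  assumes hom: "\<alpha> \<in> hom G K"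
    and e_invariant: "h \<in> carrier G \<Longrightarrow> g \<in> carrier G \<Longrightarrow> g' \<in> carrier G \<Longrightarrow>
      e (h \<otimes>\<^bsub>G\<^esub> g, s) \<bullet> e (h \<otimes>\<^bsub>G\<^esub> g', s') = e (g, s) \<bullet> e (g', s')"
begin

text \<open>Labels of the elementary tensors of \<open>e (g, s)\<close> with a function on
  \<open>K\<close>; \<open>kernel\<close> is the inner product of the tensor product on
  them.\<close>

definition X :: "('g \<times> 's \<times> ('k \<Rightarrow> real)) set" where "X = carrier G \<times> UNIV \<times> Cc"

definition E :: "'g \<times> 's \<times> ('k \<Rightarrow> real) \<Rightarrow> 'h" where "E x = e (fst x, fst (snd x))"

definition A :: "'g \<times> 's \<times> ('k \<Rightarrow> real) \<Rightarrow> 'k \<Rightarrow> real" where "A x = snd (snd x)"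

definition kernel :: "'g \<times> 's \<times> ('k \<Rightarrow> real) \<Rightarrow> 'g \<times> 's \<times> ('k \<Rightarrow> real) \<Rightarrow> real" where
  "kernel x y = (if x \<in> X \<and> y \<in> X then (E x \<bullet> E y) * I (\<lambda>z. A x z * A y z) else 0)"

lemma A_Cc: "x \<in> X \<Longrightarrow> A x \<in> Cc" by (auto simp: X_def A_def)

lemma AA_Cc: "x \<in> X \<Longrightarrow> y \<in> X \<Longrightarrow> (\<lambda>z. A x z * A y z) \<in> Cc" by (intro Cc_times A_Cc)

text \<open>A finite combination of elementary tensors is a vector-valued function on
  \<open>K\<close>, and its square norm is the integral of the pointwise one. Positivity of
  \<open>kernel\<close> and the bounds for multiplication operators thereby reduce to pointwise
  inequalities.\<close>

lemma family_integrand: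
  fixes x :: "'i \<Rightarrow> 'g \<times> 's \<times> ('k \<Rightarrow> real)"
  assumes x: "\<And>i. i \<in> J \<Longrightarrow> x i \<in> X"
  shows "(\<lambda>z. (norm (\<Sum>i\<in>J. (c i * A (x i) z) *\<^sub>R E (x i)))\<^sup>2) \<in> Cc"
    and "I (\<lambda>z. (norm (\<Sum>i\<in>J. (c i * A (x i) z) *\<^sub>R E (x i)))\<^sup>2)
      = (\<Sum>i\<in>J. \<Sum>j\<in>J. c i * c j * (E (x i) \<bullet> E (x j) * I (\<lambda>z. A (x i) z * A (x j) z)))"
proof -
  have eq: "(norm (\<Sum>i\<in>J. (c i * A (x i) z) *\<^sub>R E (x i)))\<^sup>2
      = (\<Sum>i\<in>J. \<Sum>j\<in>J. (c i * c j * (E (x i) \<bullet> E (x j))) * (A (x i) z * A (x j) z))" for z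
    unfolding norm_sum_sq by (intro sum.cong refl) (simp add: algebra_simps)
  have t: "(\<lambda>z. (c i * c j * (E (x i) \<bullet> E (x j))) * (A (x i) z * A (x j) z)) \<in> Cc" if "i \<in> J" "j \<in> J" for i j
    using that x by (intro Cc_cmult AA_Cc)
  show "(\<lambda>z. (norm (\<Sum>i\<in>J. (c i * A (x i) z) *\<^sub>R E (x i)))\<^sup>2) \<in> Cc"
    unfolding eq using t by (intro Cc_sum)
  have "I (\<lambda>z. (norm (\<Sum>i\<in>J. (c i * A (x i) z) *\<^sub>R E (x i)))\<^sup>2)
      = (\<Sum>i\<in>J. \<Sum>j\<in>J. I (\<lambda>z. (c i * c j * (E (x i) \<bullet> E (x j))) * (A (x i) z * A (x j) z)))"
    unfolding eq using t by (simp add: I_sum Cc_sum)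
  also have "\<dots> = (\<Sum>i\<in>J. \<Sum>j\<in>J. c i * c j * (E (x i) \<bullet> E (x j) * I (\<lambda>z. A (x i) z * A (x j) z)))"
    using x by (intro sum.cong refl) (simp add: I_cmult[OF AA_Cc])
  finally show "I (\<lambda>z. (norm (\<Sum>i\<in>J. (c i * A (x i) z) *\<^sub>R E (x i)))\<^sup>2)
      = (\<Sum>i\<in>J. \<Sum>j\<in>J. c i * c j * (E (x i) \<bullet> E (x j) * I (\<lambda>z. A (x i) z * A (x j) z)))" .
qed

lemma psd_kernel: "psd_kernel kernel"
  unfolding psd_kernel_def
proof (intro conjI allI impI)
  show "kernel x y = kernel y x" for x y by (simp add: kernel_def inner_commute mult.commute)
  fix F :: "('g \<times> 's \<times> ('k \<Rightarrow> real)) set" and c :: "'g \<times> 's \<times> ('k \<Rightarrow> real) \<Rightarrow> real"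
  assume F: "finite F"
  have "(\<Sum>x\<in>F. \<Sum>y\<in>F. c x * c y * kernel x y) = (\<Sum>x\<in>F \<inter> X. \<Sum>y\<in>F \<inter> X. c x * c y * kernel x y)"
    using F by (intro sum.mono_neutral_cong_right) (auto simp: kernel_def intro!: sum.mono_neutral_right)
  also have "\<dots> = I (\<lambda>z. (norm (\<Sum>i\<in>F \<inter> X. (c i * A i z) *\<^sub>R E i))\<^sup>2)"
    by (subst family_integrand(2)) (auto intro!: sum.cong simp: kernel_def)
  also have "\<dots> \<ge> 0" by (rule I_nonneg[OF family_integrand(1)]) auto
  finally show "0 \<le> (\<Sum>x\<in>F. \<Sum>y\<in>F. c x * c y * kernel x y)" .
qed

definition v :: "'g \<times> 's \<times> ('k \<Rightarrow> real) \<Rightarrow> ('g \<times> 's \<times> ('k \<Rightarrow> real)) ell2" where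
  "v = (SOME v. \<forall>x y. v x \<bullet> v y = kernel x y)"

lemma v_kernel: "v x \<bullet> v y = kernel x y"
proof -
  have "\<exists>v :: _ \<Rightarrow> ('g \<times> 's \<times> ('k \<Rightarrow> real)) ell2. \<forall>x y. v x \<bullet> v y = kernel x y"
    using psd_kernel_realization[OF psd_kernel] by metis
  from someI_ex[OF this] show ?thesis unfolding v_def by blast
qed

lemma inner_v: "x \<in> X \<Longrightarrow> y \<in> X \<Longrightarrow> v x \<bullet> v y = (E x \<bullet> E y) * I (\<lambda>z. A x z * A y z)"
  by (simp add: v_kernel kernel_def)

lemma norm_family:
  assumes "\<And>i. i \<in> J \<Longrightarrow> x i \<in> X"
  shows "(norm (\<Sum>i\<in>J. c i *\<^sub>R v (x i)))\<^sup>2 = I (\<lambda>z. (norm (\<Sum>i\<in>J. (c i * A (x i) z) *\<^sub>R E (x i)))\<^sup>2)"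
proof -
  have "(norm (\<Sum>i\<in>J. c i *\<^sub>R v (x i)))\<^sup>2
      = (\<Sum>i\<in>J. \<Sum>j\<in>J. c i * c j * (E (x i) \<bullet> E (x j) * I (\<lambda>z. A (x i) z * A (x j) z)))"
    unfolding norm_sum_sq using assms by (intro sum.cong refl) (simp add: inner_v)
  then show ?thesis by (simp only: family_integrand(2)[OF assms])
qed

definition act :: "'g \<Rightarrow> 'g \<times> 's \<times> ('k \<Rightarrow> real) \<Rightarrow> 'g \<times> 's \<times> ('k \<Rightarrow> real)" where
  "act h x = (h \<otimes>\<^bsub>G\<^esub> fst x, fst (snd x), translate (\<alpha> h) (A x))"

definition mul :: "('k \<Rightarrow> real) \<Rightarrow> 'g \<times> 's \<times> ('k \<Rightarrow> real) \<Rightarrow> 'g \<times> 's \<times> ('k \<Rightarrow> real)" where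
  "mul f x = (fst x, fst (snd x), \<lambda>z. f z * A x z)"

lemma \<alpha>_closed: "g \<in> carrier G \<Longrightarrow> \<alpha> g \<in> carrier K"
  using hom by (auto simp: hom_def)

lemma \<alpha>_mult: "g \<in> carrier G \<Longrightarrow> h \<in> carrier G \<Longrightarrow> \<alpha> (g \<otimes>\<^bsub>G\<^esub> h) = \<alpha> g \<otimes>\<^bsub>K\<^esub> \<alpha> h"
  using hom by (auto simp: hom_def)

lemma group_hom_\<alpha>: "group_hom G K \<alpha>"
  by (intro group_hom.intro group_hom_axioms.intro G.is_group is_group hom)

lemma \<alpha>_one: "\<alpha> \<one>\<^bsub>G\<^esub> = \<one>\<^bsub>K\<^esub>"
  by (rule group_hom.hom_one[OF group_hom_\<alpha>])

lemma act_X: "h \<in> carrier G \<Longrightarrow> x \<in> X \<Longrightarrow> act h x \<in> X"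
  by (auto simp: X_def act_def A_def \<alpha>_closed Cc_translate)

lemma act_act: "g \<in> carrier G \<Longrightarrow> h \<in> carrier G \<Longrightarrow> x \<in> X \<Longrightarrow> act g (act h x) = act (g \<otimes>\<^bsub>G\<^esub> h) x"
  by (auto simp: X_def act_def A_def G.m_assoc translate_translate \<alpha>_closed \<alpha>_mult)

lemma act_one: "x \<in> X \<Longrightarrow> act \<one>\<^bsub>G\<^esub> x = x"
  by (auto simp: X_def act_def A_def \<alpha>_one translate_one)

lemma act_inner:
  assumes h: "h \<in> carrier G" and x: "x \<in> X" and y: "y \<in> X"
  shows "v (act h x) \<bullet> v (act h y) = v x \<bullet> v y"
proof -
  have "E (act h x) \<bullet> E (act h y) = E x \<bullet> E y"
    using h x y by (auto simp: E_def act_def X_def e_invariant)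
  moreover have "I (\<lambda>z. A (act h x) z * A (act h y) z) = I (\<lambda>z. A x z * A y z)"
    using I_translate[OF AA_Cc[OF x y] \<alpha>_closed[OF h]] by (simp add: act_def A_def[of "(_, _)"] translate_times)
  ultimately show ?thesis using h x y by (simp add: inner_v act_X)
qed

lemma act_dual:
  assumes h: "h \<in> carrier G" and x: "x \<in> X" and y: "y \<in> X"
  shows "v (act h x) \<bullet> v y = v x \<bullet> v (act (inv\<^bsub>G\<^esub> h) y)"
proof -
  have "y = act h (act (inv\<^bsub>G\<^esub> h) y)" using h y by (simp add: act_act act_one)
  then show ?thesis using act_inner[OF h x act_X[of "inv\<^bsub>G\<^esub> h" y]] h y by simp
qed

text \<open>\<open>kop\<close> yields the adjoint of its label map, whence the inverse.\<close>

definition U :: "'g \<Rightarrow> ('g \<times> 's \<times> ('k \<Rightarrow> real)) ell2 \<Rightarrow> ('g \<times> 's \<times> ('k \<Rightarrow> real)) ell2" where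
  "U h = kop v X (act (inv\<^bsub>G\<^esub> h))"

lemma kop_act:
  assumes h: "h \<in> carrier G"
  shows "kop_pair v X (act (inv\<^bsub>G\<^esub> h)) (act h) 1"
proof
  fix F c assume F: "finite F" "F \<subseteq> X"
  have "(norm (\<Sum>y\<in>F. c y *\<^sub>R v (act (inv\<^bsub>G\<^esub> h) y)))\<^sup>2 = (norm (\<Sum>y\<in>F. c y *\<^sub>R v y))\<^sup>2"
    unfolding norm_sum_sq using F h by (intro sum.cong refl) (auto simp: act_inner subset_iff)
  then show "norm (\<Sum>y\<in>F. c y *\<^sub>R v (act (inv\<^bsub>G\<^esub> h) y)) \<le> 1 * norm (\<Sum>y\<in>F. c y *\<^sub>R v y)"
    by simp
qed (use h act_dual[of "inv\<^bsub>G\<^esub> h"] in \<open>auto simp: act_X\<close>)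

lemma kop_act_inv: "h \<in> carrier G \<Longrightarrow> kop_pair v X (act h) (act (inv\<^bsub>G\<^esub> h)) 1"
  using kop_act[of "inv\<^bsub>G\<^esub> h"] by simp

lemma U_v: "h \<in> carrier G \<Longrightarrow> x \<in> X \<Longrightarrow> U h (v x) = v (act h x)"
  unfolding U_def by (rule kop_pair.kop_v[OF kop_act])

lemma star_rep_U: "star_rep G U"
proof (intro star_rep.intro star_rep_axioms.intro G.is_group)
  fix g assume g: "g \<in> carrier G"
  show "bounded_linear (U g)" unfolding U_def by (rule kop_pair.bounded_linear_kop[OF kop_act[OF g]])
  show "U g x \<bullet> y = x \<bullet> U (inv\<^bsub>G\<^esub> g) y" for x y
    unfolding U_def using g kop_selfdual[OF kop_act_inv[OF g] kop_act[OF g], of x y] by (simp add: act_X)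
  fix h x assume h: "h \<in> carrier G"
  have gh: "g \<otimes>\<^bsub>G\<^esub> h \<in> carrier G" using g h by simp
  have "U (g \<otimes>\<^bsub>G\<^esub> h) x = U g (U h x)"
    unfolding U_def[of "g \<otimes>\<^bsub>G\<^esub> h"]
  proof (rule kop_pair.kop_eqI[OF kop_act[OF gh]])
    show "U g (U h x) \<in> closure (span (v ` X))" unfolding U_def[of g] by (rule kop_pair.kop_in[OF kop_act[OF g]])
    fix y assume y: "y \<in> X"
    then show "U g (U h x) \<bullet> v y = x \<bullet> v (act (inv\<^bsub>G\<^esub> (g \<otimes>\<^bsub>G\<^esub> h)) y)"
      unfolding U_def using g h
      by (simp add: kop_pair.inner_kop[OF kop_act[OF g]] kop_pair.inner_kop[OF kop_act[OF h]]
          act_X act_act G.inv_mult_group)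
  qed
  then show "U g (U h x) = U (g \<otimes>\<^bsub>G\<^esub> h) x" by simp
qed

end

sublocale tensor_rep \<subseteq> R: star_rep G U by (rule star_rep_U)

lemma sum_sum_cartesian:
  "(\<Sum>p\<in>F \<times> F'. \<Sum>q\<in>F \<times> F'. h (fst p) (snd p) (fst q) (snd q))
    = (\<Sum>g\<in>F. \<Sum>g'\<in>F. \<Sum>k\<in>F'. \<Sum>k'\<in>F'. h g k g' (k' :: 'b))"
proof -
  have "(\<Sum>p\<in>F \<times> F'. \<Sum>q\<in>F \<times> F'. h (fst p) (snd p) (fst q) (snd q))
      = (\<Sum>g\<in>F. \<Sum>k\<in>F'. \<Sum>g'\<in>F. \<Sum>k'\<in>F'. h g k g' k')"
    by (simp add: sum.cartesian_product')
  also have "\<dots> = (\<Sum>g\<in>F. \<Sum>g'\<in>F. \<Sum>k\<in>F'. \<Sum>k'\<in>F'. h g k g' k')"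
    by (intro sum.cong refl sum.swap)
  finally show ?thesis .
qed

section \<open>Multiplication by functions on \<open>K\<close> and Fell absorption\<close>

context tensor_rep
begin

lemma E_mul [simp]: "E (mul f x) = E x" and A_mul [simp]: "A (mul f x) z = f z * A x z"
  by (simp_all add: E_def A_def mul_def)

lemma mul_X: "continuous_map T euclideanreal f \<Longrightarrow> x \<in> X \<Longrightarrow> mul f x \<in> X"
  by (auto simp: X_def mul_def A_def intro: Cc_mult)

lemma kop_mul:
  assumes f: "continuous_map T euclideanreal f" and M: "0 \<le> M" "\<And>z. \<bar>f z\<bar> \<le> M"
  shows "kop_pair v X (mul f) (mul f) M"
proof
  fix F c assume F: "finite F" "F \<subseteq> X"
  define N where "N z = (norm (\<Sum>y\<in>F. (c y * A y z) *\<^sub>R E y))\<^sup>2" for z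
  have N: "N \<in> Cc" unfolding N_def using F by (intro family_integrand(1)) auto
  have eq: "(norm (\<Sum>y\<in>F. (c y * A (mul f y) z) *\<^sub>R E (mul f y)))\<^sup>2 = (f z)\<^sup>2 * N z" for z
  proof -
    have "(\<Sum>y\<in>F. (c y * A (mul f y) z) *\<^sub>R E (mul f y)) = f z *\<^sub>R (\<Sum>y\<in>F. (c y * A y z) *\<^sub>R E y)"
      by (simp add: scaleR_sum_right mult_ac)
    then show ?thesis by (simp add: N_def power_mult_distrib)
  qed
  have mX: "mul f y \<in> X" if "y \<in> F" for y by (rule mul_X[OF f subsetD[OF F(2) that]])
  have "(norm (\<Sum>y\<in>F. c y *\<^sub>R v (mul f y)))\<^sup>2
      = I (\<lambda>z. (norm (\<Sum>y\<in>F. (c y * A (mul f y) z) *\<^sub>R E (mul f y)))\<^sup>2)"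
    by (rule norm_family[OF mX])
  also have "\<dots> = I (\<lambda>z. (f z)\<^sup>2 * N z)" by (simp only: eq)
  also have "\<dots> \<le> I (\<lambda>z. M\<^sup>2 * N z)"
  proof (rule I_mono[OF _ Cc_cmult[OF N]])
    show "(\<lambda>z. (f z)\<^sup>2 * N z) \<in> Cc"
      unfolding eq[symmetric] using mX by (intro family_integrand(1)) auto
    show "(f z)\<^sup>2 * N z \<le> M\<^sup>2 * N z" for z
      using M(2)[of z] by (intro mult_right_mono) (auto simp: N_def abs_le_square_iff[symmetric] M(1))
  qed
  also have "\<dots> = M\<^sup>2 * I N" by (rule I_cmult[OF N])
  also have "I N = (norm (\<Sum>y\<in>F. c y *\<^sub>R v y))\<^sup>2"
    unfolding N_def using F by (subst norm_family) auto
  finally have "(norm (\<Sum>y\<in>F. c y *\<^sub>R v (mul f y)))\<^sup>2 \<le> (M * norm (\<Sum>y\<in>F. c y *\<^sub>R v y))\<^sup>2"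
    by (simp only: power_mult_distrib)
  then show "norm (\<Sum>y\<in>F. c y *\<^sub>R v (mul f y)) \<le> M * norm (\<Sum>y\<in>F. c y *\<^sub>R v y)"
    by (rule power2_le_imp_le) (simp add: M(1))
next
  show "v (mul f x) \<bullet> v y = v x \<bullet> v (mul f y)" if "x \<in> X" "y \<in> X" for x y
    using that by (simp add: inner_v mul_X[OF f] mult_ac)
qed (use M mul_X[OF f] in auto)

text \<open>Obtained by integrating \<open>conv_Cauchy_Schwarz\<close>. The double sum on the right
  is the square norm of a combination of the tensors of \<open>v (y i)\<close> with
  \<open>B i\<close>, so trading this extra factor for multiplication by \<open>conv (B i) b\<close>
  is a bounded operation.\<close>

lemma conv_family:
  assumes J: "finite J" and y: "\<And>i. i \<in> J \<Longrightarrow> y i \<in> X" and B: "\<And>i. i \<in> J \<Longrightarrow> B i \<in> Cc"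
    and b: "b \<in> Cc" "I (\<lambda>y. b y * b y) > 0"
  shows "(norm (\<Sum>i\<in>J. c i *\<^sub>R v (mul (conv (B i) b) (y i))))\<^sup>2
    \<le> I (\<lambda>y. b y * b y) * (\<Sum>i\<in>J. \<Sum>j\<in>J. c i * c j * (v (y i) \<bullet> v (y j)) * I (\<lambda>z. B i z * B j z))"
proof -
  define \<beta> where "\<beta> = I (\<lambda>y. b y * b y)"
  have mX: "mul (conv (B i) b) (y i) \<in> X" if "i \<in> J" for i
    using that by (intro mul_X continuous_map_conv B b y)
  define k where "k i j = \<beta> * (c i * c j * (E (y i) \<bullet> E (y j)) * I (\<lambda>z. B i z * B j z))" for i j
  have kCc: "(\<lambda>z. k i j * (A (y i) z * A (y j) z)) \<in> Cc" if "i \<in> J" "j \<in> J" for i j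
    using that by (intro Cc_cmult AA_Cc y)
  have "(norm (\<Sum>i\<in>J. c i *\<^sub>R v (mul (conv (B i) b) (y i))))\<^sup>2
      = I (\<lambda>z. (norm (\<Sum>i\<in>J. (c i * A (mul (conv (B i) b) (y i)) z) *\<^sub>R E (mul (conv (B i) b) (y i))))\<^sup>2)"
    by (rule norm_family[OF mX])
  also have "\<dots> \<le> I (\<lambda>z. \<Sum>i\<in>J. \<Sum>j\<in>J. k i j * (A (y i) z * A (y j) z))"
  proof (rule I_mono[OF family_integrand(1)[OF mX]])
    show "(\<lambda>z. \<Sum>i\<in>J. \<Sum>j\<in>J. k i j * (A (y i) z * A (y j) z)) \<in> Cc" using kCc by (intro Cc_sum)
    show "(norm (\<Sum>i\<in>J. (c i * A (mul (conv (B i) b) (y i)) z) *\<^sub>R E (mul (conv (B i) b) (y i))))\<^sup>2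
        \<le> (\<Sum>i\<in>J. \<Sum>j\<in>J. k i j * (A (y i) z * A (y j) z))" for z
    proof (cases "z \<in> carrier K")
      case True
      have "(norm (\<Sum>i\<in>J. ((c i * A (y i) z) * conv (B i) b z) *\<^sub>R E (y i)))\<^sup>2
          \<le> \<beta> * (\<Sum>i\<in>J. \<Sum>j\<in>J. (c i * A (y i) z) * (c j * A (y j) z) * (E (y i) \<bullet> E (y j)) * I (\<lambda>z. B i z * B j z))"
        unfolding \<beta>_def by (rule conv_Cauchy_Schwarz[OF J B b(1) True b(2)])
      also have "\<dots> = (\<Sum>i\<in>J. \<Sum>j\<in>J. k i j * (A (y i) z * A (y j) z))"
        unfolding sum_distrib_left by (intro sum.cong refl) (simp add: k_def mult_ac)
      finally show ?thesis by (simp add: mult_ac)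
    next
      case False
      have "A (y i) z = 0" if "i \<in> J" for i using Cc_outside[OF A_Cc[OF y[OF that]] False] .
      then show ?thesis by simp
    qed
  qed
  also have "\<dots> = (\<Sum>i\<in>J. \<Sum>j\<in>J. k i j * I (\<lambda>z. A (y i) z * A (y j) z))"
    using kCc by (simp add: I_sum Cc_sum I_cmult AA_Cc y)
  also have "\<dots> = \<beta> * (\<Sum>i\<in>J. \<Sum>j\<in>J. c i * c j * (v (y i) \<bullet> v (y j)) * I (\<lambda>z. B i z * B j z))"
    unfolding sum_distrib_left by (intro sum.cong refl) (simp add: k_def inner_v y mult_ac)
  finally show ?thesis by (simp add: \<beta>_def)
qed

lemma act_mul:
  assumes "g \<in> carrier G" "a \<in> Cc" "b \<in> Cc" "x \<in> X"
  shows "act g (mul (conv a b) x) = mul (conv (translate (\<alpha> g) a) b) (act g x)"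
proof -
  have "translate (\<alpha> g) (\<lambda>z. conv a b z * A x z) = (\<lambda>z. conv (translate (\<alpha> g) a) b z * translate (\<alpha> g) (A x) z)"
    using assms by (simp add: translate_times translate_conv \<alpha>_closed)
  then show ?thesis by (simp add: act_def mul_def A_def)
qed

context
  fixes a b assumes a: "a \<in> Cc" and b: "b \<in> Cc" "I (\<lambda>y. b y * b y) > 0"
begin

abbreviation Mop where "Mop \<equiv> kop v X (mul (conv a b))"

lemma kop_conv: "\<exists>M. kop_pair v X (mul (conv a b)) (mul (conv a b)) M"
  using conv_bounded[OF a b(1)] kop_mul[OF continuous_map_conv[OF a b(1)]] by metis

lemma Mop_linear: "bounded_linear Mop"
  using kop_conv by (auto intro: kop_pair.bounded_linear_kop)

lemma mul_conv_X: "x \<in> X \<Longrightarrow> mul (conv a b) x \<in> X"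
  by (rule mul_X[OF continuous_map_conv[OF a b(1)]])

lemma Mop_v: "x \<in> X \<Longrightarrow> Mop (v x) = v (mul (conv a b) x)"
  using kop_conv by (auto intro: kop_pair.kop_v)

lemma Mop_selfadjoint: "Mop w \<bullet> u = w \<bullet> Mop u"
  using kop_conv by (auto intro: kop_selfdual mul_conv_X)

text \<open>In other words, the tensor of \<open>w\<close> with \<open>a\<close> goes to
  \<open>Mop w\<close> under a bounded intertwiner of cyclic subspaces. The inequality is checked on
  the span and passes to the closure because both sides are continuous in \<open>w\<close>.\<close>

lemma Mop_orbit_bound:
  assumes F: "finite F" "F \<subseteq> carrier G" and w: "w \<in> closure (span (v ` X))"
  shows "(norm (\<Sum>g\<in>F. c g *\<^sub>R U g (Mop w)))\<^sup>2 \<le> I (\<lambda>y. b y * b y) *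
    (\<Sum>g\<in>F. \<Sum>h\<in>F. c g * c h * (U g w \<bullet> U h w) * I (\<lambda>z. translate (\<alpha> g) a z * translate (\<alpha> h) a z))"
    (is "?L w \<le> ?R w")
proof -
  have gG: "g \<in> carrier G" if "g \<in> F" for g using that F by auto
  have "span (v ` X) \<subseteq> {w. ?L w \<le> ?R w}"
  proof
    fix w assume "w \<in> span (v ` X)"
    then obtain F' d where F': "finite F'" "F' \<subseteq> X" and w: "w = (\<Sum>x\<in>F'. d x *\<^sub>R v x)"
      using span_image_sum by blast
    define y where "y p = act (fst p) (snd p)" for p
    define B where "B p = translate (\<alpha> (fst p)) a" for p :: "'g \<times> ('g \<times> 's \<times> ('k \<Rightarrow> real))"
    define cc where "cc p = c (fst p) * d (snd p)" for p
    have Uw: "U g w = (\<Sum>x\<in>F'. d x *\<^sub>R v (act g x))" if "g \<in> F" for g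
      unfolding w using F' gG[OF that]
      by (simp add: linear_sum[OF R.linear] linear_scale[OF R.linear]) (intro sum.cong refl, auto simp: U_v)
    have UMw: "U g (Mop w) = (\<Sum>x\<in>F'. d x *\<^sub>R v (mul (conv (translate (\<alpha> g) a) b) (act g x)))" if "g \<in> F" for g
    proof -
      have "U g (Mop w) = (\<Sum>x\<in>F'. d x *\<^sub>R U g (Mop (v x)))"
        unfolding w using gG[OF that]
        by (simp add: linear_sum[OF R.linear] linear_scale[OF R.linear]
            linear_sum[OF bounded_linear.linear[OF Mop_linear]] linear_scale[OF bounded_linear.linear[OF Mop_linear]])
      also have "\<dots> = (\<Sum>x\<in>F'. d x *\<^sub>R v (mul (conv (translate (\<alpha> g) a) b) (act g x)))"
        using F' gG[OF that] by (intro sum.cong refl) (auto simp: Mop_v U_v mul_conv_X act_mul a b subset_iff)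
      finally show ?thesis .
    qed
    have "(\<Sum>g\<in>F. c g *\<^sub>R U g (Mop w)) = (\<Sum>g\<in>F. \<Sum>x\<in>F'. (c g * d x) *\<^sub>R v (mul (conv (translate (\<alpha> g) a) b) (act g x)))"
      by (intro sum.cong refl) (simp add: UMw scaleR_sum_right)
    also have "\<dots> = (\<Sum>p\<in>F \<times> F'. cc p *\<^sub>R v (mul (conv (B p) b) (y p)))"
      by (simp add: sum.cartesian_product case_prod_beta cc_def B_def y_def)
    finally have "?L w = (norm (\<Sum>p\<in>F \<times> F'. cc p *\<^sub>R v (mul (conv (B p) b) (y p))))\<^sup>2" by simp
    also have "\<dots> \<le> I (\<lambda>y. b y * b y) *
        (\<Sum>p\<in>F \<times> F'. \<Sum>q\<in>F \<times> F'. cc p * cc q * (v (y p) \<bullet> v (y q)) * I (\<lambda>z. B p z * B q z))"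
      using F F' by (intro conv_family b) (auto simp: y_def B_def act_X Cc_translate a \<alpha>_closed subset_iff)
    also have "(\<Sum>p\<in>F \<times> F'. \<Sum>q\<in>F \<times> F'. cc p * cc q * (v (y p) \<bullet> v (y q)) * I (\<lambda>z. B p z * B q z))
      = (\<Sum>g\<in>F. \<Sum>h\<in>F. \<Sum>x\<in>F'. \<Sum>x'\<in>F'. c g * d x * (c h * d x') * (v (act g x) \<bullet> v (act h x'))
          * I (\<lambda>z. translate (\<alpha> g) a z * translate (\<alpha> h) a z))"
      unfolding cc_def y_def B_def
      by (rule sum_sum_cartesian[where h = "\<lambda>g x h x'. c g * d x * (c h * d x') * (v (act g x) \<bullet> v (act h x'))
          * I (\<lambda>z. translate (\<alpha> g) a z * translate (\<alpha> h) a z)"])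
    also have "\<dots> = (\<Sum>g\<in>F. \<Sum>h\<in>F. c g * c h * (U g w \<bullet> U h w) * I (\<lambda>z. translate (\<alpha> g) a z * translate (\<alpha> h) a z))"
      by (intro sum.cong refl)
         (simp add: Uw inner_sum_sum sum_distrib_left sum_distrib_right mult_ac)
    finally show "w \<in> {w. ?L w \<le> ?R w}" by simp
  qed
  moreover have "closed {w. ?L w \<le> ?R w}"
  proof -
    have "continuous_on UNIV (\<lambda>w. U g w)" if "g \<in> F" for g
      using R.bounded_linear[OF gG[OF that]] by (rule linear_continuous_on)
    moreover have "continuous_on UNIV (\<lambda>w. U g (Mop w))" if "g \<in> F" for g
      using bounded_linear_compose[OF R.bounded_linear[OF gG[OF that]] Mop_linear] by (rule linear_continuous_on)
    ultimately show ?thesis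
      by (intro closed_Collect_le continuous_intros) auto
  qed
  ultimately have "closure (span (v ` X)) \<subseteq> {w. ?L w \<le> ?R w}" by (rule closure_minimal)
  with w show ?thesis by blast
qed

text \<open>Both \<open>Mop\<close> and the operator of the identity vanish on the complement of the
  closed span. So an arbitrary \<open>w\<close> may be replaced by its component in the span, to
  which \<open>Mop_orbit_bound\<close> applies.\<close>

lemma Mop_one: "Mop (U \<one>\<^bsub>G\<^esub> w) = Mop w"
proof -
  obtain M where M: "kop_pair v X (mul (conv a b)) (mul (conv a b)) M" using kop_conv by blast
  have "Mop w = Mop (U \<one>\<^bsub>G\<^esub> w)"
  proof (rule kop_pair.kop_eqI[OF M kop_pair.kop_in[OF M]])
    fix y assume y: "y \<in> X"
    show "Mop (U \<one>\<^bsub>G\<^esub> w) \<bullet> v y = w \<bullet> v (mul (conv a b) y)"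
      using y by (simp add: kop_pair.inner_kop[OF M] R.adjoint U_v mul_conv_X act_one)
  qed
  then show ?thesis by simp
qed

text \<open>Fell absorption: for each fixed \<open>z\<close> the values at \<open>z\<close> of the
  translates of \<open>a\<close> are merged with the weights, the bound for \<open>w\<close> is
  applied, and integration over \<open>z\<close> turns the new sum of squares into
  \<open>\<gamma>\<close> times the original one.\<close>

lemma Mop_bounded_vectors:
  assumes w: "w \<in> R.bounded_vectors"
  shows "Mop w \<in> R.bounded_vectors"
proof -
  obtain C where
    C: "\<And>F c. finite F \<Longrightarrow> F \<subseteq> carrier G \<Longrightarrow> (norm (\<Sum>g\<in>F. c g *\<^sub>R U g w))\<^sup>2 \<le> C * (\<Sum>g\<in>F. (c g)\<^sup>2)"
    using w unfolding R.bounded_vectors_def by blast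
  define \<beta> where "\<beta> = I (\<lambda>y. b y * b y)"
  define \<gamma> where "\<gamma> = I (\<lambda>y. a y * a y)"
  have "(norm (\<Sum>g\<in>F. c g *\<^sub>R U g (Mop w)))\<^sup>2 \<le> (\<beta> * (C * \<gamma>)) * (\<Sum>g\<in>F. (c g)\<^sup>2)"
    if F: "finite F" "F \<subseteq> carrier G" for F c
  proof -
    define a' where "a' g = translate (\<alpha> g) a" for g
    have a': "a' g \<in> Cc" if "g \<in> F" for g using that F by (auto simp: a'_def intro!: Cc_translate a \<alpha>_closed)
    have one: "U g (U \<one>\<^bsub>G\<^esub> w) = U g w" if "g \<in> F" for g
      using that F by (intro R.one_mult(1)) auto
    define k where "k g h = c g * c h * (U g w \<bullet> U h w)" for g h
    have kCc: "(\<lambda>z. k g h * (a' g z * a' h z)) \<in> Cc" if "g \<in> F" "h \<in> F" for g h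
      using that by (intro Cc_cmult Cc_times a')
    have sCc: "(\<lambda>z. (c g)\<^sup>2 * (a' g z * a' g z)) \<in> Cc" if "g \<in> F" for g
      using that by (intro Cc_cmult Cc_times a')
    have sq: "(\<lambda>z. a' g z * a' g z) \<in> Cc" if "g \<in> F" for g
      using that by (intro Cc_times a')
    have "U \<one>\<^bsub>G\<^esub> w \<in> closure (span (v ` X))"
      unfolding U_def by (rule kop_pair.kop_in[OF kop_act]) simp
    from Mop_orbit_bound[OF F this, of c]
    have orbit: "(norm (\<Sum>g\<in>F. c g *\<^sub>R U g (Mop w)))\<^sup>2 \<le> \<beta> * (\<Sum>g\<in>F. \<Sum>h\<in>F. k g h * I (\<lambda>z. a' g z * a' h z))"
      by (simp add: Mop_one \<beta>_def k_def a'_def one)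
    have "(\<Sum>g\<in>F. \<Sum>h\<in>F. k g h * I (\<lambda>z. a' g z * a' h z)) = I (\<lambda>z. \<Sum>g\<in>F. \<Sum>h\<in>F. k g h * (a' g z * a' h z))"
      using kCc by (simp add: I_sum Cc_sum I_cmult Cc_times a')
    also have "\<dots> \<le> I (\<lambda>z. C * (\<Sum>g\<in>F. (c g)\<^sup>2 * (a' g z * a' g z)))"
    proof (rule I_mono)
      show "(\<lambda>z. \<Sum>g\<in>F. \<Sum>h\<in>F. k g h * (a' g z * a' h z)) \<in> Cc" using kCc by (intro Cc_sum)
      show "(\<lambda>z. C * (\<Sum>g\<in>F. (c g)\<^sup>2 * (a' g z * a' g z))) \<in> Cc" by (rule Cc_cmult[OF Cc_sum[OF sCc]])
      fix z
      have "(\<Sum>g\<in>F. \<Sum>h\<in>F. k g h * (a' g z * a' h z)) = (norm (\<Sum>g\<in>F. (c g * a' g z) *\<^sub>R U g w))\<^sup>2"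
        unfolding norm_sum_sq by (intro sum.cong refl) (simp add: k_def mult_ac)
      also have "\<dots> \<le> C * (\<Sum>g\<in>F. (c g * a' g z)\<^sup>2)" by (rule C[OF F])
      finally show "(\<Sum>g\<in>F. \<Sum>h\<in>F. k g h * (a' g z * a' h z)) \<le> C * (\<Sum>g\<in>F. (c g)\<^sup>2 * (a' g z * a' g z))"
        by (simp add: power2_eq_square mult_ac)
    qed
    also have "\<dots> = C * (\<Sum>g\<in>F. I (\<lambda>z. (c g)\<^sup>2 * (a' g z * a' g z)))"
      by (simp only: I_cmult[OF Cc_sum[OF sCc]] I_sum[OF sCc])
    also have "\<dots> = C * (\<Sum>g\<in>F. (c g)\<^sup>2 * I (\<lambda>z. a' g z * a' g z))"
      by (intro arg_cong[of _ _ "\<lambda>s. C * s"] sum.cong refl I_cmult sq)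
    also have "\<dots> = C * (\<Sum>g\<in>F. (c g)\<^sup>2 * \<gamma>)"
    proof -
      have "I (\<lambda>z. a' g z * a' g z) = \<gamma>" if "g \<in> F" for g
        using I_translate[OF Cc_times[OF a a], of "\<alpha> g"] that F
        by (auto simp: a'_def \<gamma>_def translate_times \<alpha>_closed)
      then show ?thesis by simp
    qed
    finally have "\<beta> * (\<Sum>g\<in>F. \<Sum>h\<in>F. k g h * I (\<lambda>z. a' g z * a' h z)) \<le> \<beta> * (C * (\<Sum>g\<in>F. (c g)\<^sup>2 * \<gamma>))"
      using b(2) by (intro mult_left_mono) (auto simp: \<beta>_def)
    with orbit show ?thesis by (simp add: sum_distrib_left mult_ac)
  qed
  then show ?thesis unfolding R.bounded_vectors_def by blast
qed

lemma Mop_ac_part: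
  assumes "w \<in> R.ac_part"
  shows "Mop w \<in> R.ac_part"
  unfolding R.ac_part_def
  by (rule closure_image_subset_bounded_linear[OF Mop_linear _ assms[unfolded R.ac_part_def]])
     (auto intro!: closure_subset[THEN subsetD] Mop_bounded_vectors)

text \<open>The multiplier annihilates \<open>v x\<close> and fixes \<open>v y\<close>. Since it
  preserves the absolutely continuous part, it sends the singular component of \<open>v x\<close>
  into that part; since it is self-adjoint, the image is also orthogonal to that part. So the image
  is 0, and moving the multiplier away from \<open>v y\<close> gives the claim.\<close>

lemma singular_part_separated:
  assumes x: "x \<in> X" "\<And>z. conv a b z * A x z = 0" and y: "y \<in> X" "\<And>z. conv a b z * A y z = A y z"
  shows "(v x - proj R.ac_part (v x)) \<bullet> v y = 0"
proof -
  define q where "q = v x - proj R.ac_part (v x)"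
  have "v (mul (conv a b) x) \<bullet> v (mul (conv a b) x) = 0"
    by (simp only: inner_v[OF mul_conv_X mul_conv_X] x A_mul mult_zero_left mult_zero_right I_zero)
  then have "Mop (v x) = 0" using Mop_v[OF x(1)] by simp
  then have "Mop q = - Mop (proj R.ac_part (v x))"
    unfolding q_def by (simp add: linear_diff[OF bounded_linear.linear[OF Mop_linear]])
  then have ac: "Mop q \<in> R.ac_part"
    using Mop_ac_part[OF proj_in[OF R.ac_part]] subspace_neg[OF R.ac_part(1)] by simp
  have "Mop q \<bullet> Mop q = q \<bullet> Mop (Mop q)" by (rule Mop_selfadjoint)
  also have "\<dots> = 0"
    by (rule proj_orth[OF R.ac_part Mop_ac_part[OF ac], of "v x", folded q_def])
  finally have "Mop q = 0" by simp
  have "mul (conv a b) y = y" using y(2) by (cases y) (simp add: mul_def A_def fun_eq_iff)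
  then have "v y = Mop (v y)" using Mop_v[OF y(1)] by simp
  then have "q \<bullet> v y = q \<bullet> Mop (v y)" by simp
  also have "\<dots> = Mop q \<bullet> v y" by (rule Mop_selfadjoint[symmetric])
  finally show ?thesis using \<open>Mop q = 0\<close> by (simp add: q_def)
qed

end

end

section \<open>Convergently embedded sets\<close>

context lc_group
begin

lemma set_mult2I: "a \<in> A \<Longrightarrow> b \<in> B \<Longrightarrow> a \<otimes> b \<in> set_mult2 A B"
  unfolding set_mult2_iff by blast

lemma ex_Cc_nbhd:
  assumes V: "openin T V" "\<one> \<in> V"
  shows "\<exists>a\<in>Cc. (\<forall>x. 0 \<le> a x) \<and> a \<one> = 1 \<and> (\<forall>x. a x \<noteq> 0 \<longrightarrow> x \<in> V)"
proof -
  have Q: "compactin T {\<one>}" by simp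
  have F: "closedin T (topspace T - V)" using V(1) by (rule openin_closedin_eq[THEN iffD1, THEN conjunct2])
  have disj: "{\<one>} \<inter> (topspace T - V) = {}" using V by auto
  show ?thesis
  proof (rule Urysohn_Cc[OF Q F disj])
    fix f S
    assume f: "f \<in> Cc" "\<And>x. 0 \<le> f x" "\<And>x. x \<in> {\<one>} \<Longrightarrow> f x = 1" "compactin T S"
      "\<And>x. f x \<noteq> 0 \<Longrightarrow> x \<in> S" "S \<inter> (topspace T - V) = {}"
    have "x \<in> V" if "f x \<noteq> 0" for x
      using f(5)[OF that] f(6) compactin_carrier[OF f(4)] by auto
    with f(1-3) show ?thesis by auto
  qed
qed

lemma ex_Urysohn_Cc:
  assumes "compactin T Q" "closedin T F" "Q \<inter> F = {}"
  shows "\<exists>f S. f \<in> Cc \<and> compactin T S \<and> (\<forall>x\<in>Q. f x = 1) \<and> (\<forall>x. f x \<noteq> 0 \<longrightarrow> x \<in> S) \<and> S \<inter> F = {}"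
proof (rule Urysohn_Cc[OF assms])
  fix f S
  assume "f \<in> Cc" "\<And>x. x \<in> Q \<Longrightarrow> f x = 1" "compactin T S" "\<And>x. f x \<noteq> 0 \<Longrightarrow> x \<in> S" "S \<inter> F = {}"
  then show ?thesis by (intro exI[of _ f] exI[of _ S]) simp
qed

text \<open>The two products are dictated by \<open>singular_zero_off_p\<close>. A cutoff at
  \<open>p\<close> must be 1 on the first. Its support must avoid the second, because this support
  enlarged by \<open>C\<close> must not meet \<open>q C C\<close>, where one factor \<open>C\<close>
  holds the support of the translated function and the other that of the convolving one.\<close>

lemma separating_nbhd:
  assumes p: "p \<in> carrier K" and q: "q \<in> carrier K" and pq: "p \<noteq> q"
  obtains V C where "openin T V" "\<one> \<in> V" "compactin T C" "V \<subseteq> C"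
    "set_mult2 (set_mult2 {p} C) C \<inter> set_mult2 (set_mult2 (set_mult2 {q} C) C) ((\<lambda>x. inv x) ` C) = {}"
proof -
  define d where "d = inv p \<otimes> q"
  have d: "d \<in> carrier K" "p \<otimes> d = q" using p q by (simp_all add: d_def m_assoc[symmetric])
  have "d \<noteq> \<one>" using d pq p by auto
  then obtain O1 O2 where O: "openin T O1" "openin T O2" "\<one> \<in> O1" "d \<in> O2" "O1 \<inter> O2 = {}"
    using Hausdorff d(1) unfolding Hausdorff_space_def disjnt_def by (metis one_closed topspace_eq)
  have "d \<otimes> \<one> \<in> O2" using O(4) d by simp
  then obtain O3 where O3: "openin T O3" "\<one> \<in> O3" "\<And>x. x \<in> O3 \<Longrightarrow> d \<otimes> x \<in> O2"
    using nbhd_vimage[OF continuous_map_mult_left[OF d(1)] O(2)] by blast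
  \<comment> \<open>\<open>U1\<close> is disjoint from its translate by \<open>d\<close>; a common
    point of the two products would lie, after cancelling \<open>p\<close>, in both.\<close>
  define U1 where "U1 = O1 \<inter> O3"
  have U1: "openin T U1" "\<one> \<in> U1" using O O3 by (auto simp: U1_def)
  have U1d: False if "x \<in> U1" "y \<in> U1" "x = d \<otimes> y" for x y
    using that O(5) O3(3)[of y] by (auto simp: U1_def)
  obtain W where W: "openin T W" "\<one> \<in> W" "\<And>x y. x \<in> W \<Longrightarrow> y \<in> W \<Longrightarrow> x \<otimes> y \<in> U1"
    using nbhd_mult[OF U1] by blast
  obtain W' where W': "openin T W'" "\<one> \<in> W'" "\<And>x y. x \<in> W' \<Longrightarrow> y \<in> W' \<Longrightarrow> x \<otimes> y \<in> W"
    using nbhd_mult[OF W(1,2)] by blast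
  have "inv \<one> \<in> W" using W by simp
  then obtain W'' where W'': "openin T W''" "\<one> \<in> W''" "\<And>x. x \<in> W'' \<Longrightarrow> inv x \<in> W"
    using nbhd_vimage[OF continuous_map_inv[OF continuous_map_ident_T] W(1)] by blast
  have "openin T (W \<inter> W' \<inter> W'')" "\<one> \<in> W \<inter> W' \<inter> W''" using W W' W'' by auto
  then obtain V C where V: "openin T V" "\<one> \<in> V" "compactin T C" "V \<subseteq> C" "C \<subseteq> W \<inter> W' \<inter> W''"
    using compact_nbhd by blast
  note CK = compactin_carrier[OF V(3)]
  have "set_mult2 (set_mult2 {p} C) C \<inter> set_mult2 (set_mult2 (set_mult2 {q} C) C) ((\<lambda>x. inv x) ` C) = {}"
  proof (rule ccontr)
    assume "\<not> ?thesis"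
    then obtain c1 c2 c3 c4 c5 where c: "c1 \<in> C" "c2 \<in> C" "c3 \<in> C" "c4 \<in> C" "c5 \<in> C"
      and eq: "(p \<otimes> c1) \<otimes> c2 = ((q \<otimes> c3) \<otimes> c4) \<otimes> inv c5"
      by (auto simp: set_mult2_iff)
    have inW: "c1 \<in> W" "c2 \<in> W" "c3 \<in> W'" "c4 \<in> W'" "c5 \<in> W''" using c V(5) by blast+
    have cK: "c1 \<in> carrier K" "c2 \<in> carrier K" "c3 \<in> carrier K" "c4 \<in> carrier K" "inv c5 \<in> carrier K"
      using CK c by simp_all
    have "c1 \<otimes> c2 \<in> U1" by (rule W(3)[OF inW(1,2)])
    moreover have "(c3 \<otimes> c4) \<otimes> inv c5 \<in> U1"
      by (rule W(3)[OF W'(3)[OF inW(3,4)] W''(3)[OF inW(5)]])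
    moreover have "p \<otimes> (c1 \<otimes> c2) = p \<otimes> (d \<otimes> ((c3 \<otimes> c4) \<otimes> inv c5))"
    proof -
      have "p \<otimes> (c1 \<otimes> c2) = q \<otimes> ((c3 \<otimes> c4) \<otimes> inv c5)"
        using eq cK p q by (simp add: m_assoc)
      also have "\<dots> = (p \<otimes> d) \<otimes> ((c3 \<otimes> c4) \<otimes> inv c5)" by (simp only: d(2))
      also have "\<dots> = p \<otimes> (d \<otimes> ((c3 \<otimes> c4) \<otimes> inv c5))"
        using cK p d(1) by (intro m_assoc) auto
      finally show ?thesis .
    qed
    then have "c1 \<otimes> c2 = d \<otimes> ((c3 \<otimes> c4) \<otimes> inv c5)"
      using cK p d(1) by simp
    ultimately show False by (rule U1d)
  qed
  with V that show thesis by blast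
qed

end

text \<open>A finitely supported function is square summable: this is why the singular part ignores
  finitely many values of a coefficient.\<close>

lemma (in star_rep) singular_coefficient_zero_finite:
  assumes Z: "U \<one> Z = Z" and fin: "finite {g \<in> carrier G. U g Z \<bullet> Y \<noteq> 0}" and g: "g \<in> carrier G"
  shows "U g (Z - proj ac_part Z) \<bullet> Y = 0"
proof -
  define c where "c g = (if g \<in> carrier G then U g Z \<bullet> Y else 0)" for g
  have "finite {g. c g \<noteq> 0}" by (rule finite_subset[OF _ fin]) (auto simp: c_def)
  then have "(\<lambda>g. (c g)\<^sup>2) summable_on {g. c g \<noteq> 0}" by (rule summable_on_finite)
  then have "(\<lambda>g. (c g)\<^sup>2) summable_on UNIV" by (rule summable_on_cong_neutral[THEN iffD1, rotated -1]) auto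
  then have "coord (Abs_ell2 c) = c" by (simp add: Abs_ell2_inverse)
  then show ?thesis by (intro singular_coefficient_zero[OF Z _ g, of Y "Abs_ell2 c"]) (simp add: c_def)
qed

section \<open>Singular coefficients along the convergent set\<close>

context tensor_rep
begin

abbreviation singular :: "('g \<times> 's \<times> ('k \<Rightarrow> real)) ell2 \<Rightarrow> ('g \<times> 's \<times> ('k \<Rightarrow> real)) ell2" where
  "singular w \<equiv> w - proj R.ac_part w"

lemma singular_linear: "bounded_linear singular"
  by (intro bounded_linear_sub bounded_linear_ident bounded_linear_proj R.ac_part)

lemma U_singular: "g \<in> carrier G \<Longrightarrow> U g (singular w) = singular (U g w)"
  using R.proj_commute[OF R.ac_part R.ac_part_invariant, of g w] by (simp add: linear_diff[OF R.linear])

lemma singular_singular: "singular (singular w) = singular w"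
  using proj_eqI[OF R.ac_part subspace_0[OF R.ac_part(1)], of "singular w"] proj_orth[OF R.ac_part, of _ w]
  by simp

lemma base_X: "a \<in> Cc \<Longrightarrow> (\<one>\<^bsub>G\<^esub>, s, a) \<in> X" by (simp add: X_def)

lemma coefficient:
  assumes x: "x \<in> carrier G" and a: "a \<in> Cc" and b: "b \<in> Cc"
  shows "U x (v (\<one>\<^bsub>G\<^esub>, s, a)) \<bullet> v (\<one>\<^bsub>G\<^esub>, s', b)
    = (e (x, s) \<bullet> e (\<one>\<^bsub>G\<^esub>, s')) * I (\<lambda>z. translate (\<alpha> x) a z * b z)"
  using U_v[OF x base_X[OF a]] inner_v[OF act_X[OF x base_X[OF a, of s]] base_X[OF b, of s']] x
  by (simp add: act_def E_def A_def)

text \<open>The set \<open>E\<close> of the informal statement is called \<open>D\<close> here.\<close>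

context
  fixes D p s S'
  assumes inj: "inj_on \<alpha> (carrier G)" and p: "p \<in> carrier K" and D: "D \<subseteq> carrier G"
    and conv: "\<And>V. openin T V \<Longrightarrow> \<one>\<^bsub>K\<^esub> \<in> V \<Longrightarrow> finite {x \<in> D. inv\<^bsub>K\<^esub> p \<otimes>\<^bsub>K\<^esub> \<alpha> x \<notin> V}"
    and supp: "\<And>s' x. s' \<in> S' \<Longrightarrow> x \<in> carrier G - D \<Longrightarrow> e (x, s) \<bullet> e (\<one>\<^bsub>G\<^esub>, s') = 0"
begin

text \<open>For points of \<open>p V\<close> the product coefficient is then \<open>I a\<close>
  times the original one, and by convergence only finitely many points of \<open>D\<close> lie
  elsewhere.\<close>

definition cutoff :: "'k set \<Rightarrow> ('k \<Rightarrow> real) \<Rightarrow> ('k \<Rightarrow> real) \<Rightarrow> bool" where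
  "cutoff V a b \<longleftrightarrow> openin T V \<and> \<one>\<^bsub>K\<^esub> \<in> V \<and> a \<in> Cc \<and> b \<in> Cc \<and>
     (\<forall>x\<in>carrier K. inv\<^bsub>K\<^esub> p \<otimes>\<^bsub>K\<^esub> x \<in> V \<longrightarrow> (\<forall>z. translate x a z * b z = translate x a z))"

lemma cutoffD:
  assumes "cutoff V a b" shows "openin T V" "\<one>\<^bsub>K\<^esub> \<in> V" "a \<in> Cc" "b \<in> Cc"
  using assms by (simp_all add: cutoff_def)

lemma cutoff_coefficient:
  assumes c: "cutoff V a b" and x: "x \<in> carrier G" "inv\<^bsub>K\<^esub> p \<otimes>\<^bsub>K\<^esub> \<alpha> x \<in> V"
  shows "U x (v (\<one>\<^bsub>G\<^esub>, s, a)) \<bullet> v (\<one>\<^bsub>G\<^esub>, s', b) = I a * (e (x, s) \<bullet> e (\<one>\<^bsub>G\<^esub>, s'))"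
proof -
  have "translate (\<alpha> x) a z * b z = translate (\<alpha> x) a z" for z
    using c x(2) \<alpha>_closed[OF x(1)] unfolding cutoff_def by blast
  then have "(\<lambda>z. translate (\<alpha> x) a z * b z) = translate (\<alpha> x) a" by (rule ext)
  then show ?thesis
    using coefficient[OF x(1) cutoffD(3,4)[OF c]] I_translate[OF cutoffD(3)[OF c] \<alpha>_closed[OF x(1)]] by simp
qed

lemma cutoffI:
  assumes V: "openin T V" "\<one>\<^bsub>K\<^esub> \<in> V" "V \<subseteq> C" "compactin T C" and a: "a \<in> Cc" "\<And>z. a z \<noteq> 0 \<Longrightarrow> z \<in> V"
    and b: "b \<in> Cc" "\<And>z. z \<in> set_mult2 (set_mult2 {p} C) C \<Longrightarrow> b z = 1"
  shows "cutoff V a b"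
  unfolding cutoff_def
proof (intro conjI V a b ballI impI allI)
  fix x z assume x: "x \<in> carrier K" "inv\<^bsub>K\<^esub> p \<otimes>\<^bsub>K\<^esub> x \<in> V"
  show "translate x a z * b z = translate x a z"
  proof (cases "translate x a z = 0")
    case False
    then have z: "z \<in> carrier K" "inv\<^bsub>K\<^esub> x \<otimes>\<^bsub>K\<^esub> z \<in> V" using a(2) by (auto simp: translate_def split: if_splits)
    \<comment> \<open>Both bracketed quotients are in \<open>V\<close>, so this places
      \<open>z\<close> in \<open>p C C\<close>, where \<open>b\<close> is 1.\<close>
    have "z = (p \<otimes>\<^bsub>K\<^esub> (inv\<^bsub>K\<^esub> p \<otimes>\<^bsub>K\<^esub> x)) \<otimes>\<^bsub>K\<^esub> (inv\<^bsub>K\<^esub> x \<otimes>\<^bsub>K\<^esub> z)"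
    proof -
      have "p \<otimes>\<^bsub>K\<^esub> (inv\<^bsub>K\<^esub> p \<otimes>\<^bsub>K\<^esub> x) = x" "x \<otimes>\<^bsub>K\<^esub> (inv\<^bsub>K\<^esub> x \<otimes>\<^bsub>K\<^esub> z) = z"
        using x z p by (simp_all add: m_assoc[symmetric])
      then show ?thesis by simp
    qed
    moreover have "(p \<otimes>\<^bsub>K\<^esub> (inv\<^bsub>K\<^esub> p \<otimes>\<^bsub>K\<^esub> x)) \<otimes>\<^bsub>K\<^esub> (inv\<^bsub>K\<^esub> x \<otimes>\<^bsub>K\<^esub> z) \<in> set_mult2 (set_mult2 {p} C) C"
      using x(2) z(2) V(3) by (intro set_mult2I) auto
    ultimately have "z \<in> set_mult2 (set_mult2 {p} C) C" by simp
    then show ?thesis using b(2) by simp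
  qed simp
qed

lemma finite_zero_coefficient:
  assumes V: "openin T V" "\<one>\<^bsub>K\<^esub> \<in> V"
    and out: "\<And>x. x \<in> carrier G - D \<Longrightarrow> f x = 0"
    and near: "\<And>x. x \<in> carrier G \<Longrightarrow> inv\<^bsub>K\<^esub> p \<otimes>\<^bsub>K\<^esub> \<alpha> x \<in> V \<Longrightarrow> f x = (0::real)"
  shows "finite {x \<in> carrier G. f x \<noteq> 0}"
proof (rule finite_subset[OF _ conv[OF V]])
  show "{x \<in> carrier G. f x \<noteq> 0} \<subseteq> {x \<in> D. inv\<^bsub>K\<^esub> p \<otimes>\<^bsub>K\<^esub> \<alpha> x \<notin> V}"
    using out near by blast
qed

lemma out_coefficient:
  assumes "s' \<in> S'" "x \<in> carrier G - D" "a \<in> Cc" "b \<in> Cc"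
  shows "U x (v (\<one>\<^bsub>G\<^esub>, s, a)) \<bullet> v (\<one>\<^bsub>G\<^esub>, s', b) = 0"
  using assms supp[OF assms(1,2)] by (simp add: coefficient)

lemma U_one_base: "a \<in> Cc \<Longrightarrow> U \<one>\<^bsub>G\<^esub> (v (\<one>\<^bsub>G\<^esub>, s, a)) = v (\<one>\<^bsub>G\<^esub>, s, a)"
  using U_v[OF G.one_closed base_X] act_one[OF base_X] by simp

text \<open>
  The singular part of the coefficient does not depend on the cutoffs, up to the normalization by
  \<open>I a\<close>: shrinking the supports changes the coefficient at finitely many points only.
\<close>

lemma singular_change_left:
  assumes c: "cutoff V a b" and c1: "cutoff V1 a1 b" and s': "s' \<in> S'" and x: "x \<in> carrier G"
  shows "I a1 * (U x (singular (v (\<one>\<^bsub>G\<^esub>, s, a))) \<bullet> v (\<one>\<^bsub>G\<^esub>, s', b))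
    = I a * (U x (singular (v (\<one>\<^bsub>G\<^esub>, s, a1))) \<bullet> v (\<one>\<^bsub>G\<^esub>, s', b))"
proof -
  \<comment> \<open>The crossed factors \<open>I a1\<close> and \<open>I a\<close> make the two
    coefficients cancel near \<open>p\<close>.\<close>
  define Z where "Z = I a1 *\<^sub>R v (\<one>\<^bsub>G\<^esub>, s, a) - I a *\<^sub>R v (\<one>\<^bsub>G\<^esub>, s, a1)"
  note sl = bounded_linear.linear[OF singular_linear]
  have UZ: "U x Z \<bullet> v (\<one>\<^bsub>G\<^esub>, s', b) = I a1 * (U x (v (\<one>\<^bsub>G\<^esub>, s, a)) \<bullet> v (\<one>\<^bsub>G\<^esub>, s', b))
      - I a * (U x (v (\<one>\<^bsub>G\<^esub>, s, a1)) \<bullet> v (\<one>\<^bsub>G\<^esub>, s', b))" if "x \<in> carrier G" for x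
    using that by (simp add: Z_def linear_diff[OF R.linear] linear_scale[OF R.linear] inner_diff_left)
  have Z1: "U \<one>\<^bsub>G\<^esub> Z = Z"
    by (simp add: Z_def linear_diff[OF R.linear] linear_scale[OF R.linear] U_one_base cutoffD(3)[OF c] cutoffD(3)[OF c1])
  have "finite {x \<in> carrier G. U x Z \<bullet> v (\<one>\<^bsub>G\<^esub>, s', b) \<noteq> 0}"
  proof (rule finite_zero_coefficient[of "V \<inter> V1"])
    show "openin T (V \<inter> V1)" "\<one>\<^bsub>K\<^esub> \<in> V \<inter> V1" using cutoffD[OF c] cutoffD[OF c1] by auto
    show "U x Z \<bullet> v (\<one>\<^bsub>G\<^esub>, s', b) = 0" if "x \<in> carrier G - D" for x
      using that out_coefficient[OF s' that] cutoffD[OF c] cutoffD[OF c1] by (simp add: UZ)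
    show "U x Z \<bullet> v (\<one>\<^bsub>G\<^esub>, s', b) = 0" if "x \<in> carrier G" "inv\<^bsub>K\<^esub> p \<otimes>\<^bsub>K\<^esub> \<alpha> x \<in> V \<inter> V1" for x
      using that cutoff_coefficient[OF c, of x s'] cutoff_coefficient[OF c1, of x s'] by (simp add: UZ)
  qed
  from R.singular_coefficient_zero_finite[OF Z1 this x]
  have "U x (singular Z) \<bullet> v (\<one>\<^bsub>G\<^esub>, s', b) = 0" .
  moreover have "singular Z = I a1 *\<^sub>R singular (v (\<one>\<^bsub>G\<^esub>, s, a)) - I a *\<^sub>R singular (v (\<one>\<^bsub>G\<^esub>, s, a1))"
    unfolding Z_def by (simp only: linear_diff[OF sl] linear_scale[OF sl])
  ultimately show ?thesis
    using x by (simp only: linear_diff[OF R.linear[OF x]] linear_scale[OF R.linear[OF x]] inner_diff_left inner_scaleR_left)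
qed

lemma singular_change_right:
  assumes c: "cutoff V a b" and c1: "cutoff V1 a b1" and s': "s' \<in> S'" and x: "x \<in> carrier G"
  shows "U x (singular (v (\<one>\<^bsub>G\<^esub>, s, a))) \<bullet> v (\<one>\<^bsub>G\<^esub>, s', b)
    = U x (singular (v (\<one>\<^bsub>G\<^esub>, s, a))) \<bullet> v (\<one>\<^bsub>G\<^esub>, s', b1)"
proof -
  have "finite {x \<in> carrier G. U x (v (\<one>\<^bsub>G\<^esub>, s, a)) \<bullet> (v (\<one>\<^bsub>G\<^esub>, s', b) - v (\<one>\<^bsub>G\<^esub>, s', b1)) \<noteq> 0}"
  proof (rule finite_zero_coefficient[of "V \<inter> V1"])
    show "openin T (V \<inter> V1)" "\<one>\<^bsub>K\<^esub> \<in> V \<inter> V1" using cutoffD[OF c] cutoffD[OF c1] by auto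
    show "U x (v (\<one>\<^bsub>G\<^esub>, s, a)) \<bullet> (v (\<one>\<^bsub>G\<^esub>, s', b) - v (\<one>\<^bsub>G\<^esub>, s', b1)) = 0" if "x \<in> carrier G - D" for x
      using that out_coefficient[OF s' that] cutoffD[OF c] cutoffD[OF c1] by (simp add: inner_diff_right)
    show "U x (v (\<one>\<^bsub>G\<^esub>, s, a)) \<bullet> (v (\<one>\<^bsub>G\<^esub>, s', b) - v (\<one>\<^bsub>G\<^esub>, s', b1)) = 0"
      if "x \<in> carrier G" "inv\<^bsub>K\<^esub> p \<otimes>\<^bsub>K\<^esub> \<alpha> x \<in> V \<inter> V1" for x
      using that cutoff_coefficient[OF c, of x s'] cutoff_coefficient[OF c1, of x s'] by (simp add: inner_diff_right)
  qed
  from R.singular_coefficient_zero_finite[OF U_one_base[OF cutoffD(3)[OF c]] this x]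
  show ?thesis by (simp add: inner_diff_right)
qed

text \<open>For the given \<open>x\<close> the cutoffs are replaced by \<open>a1\<close> and
  \<open>b1\<close>, whose supports, after moving \<open>a1\<close> by \<open>\<alpha> x\<close>,
  are separated by a multiplier \<open>conv a' b'\<close>. The singular coefficient of the new pair
  vanishes at \<open>x\<close>, and the two change lemmas carry this back to the given pair.\<close>

lemma singular_zero_off_p:
  assumes V: "openin T V" "\<one>\<^bsub>K\<^esub> \<in> V" "V \<subseteq> C0" "compactin T C0"
    and b: "\<And>z. z \<in> set_mult2 (set_mult2 {p} C0) C0 \<Longrightarrow> b z = 1"
    and c: "cutoff V a b" and s': "s' \<in> S'" and x: "x \<in> carrier G" and xp: "\<alpha> x \<noteq> p"
  shows "U x (singular (v (\<one>\<^bsub>G\<^esub>, s, a))) \<bullet> v (\<one>\<^bsub>G\<^esub>, s', b) = 0"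
proof -
  define q where "q = \<alpha> x"
  have q: "q \<in> carrier K" "p \<noteq> q" using xp \<alpha>_closed[OF x] by (auto simp: q_def)
  obtain V1 C where V1: "openin T V1" "\<one>\<^bsub>K\<^esub> \<in> V1" "compactin T C" "V1 \<subseteq> C"
    and disj: "set_mult2 (set_mult2 {p} C) C
        \<inter> set_mult2 (set_mult2 (set_mult2 {q} C) C) ((\<lambda>x. inv\<^bsub>K\<^esub> x) ` C) = {}"
    using separating_nbhd[OF p q] by blast
  define V2 where "V2 = V \<inter> V1"
  have V2: "openin T V2" "\<one>\<^bsub>K\<^esub> \<in> V2" "V2 \<subseteq> C0" "V2 \<subseteq> C" using V V1 by (auto simp: V2_def)
  from ex_Cc_nbhd[OF V2(1,2)] obtain a1 where
    a1: "a1 \<in> Cc" "\<And>z. 0 \<le> a1 z" "a1 \<one>\<^bsub>K\<^esub> = 1" "\<And>z. a1 z \<noteq> 0 \<Longrightarrow> z \<in> V2" by blast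
  have a1C: "z \<in> C" if "a1 z \<noteq> 0" for z using a1(4)[OF that] V2(4) by blast
  have Ia1: "I a1 > 0" using I_pos[OF a1(1,2), of "\<one>\<^bsub>K\<^esub>"] a1(3) by simp
  note CK = compactin_carrier[OF V1(3)]
  have qC: "compactin T (set_mult2 {q} C)" and pCC: "compactin T (set_mult2 (set_mult2 {p} C) C)"
    using p q V1(3) by (simp_all add: compactin_set_mult2)
  have Fcl: "closedin T (set_mult2 (set_mult2 (set_mult2 {q} C) C) ((\<lambda>x. inv\<^bsub>K\<^esub> x) ` C))"
    by (intro closedin_compact compactin_set_mult2 compactin_inv_image qC V1(3))
  obtain b1 S2 where b1S2: "b1 \<in> Cc \<and> compactin T S2 \<and>
      (\<forall>z\<in>set_mult2 (set_mult2 {p} C) C. b1 z = 1) \<and> (\<forall>z. b1 z \<noteq> 0 \<longrightarrow> z \<in> S2) \<and>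
      S2 \<inter> set_mult2 (set_mult2 (set_mult2 {q} C) C) ((\<lambda>x. inv\<^bsub>K\<^esub> x) ` C) = {}"
    using ex_Urysohn_Cc[OF pCC Fcl disj] by (elim exE)
  have b1: "b1 \<in> Cc" "b1 z = 1" if "z \<in> set_mult2 (set_mult2 {p} C) C" for z
    using b1S2 that by simp_all
  have b1Cc: "b1 \<in> Cc" and S2: "compactin T S2"
      "S2 \<inter> set_mult2 (set_mult2 (set_mult2 {q} C) C) ((\<lambda>x. inv\<^bsub>K\<^esub> x) ` C) = {}"
    using b1S2 by simp_all
  have b1S: "z \<in> S2" if "b1 z \<noteq> 0" for z using b1S2 that by simp
  note S2K = compactin_carrier[OF S2(1)]
  have S2C: "compactin T (set_mult2 S2 C)" by (intro compactin_set_mult2 S2(1) V1(3))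
  have qCC: "closedin T (set_mult2 (set_mult2 {q} C) C)"
    by (intro closedin_compact compactin_set_mult2 qC V1(3))
  have disj2: "set_mult2 S2 C \<inter> set_mult2 (set_mult2 {q} C) C = {}"
  proof (rule ccontr)
    assume "\<not> ?thesis"
    then obtain w where w: "w \<in> set_mult2 S2 C" "w \<in> set_mult2 (set_mult2 {q} C) C" by blast
    from w(1) obtain t c where "t \<in> S2" "c \<in> C" "w = t \<otimes>\<^bsub>K\<^esub> c"
      unfolding set_mult2_iff[of w S2] by blast
    with w(2) have t: "t \<in> S2" "c \<in> C" "w \<in> set_mult2 (set_mult2 {q} C) C" "t \<otimes>\<^bsub>K\<^esub> c = w" by simp_all
    then have "w \<otimes>\<^bsub>K\<^esub> inv\<^bsub>K\<^esub> c = t" using S2K CK by (auto simp: m_assoc)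
    moreover have "w \<otimes>\<^bsub>K\<^esub> inv\<^bsub>K\<^esub> c \<in> set_mult2 (set_mult2 (set_mult2 {q} C) C) ((\<lambda>x. inv\<^bsub>K\<^esub> x) ` C)"
      using t by (intro set_mult2I) auto
    ultimately have "t \<in> set_mult2 (set_mult2 (set_mult2 {q} C) C) ((\<lambda>x. inv\<^bsub>K\<^esub> x) ` C)" by simp
    then show False using S2(2) t(1) by blast
  qed
  obtain a' S3 where a'S3: "a' \<in> Cc \<and> compactin T S3 \<and> (\<forall>z\<in>set_mult2 S2 C. a' z = 1) \<and>
      (\<forall>z. a' z \<noteq> 0 \<longrightarrow> z \<in> S3) \<and> S3 \<inter> set_mult2 (set_mult2 {q} C) C = {}"
    using ex_Urysohn_Cc[OF S2C qCC disj2] by (elim exE)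
  have a'Cc: "a' \<in> Cc" using a'S3 by simp
  have a'1: "a' z = 1" if "z \<in> set_mult2 S2 C" for z using a'S3 that by simp
  have a'0: "a' z = 0" if "z \<in> set_mult2 (set_mult2 {q} C) C" for z using a'S3 that by blast
  \<comment> \<open>Normalized so that \<open>I b' = 1\<close>: then \<open>conv a' b'\<close> is 1
    wherever \<open>a'\<close> is 1 on the whole translated support of \<open>b'\<close>.\<close>
  define b' where "b' z = inverse (I a1) * a1 z" for z
  have b': "b' \<in> Cc" unfolding b'_def by (rule Cc_cmult[OF a1(1)])
  have Ib': "I b' = 1" using I_cmult[OF a1(1), of "inverse (I a1)"] Ia1 by (simp add: b'_def[abs_def])
  have \<beta>: "I (\<lambda>y. b' y * b' y) > 0"
    using Ia1 a1(3) by (intro I_pos[of _ "\<one>\<^bsub>K\<^esub>"] Cc_times b') (simp_all add: b'_def)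
  have tr: "\<exists>c\<in>C. y = z \<otimes>\<^bsub>K\<^esub> c" if z: "z \<in> carrier K" and "translate z b' y \<noteq> 0" for z y
  proof -
    have "y \<in> carrier K" "inv\<^bsub>K\<^esub> z \<otimes>\<^bsub>K\<^esub> y \<in> C"
      using that a1C by (auto simp: translate_def b'_def split: if_splits)
    moreover from this z have "y = z \<otimes>\<^bsub>K\<^esub> (inv\<^bsub>K\<^esub> z \<otimes>\<^bsub>K\<^esub> y)" by (simp add: m_assoc[symmetric])
    ultimately show ?thesis by (rule_tac bexI[of _ "inv\<^bsub>K\<^esub> z \<otimes>\<^bsub>K\<^esub> y"])
  qed
  have conv1: "conv a' b' z = 1" if z: "z \<in> S2" for z
  proof -
    have "a' y * translate z b' y = translate z b' y" for y
    proof (cases "translate z b' y = 0")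
      case False
      then have "y \<in> set_mult2 S2 C" using tr[OF S2K[OF z] False] z by (auto intro: set_mult2I)
      then show ?thesis using a'1 by simp
    qed simp
    then have "(\<lambda>y. a' y * translate z b' y) = translate z b'" by (rule ext)
    then show ?thesis using S2K[OF z] Ib' b' by (simp add: conv_def I_translate)
  qed
  have conv0: "conv a' b' z = 0" if z: "z \<in> set_mult2 {q} C" for z
  proof -
    have zK: "z \<in> carrier K" using compactin_carrier[OF qC z] .
    have "a' y * translate z b' y = 0" for y
    proof (cases "translate z b' y = 0")
      case False
      then have "y \<in> set_mult2 (set_mult2 {q} C) C"
        using tr[OF zK False] z by (auto intro: set_mult2I)
      then show ?thesis using a'0 by simp
    qed simp
    then have "(\<lambda>y. a' y * translate z b' y) = (\<lambda>y. 0)" by (rule ext)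
    then show ?thesis using zK by (simp add: conv_def I_zero)
  qed
  have c11: "cutoff V2 a1 b1" by (rule cutoffI[OF V2(1,2,4) V1(3) a1(1,4) b1Cc b1(2)])
  \<comment> \<open>The pair of \<open>a1\<close> and \<open>b\<close> links the given pair to the
    new one, a single function changing at a time; for this \<open>V2\<close> was kept inside
    \<open>C0\<close>.\<close>
  have c1: "cutoff V2 a1 b" by (rule cutoffI[OF V2(1,2,3) V(4) a1(1,4) cutoffD(4)[OF c] b])
  have "singular (v (act x (\<one>\<^bsub>G\<^esub>, s, a1))) \<bullet> v (\<one>\<^bsub>G\<^esub>, s', b1) = 0"
  proof (rule singular_part_separated[OF a'Cc b' \<beta> act_X[OF x base_X[OF a1(1)]] _ base_X[OF b1Cc]])
    show "conv a' b' z * A (act x (\<one>\<^bsub>G\<^esub>, s, a1)) z = 0" for z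
    proof (cases "translate q a1 z = 0")
      case False
      then have z: "z \<in> carrier K" "inv\<^bsub>K\<^esub> q \<otimes>\<^bsub>K\<^esub> z \<in> C" using a1C by (auto simp: translate_def split: if_splits)
      then have "q \<otimes>\<^bsub>K\<^esub> (inv\<^bsub>K\<^esub> q \<otimes>\<^bsub>K\<^esub> z) = z" using q(1) by (simp add: m_assoc[symmetric])
      moreover have "q \<otimes>\<^bsub>K\<^esub> (inv\<^bsub>K\<^esub> q \<otimes>\<^bsub>K\<^esub> z) \<in> set_mult2 {q} C"
        using z(2) by (intro set_mult2I) auto
      ultimately have "z \<in> set_mult2 {q} C" by simp
      then show ?thesis using conv0 by simp
    qed (simp add: act_def A_def q_def)
    show "conv a' b' z * A (\<one>\<^bsub>G\<^esub>, s', b1) z = A (\<one>\<^bsub>G\<^esub>, s', b1) z" for z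
      using conv1[of z] b1S[of z] by (cases "b1 z = 0") (simp_all add: A_def)
  qed
  then have "U x (singular (v (\<one>\<^bsub>G\<^esub>, s, a1))) \<bullet> v (\<one>\<^bsub>G\<^esub>, s', b1) = 0"
    using x by (simp only: U_singular U_v base_X[OF a1(1)])
  then have "U x (singular (v (\<one>\<^bsub>G\<^esub>, s, a1))) \<bullet> v (\<one>\<^bsub>G\<^esub>, s', b) = 0"
    using singular_change_right[OF c1 c11 s' x] by simp
  then have "I a1 * (U x (singular (v (\<one>\<^bsub>G\<^esub>, s, a))) \<bullet> v (\<one>\<^bsub>G\<^esub>, s', b)) = 0"
    using singular_change_left[OF c c1 s' x] by simp
  then show ?thesis using Ia1 by simp
qed

text \<open>One \<open>w\<close> serves all tags in \<open>S'\<close>, so that the real and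
  imaginary part of a function become coefficients of the same vector.\<close>

lemma restricted_coefficients_ac:
  obtains w where "w \<in> R.ac_part"
    "\<And>s'. s' \<in> S' \<Longrightarrow> \<exists>Y. finite {x \<in> carrier G. e (x, s) \<bullet> e (\<one>\<^bsub>G\<^esub>, s') \<noteq> U x w \<bullet> Y}"
proof -
  obtain V C where V: "openin T V" "\<one>\<^bsub>K\<^esub> \<in> V" "compactin T C" "V \<subseteq> C" using compact_nbhd_one by blast
  obtain a where a: "a \<in> Cc" "\<And>z. 0 \<le> a z" "a \<one>\<^bsub>K\<^esub> = 1" "\<And>z. a z \<noteq> 0 \<Longrightarrow> z \<in> V"
    using ex_Cc_nbhd[OF V(1,2)] by blast
  have Ia: "I a > 0" using I_pos[OF a(1,2), of "\<one>\<^bsub>K\<^esub>"] a(3) by simp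
  have "compactin T (set_mult2 (set_mult2 {p} C) C)" using p V(3) by (simp add: compactin_set_mult2)
  then obtain b where b: "b \<in> Cc" "\<And>z. z \<in> set_mult2 (set_mult2 {p} C) C \<Longrightarrow> b z = 1"
    using ex_Cc_one by blast
  have c: "cutoff V a b" by (rule cutoffI[OF V(1,2,4,3) a(1,4) b])
  define Z where "Z = v (\<one>\<^bsub>G\<^esub>, s, a)"
  define w where "w = proj R.ac_part Z"
  have Z1: "U \<one>\<^bsub>G\<^esub> Z = Z" unfolding Z_def by (rule U_one_base[OF a(1)])
  show thesis
  proof (rule that[of w])
    show "w \<in> R.ac_part" unfolding w_def by (rule proj_in[OF R.ac_part])
    fix s' assume s': "s' \<in> S'"
    define Y where "Y = v (\<one>\<^bsub>G\<^esub>, s', b)"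
    have "finite {x \<in> carrier G. U x (singular Z) \<bullet> Y \<noteq> 0}"
    proof (rule finite_subset)
      show "{x \<in> carrier G. U x (singular Z) \<bullet> Y \<noteq> 0} \<subseteq> {x \<in> carrier G. \<alpha> x = p}"
        using singular_zero_off_p[OF V(1,2,4,3) b(2) c s'] unfolding Z_def Y_def by blast
      show "finite {x \<in> carrier G. \<alpha> x = p}"
      proof (rule finite_imageD)
        show "finite (\<alpha> ` {x \<in> carrier G. \<alpha> x = p})" by (rule finite_subset[of _ "{p}"]) auto
        show "inj_on \<alpha> {x \<in> carrier G. \<alpha> x = p}" using inj by (rule inj_on_subset) auto
      qed
    qed
    \<comment> \<open>At most one \<open>x\<close> with \<open>\<alpha> x = p\<close> is left, so
      this coefficient has finite support; disjointness applied to the singular vector itself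
      removes it there too.\<close>
    from R.singular_coefficient_zero_finite[OF _ this] have sing: "U x (singular Z) \<bullet> Y = 0" if "x \<in> carrier G" for x
      using that by (simp only: singular_singular U_singular Z1 G.one_closed)
    have wZ: "U x w \<bullet> Y = U x Z \<bullet> Y" if x: "x \<in> carrier G" for x
      using sing[OF x] by (simp add: w_def linear_diff[OF R.linear[OF x]] inner_diff_left)
    have "finite {x \<in> carrier G. e (x, s) \<bullet> e (\<one>\<^bsub>G\<^esub>, s') - U x w \<bullet> (inverse (I a) *\<^sub>R Y) \<noteq> 0}"
    proof (rule finite_zero_coefficient[OF V(1,2)])
      show "e (x, s) \<bullet> e (\<one>\<^bsub>G\<^esub>, s') - U x w \<bullet> (inverse (I a) *\<^sub>R Y) = 0" if "x \<in> carrier G - D" for x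
        using that supp[OF s' that] out_coefficient[OF s' that a(1) b(1)] by (simp add: wZ) (simp add: Z_def Y_def)
      show "e (x, s) \<bullet> e (\<one>\<^bsub>G\<^esub>, s') - U x w \<bullet> (inverse (I a) *\<^sub>R Y) = 0"
        if "x \<in> carrier G" "inv\<^bsub>K\<^esub> p \<otimes>\<^bsub>K\<^esub> \<alpha> x \<in> V" for x
        using cutoff_coefficient[OF c that, of s'] Ia by (simp add: wZ[OF that(1)]) (simp add: Z_def Y_def)
    qed
    then show "\<exists>Y. finite {x \<in> carrier G. e (x, s) \<bullet> e (\<one>\<^bsub>G\<^esub>, s') \<noteq> U x w \<bullet> Y}"
      by (intro exI[of _ "inverse (I a) *\<^sub>R Y"]) simp
  qed
qed

end

end

section \<open>Positive definite functions\<close>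

lemma positive_definite_sum:
  assumes "positive_definite G \<phi>" "finite F" "F \<subseteq> carrier G"
  shows "(\<Sum>x\<in>F. \<Sum>y\<in>F. cnj (c x) * c y * \<phi> (inv\<^bsub>G\<^esub> x \<otimes>\<^bsub>G\<^esub> y)) \<in> \<real>\<^sub>\<ge>\<^sub>0"
  using assms unfolding positive_definite_def by blast

lemma (in group) positive_definite_hermitian:
  assumes \<phi>: "positive_definite G \<phi>" and g: "g \<in> carrier G"
  shows "\<phi> (inv g) = cnj (\<phi> g)"
proof -
  have one: "\<phi> \<one> \<in> \<real>\<^sub>\<ge>\<^sub>0"
    using positive_definite_sum[OF \<phi>, of "{\<one>}" "\<lambda>_. 1"] by simp
  then have im1: "Im (\<phi> \<one>) = 0" by (simp add: complex_nonneg_Reals_iff)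
  show ?thesis
  proof (cases "g = \<one>")
    case True
    then show ?thesis using im1 by (simp add: complex_eq_iff)
  next
    case False
    \<comment> \<open>Two-point sums are real for every weight \<open>z\<close>; the weight 1
      compares imaginary parts, the weight \<open>\<i>\<close> real parts.\<close>
    have two: "Im (\<phi> \<one> + z * \<phi> g + (cnj z * \<phi> (inv g) + cnj z * z * \<phi> \<one>)) = 0" for z
    proof -
      have "(\<Sum>x\<in>{\<one>, g}. \<Sum>y\<in>{\<one>, g}. cnj (if x = g then z else 1) * (if y = g then z else 1) * \<phi> (inv x \<otimes> y)) \<in> \<real>\<^sub>\<ge>\<^sub>0"
        using g by (intro positive_definite_sum[OF \<phi>]) auto
      then show ?thesis using g False by (simp add: complex_nonneg_Reals_iff)
    qed
    have "Im (\<phi> g) + Im (\<phi> (inv g)) = 0" using two[of 1] im1 by simp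
    moreover have "Re (\<phi> g) - Re (\<phi> (inv g)) = 0" using two[of \<i>] im1 by simp
    ultimately show ?thesis by (simp add: complex_eq_iff)
  qed
qed

text \<open>Repeated points are allowed, the weights of equal points being collected: distinct
  tagged labels may share their group element.\<close>

lemma positive_definite_family:
  assumes \<phi>: "positive_definite G \<phi>" and J: "finite J" and g: "\<And>j. j \<in> J \<Longrightarrow> g j \<in> carrier G"
  shows "(\<Sum>i\<in>J. \<Sum>j\<in>J. cnj (c i) * c j * \<phi> (inv\<^bsub>G\<^esub> (g i) \<otimes>\<^bsub>G\<^esub> g j)) \<in> \<real>\<^sub>\<ge>\<^sub>0"
proof -
  define C where "C x = (\<Sum>j\<in>{j\<in>J. g j = x}. c j)" for x
  have C: "(\<Sum>x\<in>g ` J. C x * f x) = (\<Sum>j\<in>J. c j * f (g j))" for f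
  proof -
    have "(\<Sum>x\<in>g ` J. C x * f x) = (\<Sum>x\<in>g ` J. \<Sum>j\<in>{j\<in>J. g j = x}. c j * f (g j))"
      unfolding C_def sum_distrib_right by (intro sum.cong refl) auto
    also have "\<dots> = (\<Sum>j\<in>J. c j * f (g j))" using J by (intro sum.group) auto
    finally show ?thesis .
  qed
  have C': "(\<Sum>x\<in>g ` J. cnj (C x) * f x) = (\<Sum>j\<in>J. cnj (c j) * f (g j))" for f
    using arg_cong[OF C[of "\<lambda>x. cnj (f x)"], of cnj] by simp
  have "(\<Sum>i\<in>J. \<Sum>j\<in>J. cnj (c i) * c j * \<phi> (inv\<^bsub>G\<^esub> (g i) \<otimes>\<^bsub>G\<^esub> g j))
      = (\<Sum>i\<in>J. cnj (c i) * (\<Sum>j\<in>J. c j * \<phi> (inv\<^bsub>G\<^esub> (g i) \<otimes>\<^bsub>G\<^esub> g j)))"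
    by (simp add: sum_distrib_left mult.assoc)
  also have "\<dots> = (\<Sum>x\<in>g ` J. cnj (C x) * (\<Sum>y\<in>g ` J. C y * \<phi> (inv\<^bsub>G\<^esub> x \<otimes>\<^bsub>G\<^esub> y)))"
    unfolding C C' ..
  also have "\<dots> = (\<Sum>x\<in>g ` J. \<Sum>y\<in>g ` J. cnj (C x) * C y * \<phi> (inv\<^bsub>G\<^esub> x \<otimes>\<^bsub>G\<^esub> y))"
    by (simp add: sum_distrib_left mult.assoc)
  also have "\<dots> \<in> \<real>\<^sub>\<ge>\<^sub>0" using J g by (intro positive_definite_sum[OF \<phi>]) auto
  finally show ?thesis .
qed

text \<open>
  A tag \<open>s\<close> stands for the vector \<open>\<Sum>i. s i *\<^sub>C \<xi> i\<close>, where \<open>\<xi> i\<close> is the cyclic vector of \<open>\<phi> i\<close>, in the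
  direct sum of the representations, which is regarded as a real Hilbert space.
\<close>

lemma (in group) positive_definite_realization:
  fixes \<phi> :: "nat \<Rightarrow> 'a \<Rightarrow> complex"
  assumes \<phi>: "\<And>i. i < n \<Longrightarrow> positive_definite G (\<phi> i)"
  shows "\<exists>e :: 'a \<times> (nat \<Rightarrow> complex) \<Rightarrow> ('a \<times> (nat \<Rightarrow> complex)) ell2. \<forall>g\<in>carrier G. \<forall>h\<in>carrier G. \<forall>s t.
    e (g, s) \<bullet> e (h, t) = Re (\<Sum>i<n. cnj (s i) * t i * \<phi> i (inv g \<otimes> h))"
proof -
  define \<kappa> where "\<kappa> p q = (if fst p \<in> carrier G \<and> fst q \<in> carrier G
    then Re (\<Sum>i<n. cnj (snd p i) * snd q i * \<phi> i (inv (fst p) \<otimes> fst q)) else 0)" for p q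
  have "psd_kernel \<kappa>"
    unfolding psd_kernel_def
  proof (intro conjI allI impI)
    fix p q
    show "\<kappa> p q = \<kappa> q p"
    proof (cases "fst p \<in> carrier G \<and> fst q \<in> carrier G")
      case True
      have "Re (cnj (snd p i) * snd q i * \<phi> i (inv (fst p) \<otimes> fst q))
          = Re (cnj (snd q i) * snd p i * \<phi> i (inv (fst q) \<otimes> fst p))" if "i < n" for i
      proof -
        have "\<phi> i (inv (fst q) \<otimes> fst p) = cnj (\<phi> i (inv (fst p) \<otimes> fst q))"
          using positive_definite_hermitian[OF \<phi>[OF that], of "inv (fst p) \<otimes> fst q"] True
          by (simp add: inv_mult_group)
        then have "cnj (snd q i) * snd p i * \<phi> i (inv (fst q) \<otimes> fst p)
            = cnj (cnj (snd p i) * snd q i * \<phi> i (inv (fst p) \<otimes> fst q))" by simp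
        then show ?thesis by (simp only: cnj.simps)
      qed
      then show ?thesis using True by (simp add: \<kappa>_def)
    qed (auto simp: \<kappa>_def)
  next
    fix F :: "('a \<times> (nat \<Rightarrow> complex)) set" and r :: "'a \<times> (nat \<Rightarrow> complex) \<Rightarrow> real" assume F: "finite F"
    define J where "J = {p \<in> F. fst p \<in> carrier G}"
    have "(\<Sum>p\<in>F. \<Sum>q\<in>F. r p * r q * \<kappa> p q) = (\<Sum>p\<in>J. \<Sum>q\<in>J. r p * r q * \<kappa> p q)"
      using F by (intro sum.mono_neutral_cong_right) (auto simp: \<kappa>_def J_def intro!: sum.mono_neutral_right)
    also have "\<dots> = Re (\<Sum>p\<in>J. \<Sum>q\<in>J. \<Sum>i<n. cnj (r p * snd p i) * (r q * snd q i) * \<phi> i (inv (fst p) \<otimes> fst q))"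
    proof -
      have "r p * r q * \<kappa> p q = Re (\<Sum>i<n. cnj (r p * snd p i) * (r q * snd q i) * \<phi> i (inv (fst p) \<otimes> fst q))"
        if pq: "p \<in> J" "q \<in> J" for p q :: "'a \<times> (nat \<Rightarrow> complex)"
      proof -
        define S where "S = (\<Sum>i<n. cnj (snd p i) * snd q i * \<phi> i (inv (fst p) \<otimes> fst q))"
        have "(\<Sum>i<n. cnj (r p * snd p i) * (r q * snd q i) * \<phi> i (inv (fst p) \<otimes> fst q))
            = complex_of_real (r p * r q) * S"
          unfolding S_def sum_distrib_left by (intro sum.cong refl) (simp add: mult_ac)
        moreover have "\<kappa> p q = Re S" using pq unfolding \<kappa>_def J_def S_def by simp
        ultimately show ?thesis by simp
      qed
      then show ?thesis by (simp only: Re_sum) (intro sum.cong refl, simp add: Re_sum)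
    qed
    also have "(\<Sum>p\<in>J. \<Sum>q\<in>J. \<Sum>i<n. cnj (r p * snd p i) * (r q * snd q i) * \<phi> i (inv (fst p) \<otimes> fst q))
        = (\<Sum>i<n. \<Sum>p\<in>J. \<Sum>q\<in>J. cnj (r p * snd p i) * (r q * snd q i) * \<phi> i (inv (fst p) \<otimes> fst q))"
      by (subst sum.swap[where A = "{..<n}"]) (intro sum.cong refl sum.swap)
    also have "Re \<dots> = (\<Sum>i<n. Re (\<Sum>p\<in>J. \<Sum>q\<in>J. cnj (r p * snd p i) * (r q * snd q i) * \<phi> i (inv (fst p) \<otimes> fst q)))"
      by (rule Re_sum)
    also have "\<dots> \<ge> 0"
    proof (rule sum_nonneg)
      fix i assume "i \<in> {..<n}"
      then have "(\<Sum>p\<in>J. \<Sum>q\<in>J. cnj (r p * snd p i) * (r q * snd q i) * \<phi> i (inv (fst p) \<otimes> fst q)) \<in> \<real>\<^sub>\<ge>\<^sub>0"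
        using F by (intro positive_definite_family \<phi>) (auto simp: J_def)
      then show "0 \<le> Re (\<Sum>p\<in>J. \<Sum>q\<in>J. cnj (r p * snd p i) * (r q * snd q i) * \<phi> i (inv (fst p) \<otimes> fst q))"
        by (simp only: complex_nonneg_Reals_iff)
    qed
    finally show "0 \<le> (\<Sum>p\<in>F. \<Sum>q\<in>F. r p * r q * \<kappa> p q)" .
  qed
  from psd_kernel_realization[OF this] obtain e :: "'a \<times> (nat \<Rightarrow> complex) \<Rightarrow> ('a \<times> (nat \<Rightarrow> complex)) ell2"
    where e: "\<And>p q. e p \<bullet> e q = \<kappa> p q" by blast
  show ?thesis by (intro exI[of _ e]) (simp add: e \<kappa>_def)
qed

section \<open>The theorem\<close>

lemma (in lc_group) ex_haar_group: "\<exists>I. haar_group K T I"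
proof (rule haar_functional)
  fix I :: "('k \<Rightarrow> real) \<Rightarrow> real"
  assume I: "\<And>f g. f \<in> Cc \<Longrightarrow> g \<in> Cc \<Longrightarrow> I (\<lambda>x. f x + g x) = I f + I g"
    "\<And>f c. f \<in> Cc \<Longrightarrow> I (\<lambda>x. c * f x) = c * I f"
    "\<And>f. f \<in> Cc \<Longrightarrow> (\<And>x. 0 \<le> f x) \<Longrightarrow> 0 \<le> I f"
    "\<And>f x. f \<in> Cc \<Longrightarrow> (\<And>x. 0 \<le> f x) \<Longrightarrow> f x > 0 \<Longrightarrow> I f > 0"
    "\<And>f x. f \<in> Cc \<Longrightarrow> x \<in> carrier K \<Longrightarrow> I (translate x f) = I f"
  have "haar_group K T I"
  proof (intro haar_group.intro haar_group_axioms.intro lc_group_axioms)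
    show "0 \<le> I f" if "f \<in> Cc" "\<And>x. 0 \<le> f x" for f using that by (rule I(3))
    show "0 < I f" if "f \<in> Cc" "\<And>x. 0 \<le> f x" "0 < f x" for f x using that by (rule I(4))
  qed (simp_all add: I(1,2,5))
  then show ?thesis by blast
qed

text \<open>Infinitely many far points would accumulate by compactness, necessarily at
  \<open>p\<close>, whose neighbourhood \<open>p V\<close> contains none of them.\<close>

lemma (in lc_group) finite_far_points:
  assumes inj: "inj_on \<alpha> E" and cpt: "compactin T (T closure_of (\<alpha> ` E))"
    and sub: "\<alpha> ` E \<subseteq> carrier K"
    and lim: "T derived_set_of (\<alpha> ` E) = {p}" and V: "openin T V" "\<one> \<in> V"
  shows "finite {x \<in> E. inv p \<otimes> \<alpha> x \<notin> V}"
proof (rule ccontr)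
  define D where "D = {x \<in> E. inv p \<otimes> \<alpha> x \<notin> V}"
  assume "infinite {x \<in> E. inv p \<otimes> \<alpha> x \<notin> V}"
  then have "infinite (\<alpha> ` D)"
    using finite_imageD[of \<alpha> D] inj_on_subset[OF inj, of D] by (auto simp: D_def)
  moreover have DE: "\<alpha> ` D \<subseteq> \<alpha> ` E" by (auto simp: D_def)
  ultimately have "T derived_set_of (\<alpha> ` D) \<noteq> {}"
    using compact_closure_of_imp_Bolzano_Weierstrass[OF cpt _ DE] sub by simp
  moreover have "T derived_set_of (\<alpha> ` D) \<subseteq> {p}"
    using derived_set_of_mono[OF DE] lim by metis
  ultimately have pD: "p \<in> T derived_set_of (\<alpha> ` D)" by blast
  then have p: "p \<in> carrier K" using derived_set_of_subset_topspace[of T] by auto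
  define W where "W = {k \<in> topspace T. inv p \<otimes> k \<in> V}"
  have "openin T W"
    unfolding W_def using p V(1) by (intro openin_continuous_map_preimage[OF continuous_map_mult_left]) auto
  moreover have "p \<in> W" using p V by (simp add: W_def)
  ultimately obtain y where "y \<in> \<alpha> ` D" "y \<in> W"
    using pD unfolding in_derived_set_of by blast
  then show False by (auto simp: D_def W_def)
qed

text \<open>Both vectors are extended by zero from the subgroup. For \<open>x\<close> off the
  subgroup the shifted \<open>\<xi>\<close> lives on a different coset from \<open>\<eta>\<close>,
  so the coefficient vanishes by itself.\<close>

lemma (in group) fourier_algebraI:
  fixes \<zeta> y1 y2 :: "'a ell2"
  assumes H: "subgroup H G" and G': "G' = G\<lparr>carrier := H\<rparr>"
    and re: "\<And>x. x \<in> H \<Longrightarrow> Re (u x) = left_shift G' x \<zeta> \<bullet> y1"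
    and im: "\<And>x. x \<in> H \<Longrightarrow> Im (u x) = left_shift G' x \<zeta> \<bullet> y2"
    and out: "\<And>x. x \<in> carrier G - H \<Longrightarrow> u x = 0"
  shows "u \<in> fourier_algebra G"
proof -
  interpret H: group G' unfolding G' by (rule subgroup_imp_group[OF H])
  have HG: "H \<subseteq> carrier G" using H by (rule subgroup.subset)
  have invH: "inv\<^bsub>G'\<^esub> x = inv x" if "x \<in> H" for x
    unfolding G' by (rule m_inv_consistent[OF H that])
  define \<xi> where "\<xi> h = complex_of_real (if h \<in> H then coord \<zeta> h else 0)" for h
  \<comment> \<open>\<open>\<zeta>\<close> is real, so the two real coefficients combine into one
    complex vector; the minus sign is undone by the conjugation in \<open>l2_inner\<close>.\<close>
  define \<eta> where "\<eta> h = (if h \<in> H then Complex (coord y1 h) (- coord y2 h) else 0)" for h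
  have sum: "(\<lambda>h. (coord f h)\<^sup>2) summable_on H" for f :: "'a ell2"
    by (rule summable_on_subset_banach[OF coord_square_summable]) simp
  have l2I: "f \<in> l2 (carrier G)" if s: "(\<lambda>h. (cmod (f h))\<^sup>2) summable_on H" and f: "\<And>h. h \<notin> H \<Longrightarrow> f h = 0" for f
    unfolding l2_def mem_Collect_eq
    by (rule summable_on_cong_neutral[THEN iffD1, OF _ _ _ s]) (use f HG in auto)
  have \<xi>: "\<xi> \<in> l2 (carrier G)"
  proof (rule l2I)
    show "(\<lambda>h. (cmod (\<xi> h))\<^sup>2) summable_on H"
      by (rule summable_on_cong[THEN iffD1, OF _ sum[of \<zeta>]]) (simp add: \<xi>_def)
  qed (simp add: \<xi>_def)
  have \<eta>: "\<eta> \<in> l2 (carrier G)"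
  proof (rule l2I)
    show "(\<lambda>h. (cmod (\<eta> h))\<^sup>2) summable_on H"
      by (rule summable_on_cong[THEN iffD1, OF _ summable_on_add[OF sum[of y1] sum[of y2]]])
         (simp add: \<eta>_def cmod_power2)
  qed (simp add: \<eta>_def)
  have "u x = l2_inner (carrier G) (left_regular G x \<xi>) \<eta>" if x: "x \<in> carrier G" for x
  proof (cases "x \<in> H")
    case True
    define a where "a h = coord (left_shift G' x \<zeta>) h" for h
    have xG': "x \<in> carrier G'" using True by (simp add: G')
    have a: "a h = (if h \<in> H then coord \<zeta> (inv x \<otimes> h) else 0)" for h
      unfolding a_def using H.coord_left_shift[OF xG', of \<zeta> h] invH[OF True] by (simp add: G')
    have hs: "((\<lambda>h. a h * coord y h) has_sum (left_shift G' x \<zeta> \<bullet> y)) UNIV" for y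
      unfolding a_def inner_ell2_def
      by (intro has_sum_infsum square_summable_times coord_square_summable)
    have "((\<lambda>h. complex_of_real (a h * coord y1 h) + \<i> * complex_of_real (a h * coord y2 h))
        has_sum (complex_of_real (Re (u x)) + \<i> * complex_of_real (Im (u x)))) UNIV"
      unfolding re[OF True] im[OF True]
      by (intro has_sum_add has_sum_cmult_right has_sum_of_real hs)
    then have "((\<lambda>h. complex_of_real (a h * coord y1 h) + \<i> * complex_of_real (a h * coord y2 h)) has_sum u x) UNIV"
      by (simp only: complex_eq[symmetric])
    then have "((\<lambda>h. left_regular G x \<xi> h * cnj (\<eta> h)) has_sum u x) (carrier G)"
    proof (rule has_sum_cong_neutral[THEN iffD1, rotated -1])
      fix h assume "h \<in> UNIV \<inter> carrier G"
      have "inv x \<otimes> h \<in> H" if "h \<in> H"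
        using that True subgroup.m_inv_closed[OF H] subgroup.m_closed[OF H] by blast
      then show "complex_of_real (a h * coord y1 h) + \<i> * complex_of_real (a h * coord y2 h)
          = left_regular G x \<xi> h * cnj (\<eta> h)"
        by (simp add: left_regular_def a \<xi>_def \<eta>_def complex_eq_iff)
    qed (use HG in \<open>auto simp: a\<close>)
    then show ?thesis unfolding l2_inner_def by (rule infsumI[symmetric])
  next
    case False
    have "left_regular G x \<xi> h * cnj (\<eta> h) = 0" for h
    proof (cases "h \<in> H")
      case True
      have "inv x \<otimes> h \<notin> H"
      proof
        assume "inv x \<otimes> h \<in> H"
        then have "h \<otimes> inv (inv x \<otimes> h) \<in> H"
          using True subgroup.m_inv_closed[OF H] subgroup.m_closed[OF H] by blast
        moreover have "h \<otimes> inv (inv x \<otimes> h) = x"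
          using x True HG by (auto simp: inv_mult_group m_assoc[symmetric])
        ultimately show False using False by simp
      qed
      then show ?thesis by (simp add: left_regular_def \<xi>_def)
    qed (simp add: \<eta>_def)
    then have "(\<lambda>h. left_regular G x \<xi> h * cnj (\<eta> h)) = (\<lambda>h. 0)" by (rule ext)
    then have "l2_inner (carrier G) (left_regular G x \<xi>) \<eta> = 0" unfolding l2_inner_def by (simp only: infsum_0_simp)
    then show ?thesis using out[of x] x False by simp
  qed
  with \<xi> \<eta> show ?thesis unfolding fourier_algebra_def by blast
qed

theorem theorem8p9:
  fixes \<Gamma> :: "('a, 'm) monoid_scheme" and E :: "'a set"
    and K :: "('k, 'n) monoid_scheme" and T :: "'k topology"
  assumes "group \<Gamma>" and "E \<subseteq> carrier \<Gamma>"
    and "locally_compact_group K T"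
    and "convergently_embedded \<Gamma> E K T"
  shows "Riesz_set \<Gamma> E"
  unfolding Riesz_set_def
proof (intro ballI impI)
  interpret \<Gamma>: group \<Gamma> by fact
  have "group K" using assms(3) by (simp add: locally_compact_group_def)
  then interpret K: lc_group K T by (intro lc_group.intro lc_group_axioms.intro assms(3))
  \<comment> \<open>\<open>\<alpha>\<close> lives on the generated subgroup only, so the argument is
    carried out there; \<open>fourier_algebraI\<close> returns to \<open>\<Gamma>\<close>.\<close>
  define H where "H = subgroup_generated \<Gamma> E"
  interpret H: group H unfolding H_def by simp
  have H_sub: "carrier H \<subseteq> carrier \<Gamma>" unfolding H_def by (rule \<Gamma>.carrier_subgroup_generated_subset)
  have E_sub: "E \<subseteq> carrier H"
    unfolding H_def by (rule \<Gamma>.subgroup_generated_subset_carrier_subset[OF assms(2)])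
  have H_ops: "x \<otimes>\<^bsub>H\<^esub> y = x \<otimes>\<^bsub>\<Gamma>\<^esub> y" "\<one>\<^bsub>H\<^esub> = \<one>\<^bsub>\<Gamma>\<^esub>" for x y by (simp_all add: H_def)
  have H_subgroup: "subgroup (carrier H) \<Gamma>" unfolding H_def by (rule \<Gamma>.subgroup_subgroup_generated)
  obtain \<alpha> p where \<alpha>: "\<alpha> \<in> hom H K" "inj_on \<alpha> (carrier H)"
    and cpt: "compactin T (T closure_of (\<alpha> ` E))" and lim: "T derived_set_of (\<alpha> ` E) = {p}"
    using assms(4) unfolding convergently_embedded_def H_def by blast
  have p: "p \<in> carrier K" using lim derived_set_of_subset_topspace[of T "\<alpha> ` E"] by simp
  have \<alpha>E: "\<alpha> ` E \<subseteq> carrier K" using \<alpha>(1) E_sub by (auto simp: hom_def)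
  obtain I where "haar_group K T I" using K.ex_haar_group by blast
  then interpret haar: haar_group K T I .
  fix u assume u_in: "u \<in> fourier_stieltjes_algebra \<Gamma>" and u0: "\<forall>x\<in>carrier \<Gamma> - E. u x = 0"
  from u_in obtain n c \<phi> where \<phi>: "\<forall>i<(n::nat). positive_definite \<Gamma> (\<phi> i)"
    and u: "\<forall>x\<in>carrier \<Gamma>. u x = (\<Sum>i<n. c i * \<phi> i x)"
    unfolding fourier_stieltjes_algebra_def mem_Collect_eq by (elim exE conjE)
  obtain e :: "'a \<times> (nat \<Rightarrow> complex) \<Rightarrow> ('a \<times> (nat \<Rightarrow> complex)) ell2" where
    e: "\<forall>g\<in>carrier \<Gamma>. \<forall>h\<in>carrier \<Gamma>. \<forall>s t.
      e (g, s) \<bullet> e (h, t) = Re (\<Sum>i<n. cnj (s i) * t i * \<phi> i (inv\<^bsub>\<Gamma>\<^esub> g \<otimes>\<^bsub>\<Gamma>\<^esub> h))"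
    using \<Gamma>.positive_definite_realization[of n \<phi>] \<phi> by blast
  interpret tensor_rep H K T I \<alpha> e
  proof (intro tensor_rep.intro tensor_rep_axioms.intro H.is_group haar.haar_group_axioms \<alpha>(1))
    fix h g g' s s' assume *: "h \<in> carrier H" "g \<in> carrier H" "g' \<in> carrier H"
    then have **: "h \<in> carrier \<Gamma>" "g \<in> carrier \<Gamma>" "g' \<in> carrier \<Gamma>" using H_sub by auto
    have "inv\<^bsub>\<Gamma>\<^esub> (h \<otimes>\<^bsub>\<Gamma>\<^esub> g) \<otimes>\<^bsub>\<Gamma>\<^esub> (h \<otimes>\<^bsub>\<Gamma>\<^esub> g') = inv\<^bsub>\<Gamma>\<^esub> g \<otimes>\<^bsub>\<Gamma>\<^esub> g'"
    proof -
      have "inv\<^bsub>\<Gamma>\<^esub> (h \<otimes>\<^bsub>\<Gamma>\<^esub> g) \<otimes>\<^bsub>\<Gamma>\<^esub> (h \<otimes>\<^bsub>\<Gamma>\<^esub> g')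
          = inv\<^bsub>\<Gamma>\<^esub> g \<otimes>\<^bsub>\<Gamma>\<^esub> (inv\<^bsub>\<Gamma>\<^esub> h \<otimes>\<^bsub>\<Gamma>\<^esub> (h \<otimes>\<^bsub>\<Gamma>\<^esub> g'))"
        using ** by (simp add: \<Gamma>.inv_mult_group \<Gamma>.m_assoc)
      also have "inv\<^bsub>\<Gamma>\<^esub> h \<otimes>\<^bsub>\<Gamma>\<^esub> (h \<otimes>\<^bsub>\<Gamma>\<^esub> g') = g'" using ** by (simp add: \<Gamma>.m_assoc[symmetric])
      finally show ?thesis .
    qed
    then show "e (h \<otimes>\<^bsub>H\<^esub> g, s) \<bullet> e (h \<otimes>\<^bsub>H\<^esub> g', s') = e (g, s) \<bullet> e (g', s')"
      using e ** by (simp add: H_ops)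
  qed
  \<comment> \<open>All coefficients are taken of the vector tagged \<open>s1\<close>. The
    conjugates cancel the one in the realization, and the factor \<open>- \<i>\<close> turns a real
    part into an imaginary one.\<close>
  define s1 s2 s3 :: "nat \<Rightarrow> complex" where "s1 i = 1" and "s2 i = cnj (c i)" and "s3 i = cnj (- \<i> * c i)" for i
  have eu: "e (x, s1) \<bullet> e (\<one>\<^bsub>H\<^esub>, s2) = Re (u x)" "e (x, s1) \<bullet> e (\<one>\<^bsub>H\<^esub>, s3) = Im (u x)" if x: "x \<in> carrier \<Gamma>" for x
  proof -
    have "e (x, s1) \<bullet> e (\<one>\<^bsub>H\<^esub>, s2) = Re (\<Sum>i<n. c i * \<phi> i x)"
      using e x by (subst inner_commute) (simp add: H_ops s1_def s2_def)
    then show "e (x, s1) \<bullet> e (\<one>\<^bsub>H\<^esub>, s2) = Re (u x)" using u x by simp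
    have "e (x, s1) \<bullet> e (\<one>\<^bsub>H\<^esub>, s3) = Re (\<Sum>i<n. - \<i> * (c i * \<phi> i x))"
      using e x by (subst inner_commute) (simp add: H_ops s1_def s3_def mult.assoc)
    also have "\<dots> = Im (u x)" using u x by (simp add: Re_sum Im_sum add.commute)
    finally show "e (x, s1) \<bullet> e (\<one>\<^bsub>H\<^esub>, s3) = Im (u x)" .
  qed
  have far: "finite {x \<in> E. inv\<^bsub>K\<^esub> p \<otimes>\<^bsub>K\<^esub> \<alpha> x \<notin> V}" if "openin T V" "\<one>\<^bsub>K\<^esub> \<in> V" for V
    by (rule K.finite_far_points[OF inj_on_subset[OF \<alpha>(2) E_sub] cpt \<alpha>E lim that])
  have supp: "e (x, s1) \<bullet> e (\<one>\<^bsub>H\<^esub>, s') = 0" if "s' \<in> {s2, s3}" "x \<in> carrier H - E" for s' x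
    using that H_sub eu[of x] u0 by auto
  have "\<exists>w. w \<in> R.ac_part \<and>
      (\<forall>s'\<in>{s2, s3}. \<exists>Y. finite {x \<in> carrier H. e (x, s1) \<bullet> e (\<one>\<^bsub>H\<^esub>, s') \<noteq> U x w \<bullet> Y})"
  proof (rule restricted_coefficients_ac[where S' = "{s2, s3}" and s = s1, OF \<alpha>(2) p E_sub])
    show "finite {x \<in> E. inv\<^bsub>K\<^esub> p \<otimes>\<^bsub>K\<^esub> \<alpha> x \<notin> V}" if "openin T V" "\<one>\<^bsub>K\<^esub> \<in> V" for V
      using that by (rule far)
    show "e (x, s1) \<bullet> e (\<one>\<^bsub>H\<^esub>, s') = 0" if "s' \<in> {s2, s3}" "x \<in> carrier H - E" for s' x
      using that by (rule supp)
    fix w assume w1: "w \<in> R.ac_part" and w2: "\<And>s'. s' \<in> {s2, s3} \<Longrightarrow>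
      \<exists>Y. finite {x \<in> carrier H. e (x, s1) \<bullet> e (\<one>\<^bsub>H\<^esub>, s') \<noteq> U x w \<bullet> Y}"
    show ?thesis by (rule exI[of _ w]) (rule conjI[OF w1 ballI[OF w2]])
  qed
  then obtain w where w: "w \<in> R.ac_part"
    "\<forall>s'\<in>{s2, s3}. \<exists>Y. finite {x \<in> carrier H. e (x, s1) \<bullet> e (\<one>\<^bsub>H\<^esub>, s') \<noteq> U x w \<bullet> Y}"
    by (elim exE conjE)
  have "\<exists>\<zeta> :: 'a ell2. \<forall>Y y0. \<exists>y. \<forall>g\<in>carrier H. U g w \<bullet> Y + coord y0 g = left_shift H g \<zeta> \<bullet> y"
  proof (rule R.ac_coefficient_regular[OF w(1)])
    fix \<zeta> :: "'a ell2"
    assume \<zeta>: "\<And>Y y0. \<exists>y. \<forall>g\<in>carrier H. U g w \<bullet> Y + coord y0 g = left_shift H g \<zeta> \<bullet> y"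
    show ?thesis by (rule exI[of _ \<zeta>]) (rule allI[OF allI[OF \<zeta>]])
  qed
  then obtain \<zeta> :: "'a ell2" where
    \<zeta>: "\<forall>Y y0. \<exists>y. \<forall>g\<in>carrier H. U g w \<bullet> Y + coord y0 g = left_shift H g \<zeta> \<bullet> y"
    by (elim exE)
  have rep: "\<exists>y. \<forall>x\<in>carrier H. e (x, s1) \<bullet> e (\<one>\<^bsub>H\<^esub>, s') = left_shift H x \<zeta> \<bullet> y" if s': "s' \<in> {s2, s3}" for s'
  proof -
    obtain Y where fin: "finite {x \<in> carrier H. e (x, s1) \<bullet> e (\<one>\<^bsub>H\<^esub>, s') \<noteq> U x w \<bullet> Y}" using w(2) s' by blast
    \<comment> \<open>The finitely many discrepancies form a square-summable family, which is handed
      over as \<open>y0\<close>.\<close>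
    define d where "d x = (if x \<in> carrier H then e (x, s1) \<bullet> e (\<one>\<^bsub>H\<^esub>, s') - U x w \<bullet> Y else 0)" for x
    have "finite {x. d x \<noteq> 0}" by (rule finite_subset[OF _ fin]) (auto simp: d_def)
    then have "(\<lambda>x. (d x)\<^sup>2) summable_on {x. d x \<noteq> 0}" by (rule summable_on_finite)
    then have "(\<lambda>x. (d x)\<^sup>2) summable_on UNIV" by (rule summable_on_cong_neutral[THEN iffD1, rotated -1]) auto
    then have "coord (Abs_ell2 d) = d" by (simp add: Abs_ell2_inverse)
    then show ?thesis using \<zeta>[rule_format, of Y "Abs_ell2 d"] by (simp add: d_def)
  qed
  obtain y1 y2 where
    y1: "\<forall>x\<in>carrier H. e (x, s1) \<bullet> e (\<one>\<^bsub>H\<^esub>, s2) = left_shift H x \<zeta> \<bullet> y1" and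
    y2: "\<forall>x\<in>carrier H. e (x, s1) \<bullet> e (\<one>\<^bsub>H\<^esub>, s3) = left_shift H x \<zeta> \<bullet> y2"
    using rep[of s2] rep[of s3] by auto
  show "u \<in> fourier_algebra \<Gamma>"
  proof (rule \<Gamma>.fourier_algebraI[OF H_subgroup])
    show "H = \<Gamma>\<lparr>carrier := carrier H\<rparr>" by (simp add: H_def subgroup_generated_def)
    show "Re (u x) = left_shift H x \<zeta> \<bullet> y1" "Im (u x) = left_shift H x \<zeta> \<bullet> y2" if "x \<in> carrier H" for x
      using that y1 y2 eu[of x] H_sub by auto
    show "u x = 0" if "x \<in> carrier \<Gamma> - carrier H" for x using that u0 E_sub by auto
  qed
qed

end
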